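(* Each of the following decision problems can be solved in time polynomial in the size of the input: given two TRSs $R_1,R_2$, decide whether $R_1\cong_{\mathbf{LE}}R_2$; whether $R_1\cong_{\mathbf{LVE}}R_2$; whether $R_1\cong_{\mathbf{LFE}}R_2$.
   Context: Terms and TRSs: $\mathcal{F}$ is a finite set of function symbols with arity map $\mathrm{ar}:\mathcal{F}\to\mathbb{N}_0$, $\mathcal{V}$ a finite set of variables disjoint from $\mathcal{F}$, and $T(\mathcal{F},\mathcal{V})$ the usual set of first-order terms over them. A term rewriting system (TRS) is a triple $R=(\mathcal{F},\mathcal{V},\mathcal{R})$ where $\mathcal{R}$ is a finite set of rules $\ell\to r$ with $\ell,r\in T(\mathcal{F},\mathcal{V})$, $\ell\notin\mathcal{V}$ and every variable of $r$ occurs in $\ell$; $\mathcal{F}$ and $\mathcal{V}$ contain all symbols occurring in the rules. Term isomorphisms: a term isomorphism $\phi:T(\mathcal{F},\mathcal{V})\to T(\mathcal{F}',\mathcal{V}')$ is a pair of bijections $\phi_{\mathcal{F}}:\mathcal{F}\to\mathcal{F}'$ with $\mathrm{ar}'(\phi_{\mathcal{F}}(f))=\mathrm{ar}(f)$ for all $f$, and $\phi_{\mathcal{V}}:\mathcal{V}\to\mathcal{V}'$, extended homomorphically to terms. It is $\mathcal{V}$-invariant if $\mathcal{V}=\mathcal{V}'$ and $\phi_{\mathcal{V}}=\mathrm{id}$, and $\mathcal{F}$-invariant if $\mathcal{F}=\mathcal{F}'$ (with equal arities) and $\phi_{\mathcal{F}}=\mathrm{id}$. Normal forms: two distinct rules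 $\ell\to r$, $\ell'\to r'$ of $\mathcal{R}$ are equivalent (resp. $\mathcal{V}$-equivalent, resp. $\mathcal{F}$-equivalent) if there is a term isomorphism (resp. an $\mathcal{F}$-invariant one, resp. a $\mathcal{V}$-invariant one) $\phi:T(\mathcal{F},\mathcal{V})\to T(\mathcal{F},\mathcal{V})$ with $\phi(\ell)=\ell'$ and $\phi(r)=r'$. $R$ is in normal form (resp. $\mathcal{V}$-normal form, resp. $\mathcal{F}$-normal form) if $\mathcal{R}$ contains no pair of equivalent (resp. $\mathcal{V}$-equivalent, resp. $\mathcal{F}$-equivalent) rules. Local TRS isomorphisms: for $R=(\mathcal{F},\mathcal{V},\mathcal{R})$ with $\mathcal{R}=\{\ell_1\to r_1,\dots,\ell_n\to r_n\}$ and $R'=(\mathcal{F}',\mathcal{V}',\mathcal{R}')$, a local isomorphism is a family $(\phi_1,\dots,\phi_n)$ of term isomorphisms $T(\mathcal{F},\mathcal{V})\to T(\mathcal{F}',\mathcal{V}')$ with $\{\phi_i(\ell_i)\to\phi_i(r_i):1\le i\le n\}=\mathcal{R}'$. $R\cong_{\mathbf{LE}}R'$ if both are in normal form and a local isomorphism exists; $R\cong_{\mathbf{LVE}}R'$ if both are in $\mathcal{V}$-normal form and there is a local isomorphism all of whose $\phi_i$ are $\mathcal{F}$-invariant; $R\cong_{\mathbf{LFE}}R'$ if both are in $\mathcal{F}$-normal form and there is a local isomorphism all of whose $\phi_i$ are $\mathcal{V}$-invariant. *)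

theory Defs
  imports Main
begin

text \<open>Function symbols and variables are both represented by natural numbers,
  but live in different constructors, so the two sets are disjoint.\<close>

datatype trm = Var nat | Fun nat "trm list"

fun vars_trm :: "trm \<Rightarrow> nat set" where
  "vars_trm (Var x) = {x}"
| "vars_trm (Fun f ts) = (\<Union>t\<in>set ts. vars_trm t)"

fun wf_trm :: "nat set \<Rightarrow> (nat \<Rightarrow> nat) \<Rightarrow> nat set \<Rightarrow> trm \<Rightarrow> bool" where
  "wf_trm F ar V (Var x) = (x \<in> V)"
| "wf_trm F ar V (Fun f ts) = (f \<in> F \<and> length ts = ar f \<and> (\<forall>t\<in>set ts. wf_trm F ar V t))"

type_synonym trs = "nat set \<times> (nat \<Rightarrow> nat) \<times> nat set \<times> (trm \<times> trm) set"

definition is_trs :: "trs \<Rightarrow> bool" where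
  "is_trs T = (case T of (F, ar, V, R) \<Rightarrow>
     finite F \<and> finite V \<and> finite R \<and>
     (\<forall>(l, r)\<in>R. wf_trm F ar V l \<and> wf_trm F ar V r \<and>
        (\<forall>x. l \<noteq> Var x) \<and> vars_trm r \<subseteq> vars_trm l))"

fun ren :: "(nat \<Rightarrow> nat) \<Rightarrow> (nat \<Rightarrow> nat) \<Rightarrow> trm \<Rightarrow> trm" where
  "ren pf pv (Var x) = Var (pv x)"
| "ren pf pv (Fun f ts) = Fun (pf f) (map (ren pf pv) ts)"

definition term_iso :: "trs \<Rightarrow> trs \<Rightarrow> (nat \<Rightarrow> nat) \<Rightarrow> (nat \<Rightarrow> nat) \<Rightarrow> bool" where
  "term_iso T T' pf pv = (case T of (F, ar, V, _) \<Rightarrow> case T' of (F', ar', V', _) \<Rightarrow>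
     bij_betw pf F F' \<and> (\<forall>f\<in>F. ar' (pf f) = ar f) \<and> bij_betw pv V V')"

text \<open>The three flavours: LE (arbitrary term isomorphisms),
  LVE (F-invariant isomorphisms), LFE (V-invariant isomorphisms).\<close>
datatype mode = LE | LVE | LFE

definition mode_ok :: "mode \<Rightarrow> trs \<Rightarrow> trs \<Rightarrow> (nat \<Rightarrow> nat) \<Rightarrow> (nat \<Rightarrow> nat) \<Rightarrow> bool" where
  "mode_ok m T T' pf pv = (case T of (F, ar, V, _) \<Rightarrow> case T' of (F', ar', V', _) \<Rightarrow>
     (case m of
        LE \<Rightarrow> True
      | LVE \<Rightarrow> F = F' \<and> (\<forall>f\<in>F. ar' f = ar f) \<and> (\<forall>f\<in>F. pf f = f)
      | LFE \<Rightarrow> V = V' \<and> (\<forall>x\<in>V. pv x = x)))"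

definition iso_m :: "mode \<Rightarrow> trs \<Rightarrow> trs \<Rightarrow> (nat \<Rightarrow> nat) \<Rightarrow> (nat \<Rightarrow> nat) \<Rightarrow> bool" where
  "iso_m m T T' pf pv = (term_iso T T' pf pv \<and> mode_ok m T T' pf pv)"

definition rules :: "trs \<Rightarrow> (trm \<times> trm) set" where
  "rules T = snd (snd (snd T))"

definition normal_form :: "mode \<Rightarrow> trs \<Rightarrow> bool" where
  "normal_form m T = (\<not> (\<exists>l r l' r'. (l, r) \<in> rules T \<and> (l', r') \<in> rules T \<and> (l, r) \<noteq> (l', r') \<and>
      (\<exists>pf pv. iso_m m T T pf pv \<and> ren pf pv l = l' \<and> ren pf pv r = r')))"

definition local_iso :: "mode \<Rightarrow> trs \<Rightarrow> trs \<Rightarrow> bool" where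
  "local_iso m T T' = (\<exists>PF PV :: trm \<times> trm \<Rightarrow> nat \<Rightarrow> nat.
      (\<forall>\<rho>\<in>rules T. iso_m m T T' (PF \<rho>) (PV \<rho>)) \<and>
      (\<lambda>\<rho>. (ren (PF \<rho>) (PV \<rho>) (fst \<rho>), ren (PF \<rho>) (PV \<rho>) (snd \<rho>))) ` rules T = rules T')"

definition trs_iso :: "mode \<Rightarrow> trs \<Rightarrow> trs \<Rightarrow> bool" where
  "trs_iso m T T' = (normal_form m T \<and> normal_form m T' \<and> local_iso m T T')"

type_synonym trs_rep = "(nat \<times> nat) list \<times> nat list \<times> (trm \<times> trm) list"

definition abs_rep :: "trs_rep \<Rightarrow> trs" where
  "abs_rep x = (case x of (Fs, Vs, Rs) \<Rightarrow>
     (fst ` set Fs, (\<lambda>f. case map_of Fs f of Some a \<Rightarrow> a | None \<Rightarrow> 0), set Vs, set Rs))"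

definition valid_rep :: "trs_rep \<Rightarrow> bool" where
  "valid_rep x = (distinct (map fst (fst x)) \<and> is_trs (abs_rep x))"

text \<open>Encoding into words over the alphabet {1,...,7}: binary digits 1,2;
  3 = open bracket, 4 = close bracket, 5 = separator, 6 = Var tag, 7 = Fun tag.\<close>
fun bin :: "nat \<Rightarrow> nat list" where
  "bin n = (if n = 0 then [] else (1 + n mod 2) # bin (n div 2))"

definition enc_nat :: "nat \<Rightarrow> nat list" where
  "enc_nat n = [3] @ bin n @ [4]"

definition enc_list :: "('a \<Rightarrow> nat list) \<Rightarrow> 'a list \<Rightarrow> nat list" where
  "enc_list e xs = [3] @ concat (map (\<lambda>x. e x @ [5]) xs) @ [4]"

fun enc_trm :: "trm \<Rightarrow> nat list" where
  "enc_trm (Var x) = 6 # enc_nat x"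
| "enc_trm (Fun f ts) = 7 # enc_nat f @ [3] @ concat (map (\<lambda>t. enc_trm t @ [5]) ts) @ [4]"

definition enc_rep :: "trs_rep \<Rightarrow> nat list" where
  "enc_rep x = (case x of (Fs, Vs, Rs) \<Rightarrow>
     enc_list (\<lambda>(f, a). enc_nat f @ enc_nat a) Fs @ enc_list enc_nat Vs @
     enc_list (\<lambda>(l, r). enc_trm l @ enc_trm r) Rs)"

definition enc_pair :: "trs_rep \<times> trs_rep \<Rightarrow> nat list" where
  "enc_pair p = enc_rep (fst p) @ enc_rep (snd p)"

datatype dir = Left | Right | Stay

text \<open>States 0..nstates-1, tape symbols 0..nsyms-1 (0 = blank); start state 0,
  halting states 1 (accept) and 2 (reject).\<close>
record tm =
  nstates :: nat
  nsyms :: nat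
  delta :: "nat \<Rightarrow> nat \<Rightarrow> nat \<times> nat \<times> dir"

definition wf_tm :: "tm \<Rightarrow> bool" where
  "wf_tm M = (nstates M \<ge> 3 \<and> nsyms M \<ge> 8 \<and>
     (\<forall>q<nstates M. \<forall>a<nsyms M. case delta M q a of (q', b, d) \<Rightarrow> q' < nstates M \<and> b < nsyms M))"

text \<open>Configuration: state, tape left of head (reversed), tape from head on.\<close>
type_synonym config = "nat \<times> nat list \<times> nat list"

definition step :: "tm \<Rightarrow> config \<Rightarrow> config" where
  "step M c = (case c of (q, ls, rs) \<Rightarrow>
     if q = 1 \<or> q = 2 then c else
     (let a = (case rs of [] \<Rightarrow> 0 | b # _ \<Rightarrow> b) in
      case delta M q a of (q', b, d) \<Rightarrow>
        (case d of
           Stay \<Rightarrow> (q', ls, b # drop 1 rs)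
         | Left \<Rightarrow> (case ls of [] \<Rightarrow> (q', [], b # drop 1 rs)
                              | c' # ls' \<Rightarrow> (q', ls', c' # b # drop 1 rs))
         | Right \<Rightarrow> (q', b # ls, drop 1 rs))))"

definition run :: "tm \<Rightarrow> nat list \<Rightarrow> nat \<Rightarrow> config" where
  "run M w n = (step M ^^ n) (0, [], w)"

definition poly_time_decidable :: "('a \<Rightarrow> bool) \<Rightarrow> ('a \<Rightarrow> nat list) \<Rightarrow> ('a \<Rightarrow> bool) \<Rightarrow> bool" where
  "poly_time_decidable D enc P = (\<exists>M c k. wf_tm M \<and>
     (\<forall>x. D x \<longrightarrow> (\<exists>n. n \<le> c * (length (enc x) + 1) ^ k \<and>
         fst (run M (enc x) n) \<in> {1, 2} \<and>
         (fst (run M (enc x) n) = 1 \<longleftrightarrow> P x))))"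

end

theory Submission
  imports Defs "HOL-Library.Nat_Bijection"
begin

text \<open>
  Two rules are related by a term isomorphism iff they have the same shape, their occurrences of
  symbols correspond consistently, and this partial correspondence extends to all of the symbols;
  it does iff there are equally many function symbols of each arity and equally many variables
  (or equal sets of them, for the kind of symbols that has to be fixed).  Between TRSs in normal form, a
  local isomorphism exists iff this relation between rules is total and surjective.

  On the input word, all of this can be stated by bounded quantification over positions and by
  equality of numbers of positions: such counting yields the bracket depth, the rank of a symbol in
  its rule (hence corresponding occurrences in two rules), and offsets (hence equality of numerals).
  A statement of this kind is evaluated by a program with finitely many pointers into the word,
  whose loops all run once through the word, so it makes polynomially many steps.  A one-tape Turing
  machine stores the pointers as marks on the tape cells and performs each step in one sweep.
\<close>

section \<open>Pointer programs and their simulation\<close>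

text \<open>The problems are tractable because the isomorphisms of different rules are independent:
  no common renaming is searched for, and a pair of rules determines its own partial correspondence
  completely. Normal form does the rest. Matching is cancellative, so two partners of one rule in
  the other system match each other and hence coincide; partners may therefore be chosen
  arbitrarily. If the first system has no rules, the family is empty and the symbol sets impose no
  condition.

  The input lists shape the word predicates. Variables and rules may be listed repeatedly, so
  variables are counted by first occurrence, and equality of rules is itself tested as a match in
  which every symbol stays fixed. Numerals have unbounded length, so symbols are never stored in
  registers but compared in place.

  One primitive, equality of two counts over positions, also yields the quantifiers. Registers
  bounded by the length of the word suffice, because no count of positions exceeds it. The exponent
  of the time bound grows only with the nesting of counts in the formula, which is fixed for each
  problem.\<close>

datatype com = Inc nat | Zero nat | Sym nat nat | Less nat nat | Same nat nat
  | Flip | Seq com com | When com | Loop com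

text \<open>The value 0 behind the word is the tape blank, so position \<open>length w\<close>
  serves as end marker.\<close>

definition sym_at :: "nat list \<Rightarrow> nat \<Rightarrow> nat" where
  "sym_at w i = (if i < length w then w ! i else 0)"

lemma sym_at_less: "set w \<subseteq> {1..7} \<Longrightarrow> sym_at w i < 8"
  by (force simp: sym_at_def dest: nth_mem)

type_synonym pconf = "com list \<times> bool \<times> (nat \<Rightarrow> nat)"

text \<open>The list is a stack of continuations. Pointers are capped at \<open>length w\<close>,
  the blank cell behind the word. A loop tests the flag before every round, including the first, and
  ends once the flag is set.\<close>

fun pstep :: "nat list \<Rightarrow> pconf \<Rightarrow> pconf" where
  "pstep w ([], b, e) = ([], b, e)"
| "pstep w (Inc r # K, b, e) = (K, b, e(r := min (length w) (Suc (e r))))"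
| "pstep w (Zero r # K, b, e) = (K, b, e(r := 0))"
| "pstep w (Sym r a # K, b, e) = (K, sym_at w (e r) = a, e)"
| "pstep w (Less r s # K, b, e) = (K, e r < e s, e)"
| "pstep w (Same r s # K, b, e) = (K, e r = e s, e)"
| "pstep w (Flip # K, b, e) = (K, \<not> b, e)"
| "pstep w (Seq c d # K, b, e) = (c # d # K, b, e)"
| "pstep w (When c # K, b, e) = (if b then c # K else K, b, e)"
| "pstep w (Loop c # K, b, e) = (if b then K else c # Loop c # K, b, e)"

text \<open>The stacks that can occur between pushing \<open>c\<close> on \<open>K\<close> and
  uncovering \<open>K\<close>. A loop runs its body on top of itself, so stacks do not grow from
  round to round; being finitely many, they can be part of the machine's control state.\<close>

fun reach :: "com \<Rightarrow> com list \<Rightarrow> com list set" where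
  "reach (Seq c d) K = insert (Seq c d # K) (reach c (d # K) \<union> reach d K)"
| "reach (When c) K = insert (When c # K) (reach c K)"
| "reach (Loop c) K = insert (Loop c # K) (reach c (Loop c # K))"
| "reach c K = {c # K}"

lemma finite_reach: "finite (reach c K)"
  by (induction c arbitrary: K) auto

lemma reach_start: "c # K \<in> reach c K"
  by (cases c) auto

text \<open>The stack \<open>K\<close> below has to be general: the first half of a sequence runs on
  top of the second half, and a loop body on top of the loop.\<close>

lemma reach_closed:
  "S \<in> reach c K \<Longrightarrow> fst (pstep w (S, b, e)) \<in> insert K (reach c K)"
proof (induction c arbitrary: K)
  case (Seq c d)
  from Seq.prems consider "S = Seq c d # K" | "S \<in> reach c (d # K)" | "S \<in> reach d K" by auto
  then show ?case
  proof cases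
    case 2
    then show ?thesis using Seq.IH(1)[of "d # K"] reach_start[of d K] by auto
  next
    case 3
    then show ?thesis using Seq.IH(2)[of K] by auto
  qed (use reach_start[of c "d # K"] in auto)
next
  case (When c)
  then show ?case using reach_start[of c K] by (cases "S = When c # K") auto
next
  case (Loop c)
  then show ?case using reach_start[of c "Loop c # K"] by (cases "S = Loop c # K") auto
qed auto

fun regs :: "com \<Rightarrow> nat set" where
  "regs (Inc r) = {r}"
| "regs (Zero r) = {r}"
| "regs (Sym r a) = {r}"
| "regs (Less r s) = {r, s}"
| "regs (Same r s) = {r, s}"
| "regs Flip = {}"
| "regs (Seq c d) = regs c \<union> regs d"
| "regs (When c) = regs c"
| "regs (Loop c) = regs c"

lemma finite_regs: "finite (regs c)"
  by (induction c) auto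

text \<open>A tape symbol consists of an input symbol and a set of marks; without marks, it is the input
  symbol itself, so that the input is a valid tape.  Mark \<open>k\<close> (above all registers) is on the leftmost cell.\<close>

definition mk :: "nat \<Rightarrow> nat set \<Rightarrow> nat" where
  "mk a S = a + 8 * set_encode S"

definition base :: "nat \<Rightarrow> nat" where "base x = x mod 8"

definition marks :: "nat \<Rightarrow> nat set" where "marks x = set_decode (x div 8)"

lemma base_mk [simp]: "a < 8 \<Longrightarrow> base (mk a S) = a"
  by (simp add: base_def mk_def)

lemma marks_mk [simp]: "a < 8 \<Longrightarrow> finite S \<Longrightarrow> marks (mk a S) = S"
  by (simp add: marks_def mk_def)

lemma mk_empty [simp]: "mk a {} = a"
  by (simp add: mk_def)

text \<open>The largest code is that of \<open>{..k}\<close>, a sum of powers of two below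
  \<open>2 ^ Suc k\<close>; this fixes the size of the tape alphabet.\<close>

lemma mk_bound:
  assumes "a < 8" "S \<subseteq> {..k}"
  shows "mk a S < 8 * 2 ^ Suc k"
proof -
  have "set_encode S \<le> sum (\<lambda>i. 2 ^ i) {..k}"
    unfolding set_encode_def using assms(2) by (intro sum_mono2) auto
  also have "\<dots> < (2::nat) ^ Suc k"
    by (induction k) auto
  finally show ?thesis using assms(1) by (simp add: mk_def)
qed

section \<open>The transition function of the simulating machine\<close>

fun sweeping :: "com \<Rightarrow> bool" where
  "sweeping (Inc r) = True"
| "sweeping (Zero r) = True"
| "sweeping (Sym r a) = True"
| "sweeping (Less r s) = True"
| "sweeping (Same r s) = True"
| "sweeping c = False"

fun testing :: "com \<Rightarrow> bool" where
  "testing (Sym r a) = True"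
| "testing (Less r s) = True"
| "testing (Same r s) = True"
| "testing c = False"

text \<open>The two bits carried along a sweep: the first one says that a mark has to be put on the next cell
  (\<open>Inc\<close>) or that the first pointer has been passed (\<open>Less\<close>), the second one collects the answer of a test.\<close>

fun upd :: "nat \<Rightarrow> com \<Rightarrow> bool \<Rightarrow> bool \<Rightarrow> nat \<Rightarrow> bool \<times> bool \<times> nat" where
  "upd k (Inc r) g a x =
    (if g then (False, a, mk (base x) (insert r (marks x)))
     else if r \<in> marks x \<and> base x \<noteq> 0 then (True, a, mk (base x) (marks x - {r}))
     else (False, a, x))"
| "upd k (Zero r) g a x =
    (g, a, mk (base x) (if k \<in> marks x then insert r (marks x) else marks x - {r}))"
| "upd k (Sym r s) g a x = (g, a \<or> (r \<in> marks x \<and> base x = s), x)"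
| "upd k (Less r s) g a x = (g \<or> r \<in> marks x, a \<or> (g \<and> s \<in> marks x), x)"
| "upd k (Same r s) g a x = (g, a \<or> (r \<in> marks x \<and> s \<in> marks x), x)"
| "upd k c g a x = (g, a, x)"

datatype ctl = Init | Scan | Acc | Rej | Sweep "com list" bool bool bool | Back "com list" bool

text \<open>An instruction about pointers takes a sweep right to the first blank and back to mark
  \<open>k\<close>. The others change only stack and flag, so their successor is read off
  \<open>pstep\<close> with a dummy word and dummy pointers. An empty stack means termination, with
  the flag as answer.\<close>

fun delt :: "nat \<Rightarrow> com \<Rightarrow> ctl \<Rightarrow> nat \<Rightarrow> ctl \<times> nat \<times> dir" where
  "delt k c0 Init x = (Scan, mk (base x) {..k}, Right)"
| "delt k c0 Scan x = (if base x = 0 then (Back [c0] False, x, Stay) else (Scan, x, Right))"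
| "delt k c0 (Back K b) x =
    (if k \<in> marks x then (Sweep K b False False, x, Stay) else (Back K b, x, Left))"
| "delt k c0 (Sweep [] b g a) x = (if b then Acc else Rej, x, Stay)"
| "delt k c0 (Sweep (c # K) b g a) x =
    (if sweeping c then
       (case upd k c g a x of (g', a', x') \<Rightarrow>
          if base x = 0 then (Back K (if testing c then a' else b), x', Stay)
          else (Sweep (c # K) b g' a', x', Right))
     else (case pstep [] (c # K, b, (\<lambda>_. 0)) of (K', b', _) \<Rightarrow> (Sweep K' b' False False, x, Stay)))"
| "delt k c0 q x = (q, x, Stay)"

definition stacks :: "com \<Rightarrow> com list set" where
  "stacks c0 = insert [] (reach c0 [])"

definition ctls :: "com \<Rightarrow> ctl set" where
  "ctls c0 = {Init, Scan, Acc, Rej}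
     \<union> (\<lambda>(K, b, g, a). Sweep K b g a) ` (stacks c0 \<times> UNIV)
     \<union> (\<lambda>(K, b). Back K b) ` (stacks c0 \<times> UNIV)"

lemma finite_ctls: "finite (ctls c0)"
  unfolding ctls_def stacks_def by (simp add: finite_reach)

lemma ctls_iff [simp]:
  "Init \<in> ctls c0" "Scan \<in> ctls c0" "Acc \<in> ctls c0" "Rej \<in> ctls c0"
  "Sweep K b g a \<in> ctls c0 \<longleftrightarrow> K \<in> stacks c0"
  "Back K b \<in> ctls c0 \<longleftrightarrow> K \<in> stacks c0"
  by (auto simp: ctls_def image_iff)

lemma stacks_closed: "S \<in> stacks c0 \<Longrightarrow> fst (pstep w (S, b, e)) \<in> stacks c0"
  using reach_closed[of S c0 "[]" w b e] by (auto simp: stacks_def)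

text \<open>Every instruction ever executed uses only registers of the program, hence below
  \<open>k\<close>; so mark \<open>k\<close> stays free to identify the leftmost cell.\<close>

lemma reach_regs:
  "S \<in> reach c K \<Longrightarrow> c' \<in> set S \<Longrightarrow> regs c' \<subseteq> regs c \<union> (\<Union>d\<in>set K. regs d)"
proof (induction c arbitrary: K)
  case (Seq c d)
  from Seq.prems consider "S = Seq c d # K" | "S \<in> reach c (d # K)" | "S \<in> reach d K" by auto
  then show ?case
  proof cases
    case 2 then show ?thesis using Seq.IH(1)[of "d # K"] Seq.prems by fastforce
  next
    case 3 then show ?thesis using Seq.IH(2)[of "K"] Seq.prems by fastforce
  qed (use Seq.prems in auto)
next
  case (Loop c)
  from Loop.prems consider "S = Loop c # K" | "S \<in> reach c (Loop c # K)" by auto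
  then show ?case
  proof cases
    case 2 then show ?thesis using Loop.IH[of "Loop c # K"] Loop.prems by fastforce
  qed (use Loop.prems in auto)
next
  case (When c)
  from When.prems consider "S = When c # K" | "S \<in> reach c K" by auto
  then show ?case
  proof cases
    case 2 then show ?thesis using When.IH[of "K"] When.prems by fastforce
  qed (use When.prems in auto)
qed auto

section \<open>Correctness and running time of the simulation\<close>

locale pointer_tm =
  fixes c0 :: com and k :: nat and code :: "ctl \<Rightarrow> nat" and N :: nat
  assumes inj_code: "inj_on code (ctls c0)"
    and code_less: "\<And>q. q \<in> ctls c0 \<Longrightarrow> code q < N"
    and code_simps [simp]: "code Init = 0" "code Acc = 1" "code Rej = 2"
    and N3: "N \<ge> 3"
    and regs_less: "\<And>r. r \<in> regs c0 \<Longrightarrow> r < k"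
begin

text \<open>The defaults \<open>1\<close> and \<open>0\<close> make the whole table well-formed,
  also at numbers that code no control state and at symbols that never occur.\<close>

definition M :: tm where
  "M = \<lparr>nstates = N, nsyms = 8 * 2 ^ Suc k,
     delta = (\<lambda>s x. case delt k c0 (inv_into (ctls c0) code s) x of (q, y, d) \<Rightarrow>
       (if q \<in> ctls c0 then code q else 1, if y < 8 * 2 ^ Suc k then y else 0, d))\<rparr>"

lemma wf_M: "wf_tm M"
  using N3 unfolding wf_tm_def by (auto simp: M_def code_less split: prod.split)

lemma M_step:
  assumes "q \<in> ctls c0" "q \<noteq> Acc" "q \<noteq> Rej"
    and "delt k c0 q (case rs of [] \<Rightarrow> 0 | b # _ \<Rightarrow> b) = (q', y, d)"
    and "q' \<in> ctls c0" "y < 8 * 2 ^ Suc k"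
  shows "step M (code q, ls, rs) =
    (case d of Stay \<Rightarrow> (code q', ls, y # drop 1 rs)
     | Left \<Rightarrow> (case ls of [] \<Rightarrow> (code q', [], y # drop 1 rs)
                | c' # ls' \<Rightarrow> (code q', ls', c' # y # drop 1 rs))
     | Right \<Rightarrow> (code q', y # ls, drop 1 rs))"
proof -
  have "code q \<noteq> 1" "code q \<noteq> 2"
    using assms(1-3) inj_onD[OF inj_code, of q Acc] inj_onD[OF inj_code, of q Rej] by auto
  moreover have "inv_into (ctls c0) code (code q) = q"
    using inj_code assms(1) by simp
  ultimately show ?thesis
    using assms(4-6) by (cases d) (simp_all add: step_def M_def Let_def split: list.splits)
qed

text \<open>The functions \<open>g\<close> and \<open>a\<close> give the carried bits on arrival at
  each cell, \<open>T\<close> and \<open>T'\<close> the tape before and after. A whole sweep is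
  thereby reduced to a check of \<open>upd\<close> at single cells; cell \<open>n\<close> is the
  terminating blank.\<close>

lemma sweep_right:
  assumes "c # K \<in> stacks c0" "sweeping c"
    and "\<And>i. i \<le> n \<Longrightarrow> upd k c (g i) (a i) (T i) = (g (Suc i), a (Suc i), T' i)"
    and "\<And>i. i \<le> n \<Longrightarrow> base (T i) = 0 \<longleftrightarrow> i = n"
    and "\<And>i. i \<le> n \<Longrightarrow> T' i < 8 * 2 ^ Suc k"
  shows "(step M ^^ Suc n) (code (Sweep (c # K) b (g 0) (a 0)), [], map T [0..<Suc n]) =
    (code (Back K (if testing c then a (Suc n) else b)), rev (map T' [0..<n]), [T' n])"
proof -
  have K: "K \<in> stacks c0"
    using stacks_closed[OF assms(1), of "[]" b "\<lambda>_. 0"] assms(2) by (cases c) auto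
  have "i \<le> n \<Longrightarrow> (step M ^^ i) (code (Sweep (c # K) b (g 0) (a 0)), [], map T [0..<Suc n]) =
    (code (Sweep (c # K) b (g i) (a i)), rev (map T' [0..<i]), map T [i..<Suc n])" for i
  proof (induction i)
    case (Suc i)
    have "map T [i..<Suc n] = T i # map T [Suc i..<Suc n]"
      using Suc.prems by (simp add: upt_conv_Cons del: upt_Suc)
    moreover have "step M (code (Sweep (c # K) b (g i) (a i)), rev (map T' [0..<i]), T i # map T [Suc i..<Suc n])
      = (code (Sweep (c # K) b (g (Suc i)) (a (Suc i))), T' i # rev (map T' [0..<i]), map T [Suc i..<Suc n])"
      using Suc.prems assms by (subst M_step[where d = Right]) auto
    ultimately show ?case using Suc by simp
  qed simp
  from this[of n]
  have "(step M ^^ n) (code (Sweep (c # K) b (g 0) (a 0)), [], map T [0..<Suc n]) =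
    (code (Sweep (c # K) b (g n) (a n)), rev (map T' [0..<n]), [T n])" by simp
  moreover have "step M (code (Sweep (c # K) b (g n) (a n)), rev (map T' [0..<n]), [T n])
     = (code (Back K (if testing c then a (Suc n) else b)), rev (map T' [0..<n]), [T' n])"
    using assms K by (subst M_step[where d = Stay]) auto
  ultimately show ?thesis by simp
qed

text \<open>The machine cannot see the left end of its tape, so only mark \<open>k\<close> tells it
  where to stop.\<close>

lemma sweep_back:
  assumes "K \<in> stacks c0"
    and "\<And>i. i \<le> n \<Longrightarrow> k \<in> marks (T i) \<longleftrightarrow> i = 0"
    and "\<And>i. i \<le> n \<Longrightarrow> T i < 8 * 2 ^ Suc k"
  shows "(step M ^^ Suc n) (code (Back K b), rev (map T [0..<n]), [T n]) =
    (code (Sweep K b False False), [], map T [0..<Suc n])"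
proof -
  have "i \<le> n \<Longrightarrow> (step M ^^ i) (code (Back K b), rev (map T [0..<n]), [T n]) =
    (code (Back K b), rev (map T [0..<n - i]), map T [n - i..<Suc n])" for i
  proof (induction i)
    case (Suc i)
    define m where "m = n - Suc i"
    have m: "n - i = Suc m" "Suc m \<le> n" using Suc.prems by (auto simp: m_def)
    have "map T [Suc m..<Suc n] = T (Suc m) # map T [Suc (Suc m)..<Suc n]"
      using m by (simp add: upt_conv_Cons del: upt_Suc)
    moreover have "map T [m..<Suc n] = T m # T (Suc m) # map T [Suc (Suc m)..<Suc n]"
      using m by (simp add: upt_conv_Cons del: upt_Suc)
    moreover have "step M (code (Back K b), rev (map T [0..<Suc m]), T (Suc m) # map T [Suc (Suc m)..<Suc n])
      = (code (Back K b), rev (map T [0..<m]), T m # T (Suc m) # map T [Suc (Suc m)..<Suc n])"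
      using m assms by (subst M_step[where d = Left]) auto
    ultimately show ?case using Suc m by (simp flip: m_def)
  qed simp
  from this[of n]
  have "(step M ^^ n) (code (Back K b), rev (map T [0..<n]), [T n]) =
    (code (Back K b), [], map T [0..<Suc n])" by simp
  moreover have "map T [0..<Suc n] = T 0 # map T [Suc 0..<Suc n]"
    by (simp add: upt_conv_Cons del: upt_Suc)
  moreover have "step M (code (Back K b), [], T 0 # map T [Suc 0..<Suc n])
     = (code (Sweep K b False False), [], T 0 # map T [Suc 0..<Suc n])"
    using assms by (subst M_step[where d = Stay]) auto
  ultimately show ?thesis by simp
qed

definition cell :: "nat list \<Rightarrow> (nat \<Rightarrow> nat) \<Rightarrow> nat \<Rightarrow> nat" where
  "cell w e i = mk (sym_at w i) ({r. r < k \<and> e r = i} \<union> (if i = 0 then {k} else {}))"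

text \<open>The tape has one cell more than the word, since pointers may rest on the blank behind
  it.\<close>

definition conf :: "nat list \<Rightarrow> pconf \<Rightarrow> config" where
  "conf w = (\<lambda>(K, b, e). (code (Sweep K b False False), [], map (cell w e) [0..<Suc (length w)]))"

text \<open>The bound is \<open>length w + 1\<close> steps for the sweep to the right and as many
  for the way back; instructions on stack and flag alone take one step.\<close>

lemma simulate_pstep:
  assumes w: "set w \<subseteq> {1..7}" and e: "\<And>r. e r \<le> length w"
    and K: "c # K \<in> stacks c0"
  shows "\<exists>t \<le> 2 * length w + 2. (step M ^^ t) (conf w (c # K, b, e)) = conf w (pstep w (c # K, b, e))"
proof (cases "sweeping c")
  case False
  have "step M (conf w (c # K, b, e)) = conf w (pstep w (c # K, b, e))"
  proof -
    obtain K' b' e' where p: "pstep [] (c # K, b, (\<lambda>_. 0)) = (K', b', e')" by (cases "pstep [] (c # K, b, (\<lambda>_. 0))")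
    have p': "pstep w (c # K, b, e) = (K', b', e)" using p False by (cases c) auto
    have K': "K' \<in> stacks c0" using stacks_closed[OF K, of "[]" b "\<lambda>_. 0"] p by simp
    have "map (cell w e) [0..<Suc (length w)] = cell w e 0 # map (cell w e) [Suc 0..<Suc (length w)]"
      by (simp add: upt_conv_Cons del: upt_Suc)
    moreover have "cell w e 0 < 8 * 2 ^ Suc k"
      unfolding cell_def using w by (intro mk_bound) (auto simp: sym_at_less)
    ultimately show ?thesis using p K' K False unfolding conf_def p'
      by (simp del: upt_Suc) (subst M_step[where d = Stay]; simp)
  qed
  then show ?thesis by (intro exI[of _ 1]) simp
next
  case True
  let ?n = "length w"
  obtain K' b' e' where p: "pstep w (c # K, b, e) = (K', b', e')" by (cases "pstep w (c # K, b, e)")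
  have K': "K' = K" using p True by (cases c) auto
  have rk: "r \<in> regs c \<Longrightarrow> r < k" for r
    using K reach_regs[of "c # K" c0 "[]" c] regs_less by (auto simp: stacks_def)
  have sy: "i < ?n \<Longrightarrow> w ! i \<in> {1..7}" for i using w nth_mem by blast
  have sym8: "sym_at w i < 8" for i using sy[of i] by (auto simp: sym_at_def)
  have sym0: "i \<le> ?n \<Longrightarrow> sym_at w i = 0 \<longleftrightarrow> i = ?n" for i using sy[of i] by (auto simp: sym_at_def)
  have bc: "cell w e'' i < 8 * 2 ^ Suc k" for e'' i
    unfolding cell_def using sym8 by (intro mk_bound) auto
  have base: "base (cell w e'' i) = sym_at w i" for e'' i
    using sym8 by (simp add: cell_def)
  have mks: "marks (cell w e'' i) = {r. r < k \<and> e'' r = i} \<union> (if i = 0 then {k} else {})" for e'' i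
    using sym8 by (simp add: cell_def)
  have kk: "k \<in> marks (cell w e'' i) \<longleftrightarrow> i = 0" for e'' i by (auto simp: mks)
  \<comment> \<open>Closed forms of the two bits on arrival at cell \<open>i\<close>. For
    \<open>Less\<close> the answer is formed from the bit as it was before the current cell, which
    makes the comparison strict. For \<open>Inc\<close> the bound on \<open>i\<close> says that no
    mark is carried past the blank.\<close>
  define g :: "nat \<Rightarrow> bool" where "g i = (case c of Inc r \<Rightarrow> i = Suc (e r) \<and> i \<le> ?n | Less r s \<Rightarrow> e r < i | _ \<Rightarrow> False)" for i
  define a :: "nat \<Rightarrow> bool" where "a i = (case c of Sym r s \<Rightarrow> e r < i \<and> sym_at w (e r) = s
     | Less r s \<Rightarrow> e s < i \<and> e r < e s | Same r s \<Rightarrow> e r < i \<and> e r = e s | _ \<Rightarrow> False)" for i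
  have "upd k c (g i) (a i) (cell w e i) = (g (Suc i), a (Suc i), cell w e' i)" if "i \<le> ?n" for i
  proof (cases c)
    \<comment> \<open>The mark is lifted from its cell and dropped on the next one. On the blank it
      is left in place, which realises the cap \<open>min\<close>.\<close>
    case (Inc r)
    have "r < k" using rk Inc by simp
    have e': "e' = e(r := min ?n (Suc (e r)))" using p Inc by simp
    show ?thesis
    proof (cases "e r = i \<and> i < ?n")
      case T: True
      then have "marks (cell w e i) - {r} = {s. s < k \<and> e' s = i} \<union> (if i = 0 then {k} else {})"
        using \<open>r < k\<close> unfolding mks e' by auto
      moreover have "r \<in> marks (cell w e i)" using T \<open>r < k\<close> by (simp add: mks)
      moreover have "sym_at w i \<noteq> 0" using T sym0[of i] by simp
      ultimately show ?thesis using T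
        by (simp add: Inc g_def a_def base cell_def[of w e'])
    next
      case F: False
      show ?thesis
      proof (cases "i = Suc (e r)")
        case T: True
        then have "insert r (marks (cell w e i)) = {s. s < k \<and> e' s = i} \<union> (if i = 0 then {k} else {})"
          using \<open>r < k\<close> that unfolding mks e' by auto
        with T that show ?thesis
          by (simp add: Inc g_def a_def base cell_def[of w e'])
      next
        case F2: False
        have "(e' s = i) = (e s = i)" for s
          using F F2 that e[of r] unfolding e' by auto
        then have "cell w e' i = cell w e i" by (simp add: cell_def)
        moreover have "\<not> (r \<in> marks (cell w e i) \<and> sym_at w i \<noteq> 0)"
          using F \<open>r < k\<close> that sym0[of i] by (auto simp: mks split: if_splits)
        ultimately show ?thesis using F F2 that by (auto simp: Inc g_def a_def base)
      qed
    qed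
  next
    case (Zero r)
    have "r < k" using rk Zero by simp
    have e': "e' = e(r := 0)" using p Zero by simp
    have "(if k \<in> marks (cell w e i) then insert r (marks (cell w e i)) else marks (cell w e i) - {r})
      = {s. s < k \<and> e' s = i} \<union> (if i = 0 then {k} else {})"
      using \<open>r < k\<close> unfolding kk unfolding mks e' by auto
    then show ?thesis by (simp add: Zero g_def a_def base cell_def[of w e'])
  next
    case (Sym r s)
    then show ?thesis using p rk by (auto simp: g_def a_def base mks less_Suc_eq split: if_splits)
  next
    case (Less r s)
    then show ?thesis using p rk by (auto simp: g_def a_def base mks less_Suc_eq split: if_splits)
  next
    case (Same r s)
    then show ?thesis using p rk by (auto simp: g_def a_def base mks less_Suc_eq split: if_splits)
  qed (use True in auto)
  note u = this
  have g0: "g 0 = False" and a0: "a 0 = False" by (auto simp: g_def a_def split: com.splits)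
  have b': "(if testing c then a (Suc ?n) else b) = b'"
    using p e True by (cases c) (auto simp: a_def less_Suc_eq_le)
  have K2: "K \<in> stacks c0" using stacks_closed[OF K, of w b e] p K' by simp
  have "(step M ^^ Suc ?n) (conf w (c # K, b, e)) = (code (Back K b'), rev (map (cell w e') [0..<?n]), [cell w e' ?n])"
    using sweep_right[OF K True, where n = ?n and g = g and a = a and T = "cell w e" and T' = "cell w e'" and b = b,
      OF u] sym0 bc unfolding conf_def b' by (simp add: g0 a0 base del: upt_Suc funpow.simps)
  moreover have "(step M ^^ Suc ?n) (code (Back K b'), rev (map (cell w e') [0..<?n]), [cell w e' ?n])
     = conf w (K, b', e')"
    using sweep_back[OF K2, where n = ?n and T = "cell w e'"] kk bc by (simp add: conf_def del: upt_Suc funpow.simps)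
  ultimately have "(step M ^^ (Suc ?n + Suc ?n)) (conf w (c # K, b, e)) = conf w (K, b', e')"
    by (simp only: funpow_add o_apply)
  then show ?thesis unfolding p K' by (intro exI[of _ "Suc ?n + Suc ?n"]) (simp del: funpow.simps)
qed

lemma pstep_bounded:
  "(\<And>r. e r \<le> length w) \<Longrightarrow> pstep w (K, b, e) = (K', b', e') \<Longrightarrow> e' r \<le> length w"
  by (cases K; cases "hd K") (auto split: if_splits)

lemma simulate_psteps:
  assumes w: "set w \<subseteq> {1..7}" and e: "\<And>r. e r \<le> length w" and K: "K \<in> stacks c0"
  shows "\<exists>t \<le> m * (2 * length w + 2). (step M ^^ t) (conf w (K, b, e)) = conf w ((pstep w ^^ m) (K, b, e))"
  using e K
proof (induction m arbitrary: K b e)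
  case (Suc m)
  obtain K' b' e' where p: "pstep w (K, b, e) = (K', b', e')" by (cases "pstep w (K, b, e)")
  have "\<exists>t \<le> 2 * length w + 2. (step M ^^ t) (conf w (K, b, e)) = conf w (K', b', e')"
  proof (cases K)
    case Nil
    then show ?thesis using p by (intro exI[of _ 0]) auto
  next
    case (Cons c L)
    then show ?thesis using simulate_pstep[OF w, of e c L b] Suc.prems p by auto
  qed
  then obtain t where t: "t \<le> 2 * length w + 2" "(step M ^^ t) (conf w (K, b, e)) = conf w (K', b', e')" by blast
  have "\<And>r. e' r \<le> length w" using pstep_bounded[OF _ p] Suc.prems(1) by blast
  moreover have "K' \<in> stacks c0" using stacks_closed[OF Suc.prems(2), of w b e] p by simp
  ultimately obtain t' where t': "t' \<le> m * (2 * length w + 2)"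
    "(step M ^^ t') (conf w (K', b', e')) = conf w ((pstep w ^^ m) (K', b', e'))" using Suc.IH by blast
  have "(step M ^^ (t' + t)) (conf w (K, b, e)) = conf w ((pstep w ^^ Suc m) (K, b, e))"
    using t(2) t'(2) p by (simp add: funpow_add funpow_Suc_right del: funpow.simps)
  then show ?case using t(1) t'(1) by (intro exI[of _ "t' + t"]) (simp del: funpow.simps)
qed (intro exI[of _ 0], simp)

text \<open>All pointers start at 0, so the first cell gets every mark and all other cells are
  already correct as input symbols. The word is nonempty because the marked cell must differ from
  the blank that ends the scan.\<close>

lemma initialise:
  assumes w: "set w \<subseteq> {1..7}" "w \<noteq> []"
  shows "(step M ^^ (2 * length w + 2)) (0, [], w) = conf w ([c0], False, \<lambda>_. 0)"
proof -
  let ?n = "length w" and ?e = "\<lambda>_. 0 :: nat"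
  have sy: "i < ?n \<Longrightarrow> w ! i \<in> {1..7}" for i using w nth_mem by blast
  have sym8: "sym_at w i < 8" for i using sy[of i] by (auto simp: sym_at_def)
  have sym0: "i \<le> ?n \<Longrightarrow> sym_at w i = 0 \<longleftrightarrow> i = ?n" for i using sy[of i] by (auto simp: sym_at_def)
  have bc: "cell w e'' i < 8 * 2 ^ Suc k" for e'' i
    unfolding cell_def using sym8 by (intro mk_bound) auto
  have mks: "marks (cell w e'' i) = {r. r < k \<and> e'' r = i} \<union> (if i = 0 then {k} else {})" for e'' i
    using sym8 by (simp add: cell_def)
  have kk: "k \<in> marks (cell w e'' i) \<longleftrightarrow> i = 0" for e'' i by (auto simp: mks)
  have c0: "cell w ?e 0 = mk (w ! 0) {..k}"
    using w by (simp add: cell_def sym_at_def lessThan_def atMost_def) (rule arg_cong[of _ _ "mk (w ! 0)"], auto)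
  have cs: "0 < i \<Longrightarrow> cell w ?e i = sym_at w i" for i by (simp add: cell_def)
  have base: "base (w ! i) = w ! i" if "i < ?n" for i using sy[OF that] by (auto simp: base_def)
  have ck: "[c0] \<in> stacks c0" by (simp add: stacks_def reach_start)
  have scan: "Suc i \<le> ?n \<Longrightarrow> (step M ^^ Suc i) (0, [], w) = (code Scan, rev (map (cell w ?e) [0..<Suc i]), drop (Suc i) w)" for i
  proof (induction i)
    case 0
    have "step M (code Init, [], w) = (code Scan, [cell w ?e 0], drop 1 w)"
      using w c0 base[of 0] bc[of ?e 0] by (subst M_step[where d = Right]) (auto split: list.splits)
    then show ?case by simp
  next
    case (Suc i)
    have d: "drop (Suc i) w = w ! Suc i # drop (Suc (Suc i)) w" using Suc.prems by (simp add: Cons_nth_drop_Suc)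
    have *: "cell w ?e (Suc i) = w ! Suc i" using Suc.prems by (simp add: cs sym_at_def)
    have "step M (code Scan, rev (map (cell w ?e) [0..<Suc i]), drop (Suc i) w) =
      (code Scan, rev (map (cell w ?e) [0..<Suc (Suc i)]), drop (Suc (Suc i)) w)"
      unfolding d using base[of "Suc i"] sy[of "Suc i"] Suc.prems bc[of ?e "Suc i"] *
      by (subst M_step[where d = Right]) auto
    then show ?case using Suc by simp
  qed
  have "(step M ^^ ?n) (0, [], w) = (code Scan, rev (map (cell w ?e) [0..<?n]), [])"
    using scan[of "?n - 1"] w(2) by (cases w) auto
  moreover have "step M (code Scan, rev (map (cell w ?e) [0..<?n]), []) =
     (code (Back [c0] False), rev (map (cell w ?e) [0..<?n]), [cell w ?e ?n])"
    using ck cs[of ?n] w(2) by (subst M_step[where d = Stay]) (auto simp: base_def sym_at_def)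
  ultimately have "(step M ^^ Suc ?n) (0, [], w) = (code (Back [c0] False), rev (map (cell w ?e) [0..<?n]), [cell w ?e ?n])"
    by simp
  moreover have "(step M ^^ Suc ?n) (code (Back [c0] False), rev (map (cell w ?e) [0..<?n]), [cell w ?e ?n])
     = conf w ([c0], False, ?e)"
    using sweep_back[OF ck, where n = ?n and T = "cell w ?e"] kk bc by (simp add: conf_def del: upt_Suc funpow.simps)
  ultimately have "(step M ^^ (Suc ?n + Suc ?n)) (0, [], w) = conf w ([c0], False, ?e)"
    by (simp only: funpow_add o_apply)
  then show ?thesis by (simp add: mult_2 del: funpow.simps)
qed

text \<open>Of the two additional rounds in the bound, one pays for the initialisation and the other
  for the final halting step.\<close>

lemma decide:
  assumes w: "set w \<subseteq> {1..7}" "w \<noteq> []"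
    and m: "(pstep w ^^ m) ([c0], False, \<lambda>_. 0) = ([], b, e)"
  shows "\<exists>t \<le> (m + 2) * (2 * length w + 2).
    fst (run M w t) \<in> {1, 2} \<and> (fst (run M w t) = 1 \<longleftrightarrow> b)"
proof -
  have "[c0] \<in> stacks c0" by (simp add: stacks_def reach_start)
  then obtain t where t: "t \<le> m * (2 * length w + 2)"
    "(step M ^^ t) (conf w ([c0], False, \<lambda>_. 0)) = conf w ([], b, e)"
    using simulate_psteps[OF w(1), of "\<lambda>_. 0" "[c0]" m False] m by auto
  have "map (cell w e) [0..<Suc (length w)] = cell w e 0 # map (cell w e) [Suc 0..<Suc (length w)]"
    by (simp add: upt_conv_Cons del: upt_Suc)
  moreover have "cell w e 0 < 8 * 2 ^ Suc k"
    unfolding cell_def using w by (intro mk_bound) (auto simp: sym_at_less)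
  moreover have "[] \<in> stacks c0" by (simp add: stacks_def)
  ultimately have "step M (code (Sweep [] b False False), [], map (cell w e) [0..<Suc (length w)]) =
    (code (if b then Acc else Rej), [], map (cell w e) [0..<Suc (length w)])"
    by (subst M_step[where d = Stay]) (auto simp del: upt_Suc)
  then have "fst (step M (conf w ([], b, e))) = code (if b then Acc else Rej)"
    by (simp add: conf_def del: upt_Suc)
  moreover define s where "s = 2 * length w + 2"
  moreover have "(step M ^^ s) (0, [], w) = conf w ([c0], False, \<lambda>_. 0)"
    unfolding s_def by (rule initialise[OF w])
  ultimately have "fst (run M w (1 + (t + s))) = code (if b then Acc else Rej)"
    unfolding run_def funpow_add o_apply using t(2) by simp
  then show ?thesis using t(1) by (intro exI[of _ "1 + (t + s)"]) (auto simp: s_def)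
qed

end

lemma pointer_tm_exists:
  obtains k code N where "pointer_tm c0 k code N"
proof -
  obtain f :: "ctl \<Rightarrow> nat" and m where f: "f ` ctls c0 = {i. i < m}" "inj_on f (ctls c0)"
    using finite_imp_inj_to_nat_seg[OF finite_ctls[of c0]] by blast
  \<comment> \<open>The shift by 3 keeps clear of the start and halting states prescribed by the
    machine model.\<close>
  define code where "code q = (case q of Init \<Rightarrow> 0 | Acc \<Rightarrow> 1 | Rej \<Rightarrow> 2 | _ \<Rightarrow> f q + 3)" for q
  obtain k where k: "\<forall>r\<in>regs c0. r < k"
    using finite_regs[of c0] by (meson finite_nat_set_iff_bounded)
  have "pointer_tm c0 k code (m + 3)"
  proof
    show "inj_on code (ctls c0)"
      using f(2) by (auto simp: inj_on_def code_def split: ctl.splits)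
    show "q \<in> ctls c0 \<Longrightarrow> code q < m + 3" for q
      using f(1) by (auto simp: code_def split: ctl.splits)
  qed (use k in \<open>auto simp: code_def\<close>)
  then show ?thesis by (rule that)
qed

section \<open>Predicates decided by pointer programs\<close>

definition poly_bounded :: "(nat \<Rightarrow> nat) \<Rightarrow> bool" where
  "poly_bounded T \<longleftrightarrow> (\<exists>c k. \<forall>n. T n \<le> c * (n + 1) ^ k)"

lemma poly_bounded_const: "poly_bounded (\<lambda>_. c)"
  unfolding poly_bounded_def by (rule exI[of _ c], rule exI[of _ 0]) simp

lemma poly_bounded_id: "poly_bounded (\<lambda>n. n)"
  unfolding poly_bounded_def by (rule exI[of _ 1], rule exI[of _ 1]) simp

lemma poly_bounded_add:
  assumes "poly_bounded S" "poly_bounded T" shows "poly_bounded (\<lambda>n. S n + T n)"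
proof -
  obtain c k d l where S: "\<And>n. S n \<le> c * (n + 1) ^ k" and T: "\<And>n. T n \<le> d * (n + 1) ^ l"
    using assms unfolding poly_bounded_def by blast
  have "S n + T n \<le> (c + d) * (n + 1) ^ (k + l)" for n
  proof -
    have "(n + 1) ^ k \<le> (n + 1) ^ (k + l)" "(n + 1) ^ l \<le> (n + 1) ^ (k + l)"
      by (rule power_increasing; simp)+
    then have "S n \<le> c * (n + 1) ^ (k + l)" "T n \<le> d * (n + 1) ^ (k + l)"
      using S[of n] T[of n] le_trans mult_le_mono2 by blast+
    then show ?thesis by (simp add: add_mult_distrib)
  qed
  then show ?thesis unfolding poly_bounded_def by blast
qed

lemma poly_bounded_mult:
  assumes "poly_bounded S" "poly_bounded T" shows "poly_bounded (\<lambda>n. S n * T n)"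
proof -
  obtain c k d l where S: "\<And>n. S n \<le> c * (n + 1) ^ k" and T: "\<And>n. T n \<le> d * (n + 1) ^ l"
    using assms unfolding poly_bounded_def by blast
  have "S n * T n \<le> (c * d) * (n + 1) ^ (k + l)" for n
    using mult_le_mono[OF S[of n] T[of n]] by (simp add: power_add ac_simps)
  then show ?thesis unfolding poly_bounded_def by blast
qed

text \<open>The number of steps is chosen before the continuation \<open>K\<close>, so a run can be
  placed in any context and runs compose.\<close>

definition evals :: "nat list \<Rightarrow> nat \<Rightarrow> com \<Rightarrow> bool \<Rightarrow> (nat \<Rightarrow> nat) \<Rightarrow> bool \<Rightarrow> (nat \<Rightarrow> nat) \<Rightarrow> bool" where
  "evals w T c b e b' e' \<longleftrightarrow> (\<exists>t \<le> T. \<forall>K. (pstep w ^^ t) (c # K, b, e) = (K, b', e'))"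

lemma evals_mono: "evals w T c b e b' e' \<Longrightarrow> T \<le> U \<Longrightarrow> evals w U c b e b' e'"
  unfolding evals_def by (meson le_trans)

lemma evals_step: "(\<And>K. pstep w (c # K, b, e) = (K, b', e')) \<Longrightarrow> evals w 1 c b e b' e'"
  unfolding evals_def by (rule exI[of _ 1]) simp

lemma evals_unfold:
  assumes "\<And>K. pstep w (c # K, b, e) = (c1 # K, b, e)" "evals w T c1 b e b1 e1"
  shows "evals w (Suc T) c b e b1 e1"
proof -
  obtain t where "t \<le> T" "\<And>K. (pstep w ^^ t) (c1 # K, b, e) = (K, b1, e1)"
    using assms(2) unfolding evals_def by blast
  then show ?thesis unfolding evals_def
    by (intro exI[of _ "Suc t"]) (simp add: funpow_Suc_right assms(1) del: funpow.simps)
qed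

lemma evals_unfold2:
  assumes "\<And>K. pstep w (c # K, b, e) = (c1 # c2 # K, b, e)"
    and "evals w T c1 b e b1 e1" "evals w U c2 b1 e1 b2 e2"
  shows "evals w (Suc (T + U)) c b e b2 e2"
proof -
  obtain t where t: "t \<le> T" "\<And>K. (pstep w ^^ t) (c1 # K, b, e) = (K, b1, e1)"
    using assms(2) unfolding evals_def by blast
  obtain u where u: "u \<le> U" "\<And>K. (pstep w ^^ u) (c2 # K, b1, e1) = (K, b2, e2)"
    using assms(3) unfolding evals_def by blast
  have "(pstep w ^^ Suc (u + t)) (c # K, b, e) = (K, b2, e2)" for K
    by (simp add: funpow_Suc_right assms(1) funpow_add t u del: funpow.simps)
  then show ?thesis unfolding evals_def using t(1) u(1) by (intro exI[of _ "Suc (u + t)"]) simp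
qed

lemmas evals_Seq = evals_unfold2[of w "Seq c d" b e c d for w c d b e, OF pstep.simps(8)]

lemma evals_Loop:
  "evals w T c False e b1 e1 \<Longrightarrow> evals w U (Loop c) b1 e1 b2 e2 \<Longrightarrow>
    evals w (Suc (T + U)) (Loop c) False e b2 e2"
  by (erule (1) evals_unfold2[rotated]) simp

text \<open>The registers below \<open>d\<close> are the variables in scope and are preserved; all
  others are scratch space with arbitrary contents. This discipline lets programs be nested.\<close>

definition computes :: "(nat \<Rightarrow> nat) \<Rightarrow> com \<Rightarrow> nat \<Rightarrow> (nat list \<Rightarrow> (nat \<Rightarrow> nat) \<Rightarrow> bool) \<Rightarrow> bool" where
  "computes T c d P \<longleftrightarrow> (\<forall>w e b. set w \<subseteq> {1..7} \<longrightarrow> (\<forall>r. e r \<le> length w) \<longrightarrow>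
     (\<exists>e'. (\<forall>r. e' r \<le> length w) \<and> (\<forall>r<d. e' r = e r) \<and> evals w (T (length w)) c b e (P w e) e'))"

text \<open>The second conjunct makes the truth value insensitive to scratch registers, so it
  survives the execution of other subprograms.\<close>

definition dec :: "nat \<Rightarrow> (nat list \<Rightarrow> (nat \<Rightarrow> nat) \<Rightarrow> bool) \<Rightarrow> bool" where
  "dec d P \<longleftrightarrow> (\<exists>c T. poly_bounded T \<and> computes T c d P) \<and>
     (\<forall>w e e'. (\<forall>r<d. e r = e' r) \<longrightarrow> P w e = P w e')"

lemma decI:
  assumes "poly_bounded T" "computes T c d P"
    and "\<And>w e e'. (\<And>r. r < d \<Longrightarrow> e r = e' r) \<Longrightarrow> P w e = P w e'"
  shows "dec d P"
  unfolding dec_def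
proof (intro conjI exI[of _ c] exI[of _ T] assms(1,2) allI impI)
  show "P w e = P w e'" if "\<forall>r<d. e r = e' r" for w e e'
    by (rule assms(3)) (use that in simp)
qed

lemma dec_atom:
  assumes "\<And>w b e K. set w \<subseteq> {1..7} \<Longrightarrow> pstep w (c # K, b, e) = (K, P w e, e)"
    and "\<And>w e e'. (\<And>r. r < d \<Longrightarrow> e r = e' r) \<Longrightarrow> P w e = P w e'"
  shows "dec d P"
proof -
  have "computes (\<lambda>_. 1) c d P"
    unfolding computes_def
  proof (intro allI impI)
    fix w :: "nat list" and e :: "nat \<Rightarrow> nat" and b
    assume w: "set w \<subseteq> {1..7}" and e: "\<forall>r. e r \<le> length w"
    have "evals w 1 c b e (P w e) e" by (rule evals_step) (rule assms(1)[OF w])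
    with e show "\<exists>e'. (\<forall>r. e' r \<le> length w) \<and> (\<forall>r<d. e' r = e r) \<and> evals w 1 c b e (P w e) e'"
      by blast
  qed
  then show ?thesis by (rule decI[OF poly_bounded_const]) (rule assms(2))
qed

section \<open>Closure under Boolean connectives, counting and bounded quantifiers\<close>

lemma dec_less: "i < d \<Longrightarrow> j < d \<Longrightarrow> dec d (\<lambda>w e. e i < e j)"
  by (rule dec_atom[where c = "Less i j"]) auto

lemma dec_same: "i < d \<Longrightarrow> j < d \<Longrightarrow> dec d (\<lambda>w e. e i = e j)"
  by (rule dec_atom[where c = "Same i j"]) auto

lemma dec_sym: "i < d \<Longrightarrow> dec d (\<lambda>w e. sym_at w (e i) = a)"
  by (rule dec_atom[where c = "Sym i a"]) auto

lemma decE: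
  assumes "dec d P"
  obtains c T where "poly_bounded T"
    "\<And>w e b. set w \<subseteq> {1..7} \<Longrightarrow> (\<And>r. e r \<le> length w) \<Longrightarrow>
     \<exists>e'. (\<forall>r. e' r \<le> length w) \<and> (\<forall>r<d. e' r = e r) \<and> evals w (T (length w)) c b e (P w e) e'"
    "\<And>w e e'. (\<And>r. r < d \<Longrightarrow> e r = e' r) \<Longrightarrow> P w e = P w e'"
proof -
  from assms obtain c T where "poly_bounded T" "computes T c d P"
    and "\<forall>w e e'. (\<forall>r<d. e r = e' r) \<longrightarrow> P w e = P w e'" unfolding dec_def by blast
  then show thesis unfolding computes_def by (intro that[of T c]) blast+
qed

lemma dec_not:
  assumes "dec d P" shows "dec d (\<lambda>w e. \<not> P w e)"
proof -
  obtain c T where c: "poly_bounded T"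
    "\<And>w e b. set w \<subseteq> {1..7} \<Longrightarrow> (\<And>r. e r \<le> length w) \<Longrightarrow>
     \<exists>e'. (\<forall>r. e' r \<le> length w) \<and> (\<forall>r<d. e' r = e r) \<and> evals w (T (length w)) c b e (P w e) e'"
    "\<And>w e e'. (\<And>r. r < d \<Longrightarrow> e r = e' r) \<Longrightarrow> P w e = P w e'"
    by (rule decE[OF assms]) blast
  have "computes (\<lambda>n. T n + 2) (Seq c Flip) d (\<lambda>w e. \<not> P w e)"
    unfolding computes_def
  proof (intro allI impI)
    fix w :: "nat list" and e :: "nat \<Rightarrow> nat" and b
    assume "set w \<subseteq> {1..7}" "\<forall>r. e r \<le> length w"
    then obtain e' where e': "\<forall>r. e' r \<le> length w" "\<forall>r<d. e' r = e r" "evals w (T (length w)) c b e (P w e) e'"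
      using c(2) by blast
    have "evals w 1 Flip (P w e) e' (\<not> P w e) e'" by (rule evals_step) simp
    from evals_Seq[OF e'(3) this]
    have "evals w (T (length w) + 2) (Seq c Flip) b e (\<not> P w e) e'" by simp
    with e' show "\<exists>e'. (\<forall>r. e' r \<le> length w) \<and> (\<forall>r<d. e' r = e r) \<and>
      evals w (T (length w) + 2) (Seq c Flip) b e (\<not> P w e) e'" by blast
  qed
  then show ?thesis by (rule decI[OF poly_bounded_add[OF c(1) poly_bounded_const]]) (rule arg_cong[OF c(3)], simp)
qed

lemma dec_conj:
  assumes "dec d P" "dec d Q" shows "dec d (\<lambda>w e. P w e \<and> Q w e)"
proof -
  obtain c T where c: "poly_bounded T"
    "\<And>w e b. set w \<subseteq> {1..7} \<Longrightarrow> (\<And>r. e r \<le> length w) \<Longrightarrow>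
     \<exists>e'. (\<forall>r. e' r \<le> length w) \<and> (\<forall>r<d. e' r = e r) \<and> evals w (T (length w)) c b e (P w e) e'"
    "\<And>w e e'. (\<And>r. r < d \<Longrightarrow> e r = e' r) \<Longrightarrow> P w e = P w e'"
    by (rule decE[OF assms(1)]) blast
  obtain c' T' where c': "poly_bounded T'"
    "\<And>w e b. set w \<subseteq> {1..7} \<Longrightarrow> (\<And>r. e r \<le> length w) \<Longrightarrow>
     \<exists>e'. (\<forall>r. e' r \<le> length w) \<and> (\<forall>r<d. e' r = e r) \<and> evals w (T' (length w)) c' b e (Q w e) e'"
    "\<And>w e e'. (\<And>r. r < d \<Longrightarrow> e r = e' r) \<Longrightarrow> Q w e = Q w e'"
    by (rule decE[OF assms(2)]) blast
  have comp: "computes (\<lambda>n. T n + T' n + 3) (Seq c (When c')) d (\<lambda>w e. P w e \<and> Q w e)"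
    unfolding computes_def
  proof (intro allI impI)
    fix w :: "nat list" and e :: "nat \<Rightarrow> nat" and b
    assume w: "set w \<subseteq> {1..7}" and "\<forall>r. e r \<le> length w"
    then obtain e1 where e1: "\<forall>r. e1 r \<le> length w" "\<forall>r<d. e1 r = e r" "evals w (T (length w)) c b e (P w e) e1"
      using c(2) by blast
    obtain e2 where e2: "\<forall>r. e2 r \<le> length w" "\<forall>r<d. e2 r = e1 r" "evals w (T' (length w)) c' (P w e) e1 (Q w e1) e2"
      using c'(2)[OF w] e1(1) by blast
    \<comment> \<open>Evaluating \<open>P\<close> may have spoilt scratch registers, to which
      \<open>Q\<close> is insensitive.\<close>
    have Q: "Q w e1 = Q w e" using c'(3) e1(2) by blast
    have "\<exists>e'. (\<forall>r. e' r \<le> length w) \<and> (\<forall>r<d. e' r = e r) \<and>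
      evals w (Suc (T' (length w))) (When c') (P w e) e1 (P w e \<and> Q w e) e'"
    proof (cases "P w e")
      case True
      then have "evals w (Suc (T' (length w))) (When c') (P w e) e1 (P w e \<and> Q w e) e2"
        using e2(3) Q by (intro evals_unfold[of _ _ _ _ c']) auto
      then show ?thesis using e1(2) e2 by metis
    next
      case False
      then have "evals w (Suc (T' (length w))) (When c') (P w e) e1 (P w e \<and> Q w e) e1"
        by (intro evals_mono[OF evals_step]) auto
      then show ?thesis using e1 by metis
    qed
    then obtain e' where e': "\<forall>r. e' r \<le> length w" "\<forall>r<d. e' r = e r"
      "evals w (Suc (T' (length w))) (When c') (P w e) e1 (P w e \<and> Q w e) e'" by blast
    have "evals w (T (length w) + T' (length w) + 3) (Seq c (When c')) b e (P w e \<and> Q w e) e'"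
      using evals_Seq[OF e1(3) e'(3)] by (rule evals_mono) simp
    with e' show "\<exists>e'. (\<forall>r. e' r \<le> length w) \<and> (\<forall>r<d. e' r = e r) \<and>
      evals w (T (length w) + T' (length w) + 3) (Seq c (When c')) b e (P w e \<and> Q w e) e'" by blast
  qed
  have "poly_bounded (\<lambda>n. T n + T' n + 3)"
    by (intro poly_bounded_add poly_bounded_const c(1) c'(1))
  then show ?thesis
    by (rule decI[OF _ comp]) (rule arg_cong2[OF c(3) c'(3), of _ _ _ _ "(\<and>)"]; simp)
qed

lemma card_less_Suc:
  "card {p. p < Suc i \<and> A p} = (if A i then Suc (card {p. p < i \<and> A p}) else card {p. p < i \<and> A (p::nat)})"
proof -
  have "{p. p < Suc i \<and> A p} = (if A i then insert i {p. p < i \<and> A p} else {p. p < i \<and> A p})"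
    by (auto simp: less_Suc_eq)
  then show ?thesis by simp
qed

lemma card_less_le: "card {p. p < i \<and> A p} \<le> (i::nat)"
  by (induction i) (auto simp: card_less_Suc)

text \<open>Registers \<open>d\<close> and \<open>d + 1\<close> count, register \<open>d + 2\<close> runs through the word.\<close>

lemma dec_card_eq:
  assumes "dec (d + 3) (\<lambda>w e. A w e (e (d + 2)))" "dec (d + 3) (\<lambda>w e. B w e (e (d + 2)))"
    and A: "\<And>w e e' p. (\<And>r. r < d \<Longrightarrow> e r = e' r) \<Longrightarrow> A w e p = A w e' p"
    and B: "\<And>w e e' p. (\<And>r. r < d \<Longrightarrow> e r = e' r) \<Longrightarrow> B w e p = B w e' p"
  shows "dec d (\<lambda>w e. card {p. p < length w \<and> A w e p} = card {p. p < length w \<and> B w e p})"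
proof -
  obtain c T where c: "poly_bounded T"
    "\<And>w e b. set w \<subseteq> {1..7} \<Longrightarrow> (\<And>r. e r \<le> length w) \<Longrightarrow>
     \<exists>e'. (\<forall>r. e' r \<le> length w) \<and> (\<forall>r<d+3. e' r = e r) \<and> evals w (T (length w)) c b e (A w e (e (d + 2))) e'"
    by (rule decE[OF assms(1)]) blast
  obtain c' T' where c': "poly_bounded T'"
    "\<And>w e b. set w \<subseteq> {1..7} \<Longrightarrow> (\<And>r. e r \<le> length w) \<Longrightarrow>
     \<exists>e'. (\<forall>r. e' r \<le> length w) \<and> (\<forall>r<d+3. e' r = e r) \<and> evals w (T' (length w)) c' b e (B w e (e (d + 2))) e'"
    by (rule decE[OF assms(2)]) blast
  \<comment> \<open>The final test sets the flag exactly when the running pointer has reached the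
    end of the word, which is the exit condition of the loop. The subprograms work at depth
    \<open>d + 3\<close> and so preserve the counters.\<close>
  define body where "body = Seq c (Seq (When (Inc d)) (Seq c' (Seq (When (Inc (d + 1))) (Seq (Inc (d + 2)) (Sym (d + 2) 0)))))"
  define inv where "inv w e0 i e \<longleftrightarrow> (\<forall>r. e r \<le> length w) \<and> (\<forall>r<d. e r = e0 r) \<and>
     e d = card {p. p < i \<and> A w e0 p} \<and> e (d + 1) = card {p. p < i \<and> B w e0 p} \<and> e (d + 2) = i" for w i and e0 e :: "nat \<Rightarrow> nat"
  define U where "U n = T n + T' n + 12" for n
  have end_iff: "sym_at w i = 0 \<longleftrightarrow> i = length w" if "set w \<subseteq> {1..7}" "i \<le> length w" for w i
    using that by (force simp: sym_at_def dest: nth_mem)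
  have whenInc: "evals w 2 (When (Inc r)) b e b (if b then e(r := min (length w) (Suc (e r))) else e)" for w r b e
  proof (cases b)
    case True
    have "evals w 1 (Inc r) True e True (e(r := min (length w) (Suc (e r))))" by (rule evals_step) simp
    then show ?thesis using True evals_unfold[of w "When (Inc r)" True e "Inc r"] by (simp add: numeral_2_eq_2)
  qed (auto intro: evals_mono[OF evals_step])
  have body: "\<exists>e'. inv w e0 (Suc i) e' \<and> evals w (U (length w)) body b e (Suc i = length w) e'"
    if w: "set w \<subseteq> {1..7}" and i: "i < length w" and I: "inv w e0 i e" for w e0 e i b
  proof -
    obtain e1 where e1: "\<forall>r. e1 r \<le> length w" "\<forall>r<d+3. e1 r = e r" "evals w (T (length w)) c b e (A w e (e (d + 2))) e1"
      using c(2)[OF w] I unfolding inv_def by blast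
    have a: "A w e (e (d + 2)) = A w e0 i" using A[of e e0] I unfolding inv_def by simp
    define e2 where "e2 = (if A w e0 i then e1(d := min (length w) (Suc (e1 d))) else e1)"
    have E2: "evals w 2 (When (Inc d)) (A w e0 i) e1 (A w e0 i) e2"
      unfolding e2_def by (rule whenInc)
    \<comment> \<open>Before this round the count is at most \<open>i\<close>, which is less than
      \<open>length w\<close>; hence the capped increment is a true increment.\<close>
    have e2d: "e2 d = card {p. p < Suc i \<and> A w e0 p}"
      using e1(2) I i card_less_le[of i "A w e0"] unfolding e2_def inv_def card_less_Suc by auto
    have e2r: "\<forall>r. e2 r \<le> length w" "\<forall>r<d+3. r \<noteq> d \<longrightarrow> e2 r = e r" using e1(1,2) by (auto simp: e2_def)
    obtain e3 where e3: "\<forall>r. e3 r \<le> length w" "\<forall>r<d+3. e3 r = e2 r" "evals w (T' (length w)) c' (A w e0 i) e2 (B w e2 (e2 (d + 2))) e3"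
      using c'(2)[OF w] e2r(1) by blast
    have b: "B w e2 (e2 (d + 2)) = B w e0 i" using B[of e2 e0] I e2r unfolding inv_def by simp
    define e4 where "e4 = (if B w e0 i then e3(d + 1 := min (length w) (Suc (e3 (d + 1)))) else e3)"
    have E4: "evals w 2 (When (Inc (d + 1))) (B w e0 i) e3 (B w e0 i) e4"
      unfolding e4_def by (rule whenInc)
    have e4d: "e4 (d + 1) = card {p. p < Suc i \<and> B w e0 p}"
      using e3(2) e2r I i card_less_le[of i "B w e0"] unfolding e4_def inv_def card_less_Suc by auto
    have e4r: "\<forall>r. e4 r \<le> length w" "\<forall>r<d+3. r \<noteq> d + 1 \<longrightarrow> e4 r = e2 r" using e3(1,2) by (auto simp: e4_def)
    define e5 where "e5 = e4(d + 2 := min (length w) (Suc (e4 (d + 2))))"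
    have E5: "evals w 1 (Inc (d + 2)) (B w e0 i) e4 (B w e0 i) e5" by (rule evals_step) (simp add: e5_def)
    have e5d: "e5 (d + 2) = Suc i" using e4r e2r I i unfolding e5_def inv_def by auto
    have E6: "evals w 1 (Sym (d + 2) 0) (B w e0 i) e5 (Suc i = length w) e5"
      by (rule evals_step) (use end_iff[OF w, of "Suc i"] i e5d in simp)
    have "inv w e0 (Suc i) e5"
      unfolding inv_def using e5d e4d e2d e4r e2r I by (auto simp: e5_def inv_def)
    moreover have "evals w (U (length w)) body b e (Suc i = length w) e5"
      unfolding body_def
      by (rule evals_mono, (rule evals_Seq e1(3)[unfolded a] E2 e3(3)[unfolded b] E4 E5 E6)+, simp add: U_def)
    ultimately show ?thesis by blast
  qed
  have loop: "i \<le> length w \<Longrightarrow> inv w e0 i e \<Longrightarrow>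
     \<exists>e'. inv w e0 (length w) e' \<and> evals w (1 + (length w - i) * Suc (U (length w))) (Loop body) (i = length w) e True e'"
    if w: "set w \<subseteq> {1..7}" for w e0 e i
  proof (induction "length w - i" arbitrary: i e)
    case 0
    then have "i = length w" by simp
    moreover have "evals w 1 (Loop body) True e True e" by (rule evals_step) simp
    ultimately show ?case using 0 by (intro exI[of _ e]) simp
  next
    case (Suc m)
    then have i: "i < length w" by simp
    obtain e1 where e1: "inv w e0 (Suc i) e1" "evals w (U (length w)) body False e (Suc i = length w) e1"
      using body[OF w i Suc.prems(2)] by blast
    obtain e' where e': "inv w e0 (length w) e'"
      "evals w (1 + (length w - Suc i) * Suc (U (length w))) (Loop body) (Suc i = length w) e1 True e'"
      using Suc.hyps(1)[OF _ _ e1(1)] Suc.hyps(2) i by (metis Suc_diff_Suc Suc_inject Suc_leI)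
    have "length w - i = Suc (length w - Suc i)" using i by simp
    then have "evals w (1 + (length w - i) * Suc (U (length w))) (Loop body) (i = length w) e True e'"
      using evals_Loop[OF e1(2) e'(2)] i by (auto elim!: evals_mono)
    then show ?case using e'(1) by blast
  qed
  \<comment> \<open>The test before the loop sets the flag on the empty word, so that the body is
    skipped there.\<close>
  define prog where "prog = Seq (Zero d) (Seq (Zero (d + 1)) (Seq (Zero (d + 2)) (Seq (Sym (d + 2) 0) (Seq (Loop body) (Same d (d + 1))))))"
  define V where "V n = 11 + n * Suc (U n)" for n
  have comp: "computes V prog d (\<lambda>w e. card {p. p < length w \<and> A w e p} = card {p. p < length w \<and> B w e p})"
    unfolding computes_def
  proof (intro allI impI)
    fix w :: "nat list" and e :: "nat \<Rightarrow> nat" and b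
    assume w: "set w \<subseteq> {1..7}" and e: "\<forall>r. e r \<le> length w"
    let ?e = "e(d := 0, d + 1 := 0, d + 2 := 0)"
    have "inv w e 0 ?e" using e unfolding inv_def by auto
    then obtain e' where I: "inv w e (length w) e'" and
      E: "evals w (1 + (length w - 0) * Suc (U (length w))) (Loop body) (0 = length w) ?e True e'"
      using loop[OF w, of 0 e] by blast
    have "evals w 1 (Sym (d + 2) 0) b ?e (0 = length w) ?e"
      by (rule evals_step) (use end_iff[OF w, of 0] in simp)
    moreover have "evals w 1 (Zero d) b e b (e(d := 0))" by (rule evals_step) simp
    moreover have "evals w 1 (Zero (d + 1)) b (e(d := 0)) b (e(d := 0, d + 1 := 0))" by (rule evals_step) simp
    moreover have "evals w 1 (Zero (d + 2)) b (e(d := 0, d + 1 := 0)) b ?e" by (rule evals_step) simp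
    moreover have "evals w 1 (Same d (d + 1)) True e' (card {p. p < length w \<and> A w e p} = card {p. p < length w \<and> B w e p}) e'"
      by (rule evals_step) (use I in \<open>simp add: inv_def\<close>)
    ultimately have "evals w (V (length w)) prog b e (card {p. p < length w \<and> A w e p} = card {p. p < length w \<and> B w e p}) e'"
      unfolding prog_def by - (rule evals_mono, (rule evals_Seq E | assumption)+, simp add: V_def)
    then show "\<exists>e'. (\<forall>r. e' r \<le> length w) \<and> (\<forall>r<d. e' r = e r) \<and> evals w (V (length w)) prog b e
         (card {p. p < length w \<and> A w e p} = card {p. p < length w \<and> B w e p}) e'"
      using I unfolding inv_def by blast
  qed
  have "poly_bounded V"
    unfolding V_def U_def Suc_eq_plus1
    by (intro poly_bounded_add poly_bounded_mult poly_bounded_const poly_bounded_id c(1) c'(1))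
  then show ?thesis
  proof (rule decI[OF _ comp])
    show "(card {p. p < length w \<and> A w e p} = card {p. p < length w \<and> B w e p}) =
      (card {p. p < length w \<and> A w e' p} = card {p. p < length w \<and> B w e' p})"
      if "\<And>r. r < d \<Longrightarrow> e r = e' r" for w e e'
      using A[of e e' w] B[of e e' w] that by simp
  qed
qed

lemma dec_cong:
  assumes "dec d P" "\<And>w e. P w e = Q w e"
  shows "dec d Q"
proof -
  have "P = Q" by (intro ext) (rule assms(2))
  with assms(1) show ?thesis by simp
qed

text \<open>Register 0 need not be in scope, but comparing a register with itself gives an answer
  independent of its value.\<close>

lemma dec_const: "dec d (\<lambda>w e. A)"
proof (cases A)
  case True
  have "dec d (\<lambda>w e. \<not> (e 0 < e 0))"
    by (rule dec_not, rule dec_atom[where c = "Less 0 0"]) auto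
  then show ?thesis using True by simp
next
  case False
  have "dec d (\<lambda>w e. e 0 < e 0)"
    by (rule dec_atom[where c = "Less 0 0"]) auto
  then show ?thesis using False by simp
qed

lemma dec_disj:
  assumes "dec d P" "dec d Q" shows "dec d (\<lambda>w e. P w e \<or> Q w e)"
  by (rule dec_cong[OF dec_not[OF dec_conj[OF dec_not[OF assms(1)] dec_not[OF assms(2)]]]]) blast

lemma dec_imp:
  assumes "dec d P" "dec d Q" shows "dec d (\<lambda>w e. P w e \<longrightarrow> Q w e)"
  by (rule dec_cong[OF dec_disj[OF dec_not[OF assms(1)] assms(2)]]) blast

lemma dec_iff:
  assumes "dec d P" "dec d Q" shows "dec d (\<lambda>w e. P w e = Q w e)"
  by (rule dec_cong[OF dec_conj[OF dec_imp[OF assms] dec_imp[OF assms(2,1)]]]) blast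

text \<open>Existence means that the count differs from that of the empty predicate, so the counting
  loop is the only loop ever programmed.\<close>

lemma dec_ex:
  assumes "dec (d + 3) (\<lambda>w e. A w e (e (d + 2)))"
    and "\<And>w e e' p. (\<And>r. r < d \<Longrightarrow> e r = e' r) \<Longrightarrow> A w e p = A w e' p"
  shows "dec d (\<lambda>w e. \<exists>p<length w. A w e p)"
proof -
  have "dec d (\<lambda>w e. card {p. p < length w \<and> A w e p} = card {p. p < length w \<and> False})"
    by (rule dec_card_eq[where A = A and B = "\<lambda>_ _ _. False" and d = d, OF assms(1) dec_const assms(2)]) simp_all
  from dec_not[OF this] show ?thesis by (rule dec_cong) auto
qed

lemma dec_all:
  assumes "dec (d + 3) (\<lambda>w e. A w e (e (d + 2)))"
    and "\<And>w e e' p. (\<And>r. r < d \<Longrightarrow> e r = e' r) \<Longrightarrow> A w e p = A w e' p"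
  shows "dec d (\<lambda>w e. \<forall>p<length w. A w e p)"
proof -
  have "dec d (\<lambda>w e. \<exists>p<length w. \<not> A w e p)"
    by (rule dec_ex[where A = "\<lambda>w e p. \<not> A w e p" and d = d, OF dec_not[OF assms(1)]])
      (rule arg_cong[OF assms(2)], blast)
  from dec_not[OF this] show ?thesis by (rule dec_cong) auto
qed

lemma dec_ex_const:
  fixes N :: nat
  assumes "\<And>a. a < N \<Longrightarrow> dec d (A a)"
  shows "dec d (\<lambda>w e. \<exists>a<N. A a w e)"
  using assms
proof (induction N)
  case 0
  then show ?case using dec_const[of d False] by simp
next
  case (Suc N)
  then have "dec d (\<lambda>w e. A N w e \<or> (\<exists>a<N. A a w e))" by (intro dec_disj) auto
  then show ?case by (rule dec_cong) (auto simp: less_Suc_eq)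
qed

text \<open>Replacing a predicate by one that agrees with it only over the input alphabet.
  Insensitivity to scratch registers is demanded for all words, so it is a separate premise.\<close>

lemma dec_word:
  assumes "dec d P" "\<And>w e. set w \<subseteq> {1..7} \<Longrightarrow> P w e = Q w e"
    "\<And>w e e'. (\<And>r. r < d \<Longrightarrow> e r = e' r) \<Longrightarrow> Q w e = Q w e'"
  shows "dec d Q"
proof -
  obtain c T where c: "poly_bounded T" "computes T c d P" using assms(1) unfolding dec_def by blast
  have "computes T c d Q" unfolding computes_def
  proof (intro allI impI)
    fix w :: "nat list" and e :: "nat \<Rightarrow> nat" and b
    assume "set w \<subseteq> {1..7}" "\<forall>r. e r \<le> length w"
    with c(2) have "\<exists>e'. (\<forall>r. e' r \<le> length w) \<and> (\<forall>r<d. e' r = e r) \<and> evals w (T (length w)) c b e (P w e) e'"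
      unfolding computes_def by blast
    then show "\<exists>e'. (\<forall>r. e' r \<le> length w) \<and> (\<forall>r<d. e' r = e r) \<and> evals w (T (length w)) c b e (Q w e) e'"
      unfolding assms(2)[OF \<open>set w \<subseteq> {1..7}\<close>] .
  qed
  then show ?thesis by (rule decI[OF c(1)]) (rule assms(3))
qed

lemma dec_sym_pred: "i < d \<Longrightarrow> dec d (\<lambda>w e. A (sym_at w (e i)))"
proof (rule dec_word)
  show "i < d \<Longrightarrow> dec d (\<lambda>w e. \<exists>a<8. A a \<and> sym_at w (e i) = a)"
    by (intro dec_ex_const dec_conj dec_const dec_sym)
qed (use sym_at_less in auto)

lemma dec_sym_eq: "i < d \<Longrightarrow> j < d \<Longrightarrow> dec d (\<lambda>w e. sym_at w (e i) = sym_at w (e j))"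
proof (rule dec_word)
  show "i < d \<Longrightarrow> j < d \<Longrightarrow> dec d (\<lambda>w e. \<exists>a<8. sym_at w (e i) = a \<and> sym_at w (e j) = a)"
    by (intro dec_ex_const dec_conj dec_sym)
qed (use sym_at_less in auto)

lemma dec_poly_time_decidable:
  assumes "dec 0 (\<lambda>w e. P w)" and "\<And>x. D x \<Longrightarrow> set (enc x) \<subseteq> {1..7} \<and> enc x \<noteq> [] \<and> (P (enc x) \<longleftrightarrow> Q x)"
  shows "poly_time_decidable D enc Q"
proof -
  obtain c T where T: "poly_bounded T" and c: "computes T c 0 (\<lambda>w e. P w)"
    using assms(1) unfolding dec_def by blast
  obtain k code N where "pointer_tm c k code N" by (rule pointer_tm_exists)
  then interpret pointer_tm c k code N .
  have "poly_bounded (\<lambda>n. (T n + 2) * (2 * n + 2))"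
    by (intro poly_bounded_add poly_bounded_mult poly_bounded_const poly_bounded_id T)
  then obtain a l where al: "\<And>n. (T n + 2) * (2 * n + 2) \<le> a * (n + 1) ^ l"
    unfolding poly_bounded_def by blast
  have "\<exists>n \<le> a * (length (enc x) + 1) ^ l. fst (run M (enc x) n) \<in> {1, 2} \<and>
     (fst (run M (enc x) n) = 1 \<longleftrightarrow> Q x)" if "D x" for x
  proof -
    let ?w = "enc x"
    have w: "set ?w \<subseteq> {1..7}" "?w \<noteq> []" and Q: "P ?w \<longleftrightarrow> Q x" using assms(2)[OF that] by auto
    obtain e' where "evals ?w (T (length ?w)) c False (\<lambda>_. 0) (P ?w) e'"
      using c w unfolding computes_def by fastforce
    then obtain t where t: "t \<le> T (length ?w)" "(pstep ?w ^^ t) ([c], False, \<lambda>_. 0) = ([], P ?w, e')"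
      unfolding evals_def by blast
    obtain n where n: "n \<le> (t + 2) * (2 * length ?w + 2)" "fst (run M ?w n) \<in> {1, 2}"
      "fst (run M ?w n) = 1 \<longleftrightarrow> P ?w" using decide[OF w t(2)] by blast
    have "(t + 2) * (2 * length ?w + 2) \<le> a * (length ?w + 1) ^ l"
      using t(1) by (intro le_trans[OF mult_le_mono1 al]) simp
    then show ?thesis using n Q by (meson le_trans)
  qed
  then show ?thesis unfolding poly_time_decidable_def using wf_M by blast
qed

section \<open>Isomorphism of rules\<close>

definition shape :: "trm \<Rightarrow> trm" where
  "shape = ren (\<lambda>_. 0) (\<lambda>_. 0)"

text \<open>The tags 6 and 7 are those of the encoding, so this list can be recovered from the input
  word.\<close>

fun occ :: "trm \<Rightarrow> (nat \<times> nat) list" where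
  "occ (Var x) = [(6, x)]"
| "occ (Fun f ts) = (7, f) # concat (map occ ts)"

lemma shape_simps [simp]:
  "shape (Var x) = Var 0" "shape (Fun f ts) = Fun 0 (map shape ts)"
  by (simp_all add: shape_def)

lemma occ_tags: "z \<in> set (occ t) \<Longrightarrow> fst z = 6 \<or> fst z = 7"
  by (induction t) auto

lemma shape_occ: "shape t = shape t' \<Longrightarrow> map fst (occ t) = map fst (occ t')"
proof (induction t arbitrary: t')
  case (Var x)
  then show ?case by (cases t') auto
next
  case (Fun f ts)
  then obtain g us where t': "t' = Fun g us" "map shape ts = map shape us" by (cases t') auto
  have "map fst (concat (map occ ts)) = map fst (concat (map occ us))"
    using t'(2) Fun.IH
  proof (induction ts arbitrary: us)
    case (Cons t ts)
    then obtain u us' where us: "us = u # us'" "shape t = shape u" "map shape ts = map shape us'"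
      by (cases us) auto
    have "map fst (occ t) = map fst (occ u)" by (rule Cons.prems(2)) (use us in simp_all)
    moreover have "map fst (concat (map occ ts)) = map fst (concat (map occ us'))"
      by (rule Cons.IH[OF us(3)]) (rule Cons.prems(2), simp_all)
    ultimately show ?case by (simp add: us(1))
  qed simp
  then show ?case using t'(1) by simp
qed

lemma shape_length_occ: "shape t = shape t' \<Longrightarrow> length (occ t) = length (occ t')"
  using shape_occ map_eq_imp_length_eq by blast

text \<open>A renaming leaves the tree alone and acts on each occurrence separately, so an equation
  between terms splits into equal shapes and one equation per occurrence.\<close>

lemma ren_eq_iff:
  "ren pf pv t = t' \<longleftrightarrow> shape t = shape t' \<and>
    (\<forall>((a, x), (a', x'))\<in>set (zip (occ t) (occ t')). x' = (if a = 7 then pf x else pv x))"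
proof (induction t arbitrary: t')
  case (Var x)
  then show ?case by (cases t') auto
next
  case (Fun f ts)
  show ?case
  proof (cases t')
    case (Fun g us)
    have "map (ren pf pv) ts = us \<longleftrightarrow> map shape ts = map shape us \<and>
      (\<forall>((a, x), (a', x'))\<in>set (zip (concat (map occ ts)) (concat (map occ us))). x' = (if a = 7 then pf x else pv x))"
      using Fun.IH
    proof (induction ts arbitrary: us)
      case (Cons t ts)
      show ?case
      proof (cases us)
        case us: (Cons u us')
        have t: "ren pf pv t = u \<longleftrightarrow> shape t = shape u \<and>
          (\<forall>((a, x), (a', x'))\<in>set (zip (occ t) (occ u)). x' = (if a = 7 then pf x else pv x))"
          by (rule Cons.prems) simp
        have ts: "map (ren pf pv) ts = us' \<longleftrightarrow> map shape ts = map shape us' \<and>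
          (\<forall>((a, x), (a', x'))\<in>set (zip (concat (map occ ts)) (concat (map occ us'))).
            x' = (if a = 7 then pf x else pv x))"
          by (rule Cons.IH) (rule Cons.prems, simp)
        show ?thesis
        \<comment> \<open>Equal shapes have equally many occurrences; only then does the zip of the
          concatenations split at the first argument.\<close>
        proof (cases "shape t = shape u")
          case True
          then have "zip (concat (map occ (t # ts))) (concat (map occ us)) =
            zip (occ t) (occ u) @ zip (concat (map occ ts)) (concat (map occ us'))"
            by (simp add: us shape_length_occ[OF True])
          then have app: "(\<forall>((a, x), (a', x'))\<in>set (zip (concat (map occ (t # ts))) (concat (map occ us))). x' = (if a = 7 then pf x else pv x))
            \<longleftrightarrow> (\<forall>((a, x), (a', x'))\<in>set (zip (occ t) (occ u)). x' = (if a = 7 then pf x else pv x)) \<and>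
            (\<forall>((a, x), (a', x'))\<in>set (zip (concat (map occ ts)) (concat (map occ us'))). x' = (if a = 7 then pf x else pv x))"
            by (simp only: set_append ball_Un)
          show ?thesis unfolding app unfolding us list.map list.inject t ts
            by (rule iffI; (elim conjE; intro conjI; assumption))
        qed (use t us in simp)
      qed simp
    qed auto
    then show ?thesis by (simp add: Fun eq_commute[of g] conj_ac)
  qed simp
qed

text \<open>The shape records numbers of arguments, and in well-formed terms these are the
  arities.\<close>

lemma wf_occ:
  assumes "wf_trm F ar V t" "wf_trm F' ar' V' t'" "shape t = shape t'"
    and "((a, x), (a', x')) \<in> set (zip (occ t) (occ t'))"
  shows "a = 7 \<and> a' = 7 \<and> x \<in> F \<and> x' \<in> F' \<and> ar x = ar' x' \<or> a = 6 \<and> a' = 6 \<and> x \<in> V \<and> x' \<in> V'"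
  using assms
proof (induction t arbitrary: t')
  case (Var y)
  then show ?case by (cases t') auto
next
  case (Fun f ts)
  then obtain g us where t': "t' = Fun g us" "map shape ts = map shape us" by (cases t') auto
  show ?case
  proof (cases "((a, x), (a', x')) = ((7, f), (7, g))")
    case True
    then show ?thesis using Fun.prems t' map_eq_imp_length_eq[OF t'(2)] by auto
  next
    case False
    then have "((a, x), (a', x')) \<in> set (zip (concat (map occ ts)) (concat (map occ us)))"
      using Fun.prems(4) t'(1) by auto
    moreover have "\<forall>t\<in>set ts. wf_trm F ar V t" "\<forall>t\<in>set us. wf_trm F' ar' V' t"
      using Fun.prems t'(1) by auto
    ultimately show ?thesis using t'(2) Fun.IH
    proof (induction ts arbitrary: us)
      case (Cons t ts)
      then obtain u us' where us: "us = u # us'" "shape t = shape u" "map shape ts = map shape us'" by (cases us) auto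
      then have "((a, x), (a', x')) \<in> set (zip (occ t) (occ u)) \<or>
        ((a, x), (a', x')) \<in> set (zip (concat (map occ ts)) (concat (map occ us')))"
        using Cons.prems(1) shape_length_occ[OF us(2)] by auto
      then show ?case
      proof
        assume "((a, x), (a', x')) \<in> set (zip (occ t) (occ u))"
        then show ?thesis using Cons.prems(5)[of t u] Cons.prems us by auto
      next
        assume "((a, x), (a', x')) \<in> set (zip (concat (map occ ts)) (concat (map occ us')))"
        then show ?thesis using Cons.IH[of us'] Cons.prems us by auto
      qed
    qed simp
  qed
qed

section \<open>The symbol correspondence between two rules\<close>

definition occ_rule :: "trm \<times> trm \<Rightarrow> (nat \<times> nat) list" where
  "occ_rule \<rho> = occ (fst \<rho>) @ occ (snd \<rho>)"

text \<open>The pairs of occurrences form the graph of a partial injection: one direction of the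
  inner equivalence is single-valuedness, the other injectivity. Tags are compared first because a
  variable and a function symbol may carry the same number.\<close>

definition consistent :: "bool \<Rightarrow> bool \<Rightarrow> (nat \<times> nat) list \<Rightarrow> (nat \<times> nat) list \<Rightarrow> bool" where
  "consistent idF idV xs ys \<longleftrightarrow> map fst xs = map fst ys \<and>
     (\<forall>i<length xs.
        (fst (xs ! i) = 6 \<and> idV \<or> fst (xs ! i) = 7 \<and> idF \<longrightarrow> snd (xs ! i) = snd (ys ! i)) \<and>
        (\<forall>j<length xs. fst (xs ! i) = fst (xs ! j) \<longrightarrow>
           (snd (xs ! i) = snd (xs ! j) \<longleftrightarrow> snd (ys ! i) = snd (ys ! j))))"

definition rule_match :: "bool \<Rightarrow> bool \<Rightarrow> trm \<times> trm \<Rightarrow> trm \<times> trm \<Rightarrow> bool" where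
  "rule_match idF idV \<rho> \<rho>' \<longleftrightarrow> shape (fst \<rho>) = shape (fst \<rho>') \<and> shape (snd \<rho>) = shape (snd \<rho>') \<and>
     consistent idF idV (occ_rule \<rho>) (occ_rule \<rho>')"

lemma consistent_id:
  "consistent idF idV xs ys \<Longrightarrow> i < length xs \<Longrightarrow>
    fst (xs ! i) = 6 \<and> idV \<or> fst (xs ! i) = 7 \<and> idF \<Longrightarrow> snd (xs ! i) = snd (ys ! i)"
  unfolding consistent_def by blast

lemma consistent_eq:
  "consistent idF idV xs ys \<Longrightarrow> i < length xs \<Longrightarrow> j < length xs \<Longrightarrow>
    fst (xs ! i) = fst (xs ! j) \<Longrightarrow> (snd (xs ! i) = snd (xs ! j)) = (snd (ys ! i) = snd (ys ! j))"
  unfolding consistent_def by blast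

lemma consistent_cancel:
  assumes "consistent idF idV xs ys" "consistent idF idV xs zs"
  shows "consistent idF idV ys zs"
proof -
  have l: "length xs = length ys" "length ys = length zs"
    using assms unfolding consistent_def by (auto dest: map_eq_imp_length_eq)
  have f: "fst (xs ! i) = fst (ys ! i)" "fst (ys ! i) = fst (zs ! i)" if "i < length ys" for i
    using assms that l unfolding consistent_def by (metis nth_map)+
  have a: "snd (xs ! i) = snd (ys ! i)" "snd (xs ! i) = snd (zs ! i)"
    if "i < length ys" "fst (ys ! i) = 6 \<and> idV \<or> fst (ys ! i) = 7 \<and> idF" for i
    using consistent_id[OF assms(1), of i] consistent_id[OF assms(2), of i] that l f(1)[OF that(1)]
    by simp_all
  have b: "(snd (xs ! i) = snd (xs ! j)) = (snd (ys ! i) = snd (ys ! j))"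
    "(snd (xs ! i) = snd (xs ! j)) = (snd (zs ! i) = snd (zs ! j))"
    if "i < length ys" "j < length ys" "fst (ys ! i) = fst (ys ! j)" for i j
    using consistent_eq[OF assms(1), of i j] consistent_eq[OF assms(2), of i j] that l
      f(1)[OF that(1)] f(1)[OF that(2)] by simp_all
  have "map fst ys = map fst zs" using assms unfolding consistent_def by simp
  moreover have "snd (ys ! i) = snd (zs ! i)"
    if "i < length ys" "fst (ys ! i) = 6 \<and> idV \<or> fst (ys ! i) = 7 \<and> idF" for i
    using a[OF that] by simp
  moreover have "(snd (ys ! i) = snd (ys ! j)) = (snd (zs ! i) = snd (zs ! j))"
    if "i < length ys" "j < length ys" "fst (ys ! i) = fst (ys ! j)" for i j
    using b[OF that] by blast
  ultimately show ?thesis unfolding consistent_def by blast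
qed

text \<open>Symmetry and transitivity in one: two rules with a common partner match each other, so
  that a normal form leaves each rule at most one partner.\<close>

lemma rule_match_cancel:
  "rule_match idF idV \<rho> \<sigma> \<Longrightarrow> rule_match idF idV \<rho> \<sigma>' \<Longrightarrow> rule_match idF idV \<sigma> \<sigma>'"
  unfolding rule_match_def using consistent_cancel by metis

lemma consistent_zip:
  "consistent idF idV xs ys \<longleftrightarrow> map fst xs = map fst ys \<and>
    (\<forall>((a, x), (a', x')) \<in> set (zip xs ys). (a = 6 \<and> idV \<or> a = 7 \<and> idF \<longrightarrow> x = x') \<and>
      (\<forall>((b, y), (b', y')) \<in> set (zip xs ys). a = b \<longrightarrow> (x = y \<longleftrightarrow> x' = y')))"
proof (cases "map fst xs = map fst ys")
  case True
  then have "length xs = length ys" by (rule map_eq_imp_length_eq)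
  then have ball: "(\<forall>z\<in>set (zip xs ys). Q z) \<longleftrightarrow> (\<forall>i<length xs. Q (xs ! i, ys ! i))" for Q
    unfolding all_set_conv_all_nth by simp
  show ?thesis using True
    by (simp only: consistent_def ball case_prod_beta fst_conv snd_conv)
qed (simp add: consistent_def)

lemma consistent_pairs:
  "consistent idF idV xs ys \<longleftrightarrow> map fst xs = map fst ys \<and>
    (\<forall>a x a' x'. ((a, x), (a', x')) \<in> set (zip xs ys) \<longrightarrow> a = 6 \<and> idV \<or> a = 7 \<and> idF \<longrightarrow> x = x') \<and>
    (\<forall>a x a' x' y b' y'. ((a, x), (a', x')) \<in> set (zip xs ys) \<longrightarrow> ((a, y), (b', y')) \<in> set (zip xs ys) \<longrightarrow>
      (x = y \<longleftrightarrow> x' = y'))"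
proof -
  have ball: "(\<forall>z\<in>set (zip xs ys). Q z) \<longleftrightarrow>
    (\<forall>a x a' x'. ((a, x), (a', x')) \<in> set (zip xs ys) \<longrightarrow> Q ((a, x), (a', x')))" for Q
    by (simp add: Ball_def split_paired_All)
  show ?thesis unfolding consistent_zip ball prod.case by blast
qed

lemma zip_occ_rule:
  assumes "shape (fst \<rho>) = shape (fst \<rho>')"
  shows "set (zip (occ_rule \<rho>) (occ_rule \<rho>')) =
    set (zip (occ (fst \<rho>)) (occ (fst \<rho>'))) \<union> set (zip (occ (snd \<rho>)) (occ (snd \<rho>')))"
  using shape_length_occ[OF assms] by (simp add: occ_rule_def)

lemma ren_rule_iff:
  "ren pf pv (fst \<rho>) = fst \<rho>' \<and> ren pf pv (snd \<rho>) = snd \<rho>' \<longleftrightarrow>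
    shape (fst \<rho>) = shape (fst \<rho>') \<and> shape (snd \<rho>) = shape (snd \<rho>') \<and>
    (\<forall>((a, x), (a', x'))\<in>set (zip (occ_rule \<rho>) (occ_rule \<rho>')). x' = (if a = 7 then pf x else pv x))"
proof (cases "shape (fst \<rho>) = shape (fst \<rho>')")
  case True
  show ?thesis unfolding ren_eq_iff zip_occ_rule[OF True] ball_Un
    by (rule iffI; (elim conjE; intro conjI; assumption))
qed (simp add: ren_eq_iff)

text \<open>This makes equality of rules an instance of matching, so the word predicate for matching
  also tests equality.\<close>

lemma rule_match_True: "rule_match True True \<rho> \<rho>' \<longleftrightarrow> \<rho> = \<rho>'"
proof
  assume *: "rule_match True True \<rho> \<rho>'"
  have id: "ren id id t = t" for t
    by (induction t) (auto intro: map_idI)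
  have "fst z = 6 \<or> fst z = 7" if "z \<in> set (occ_rule \<rho>)" for z
    using that occ_tags[of z "fst \<rho>"] occ_tags[of z "snd \<rho>"] unfolding occ_rule_def by auto
  then have "\<forall>((a, x), (a', x'))\<in>set (zip (occ_rule \<rho>) (occ_rule \<rho>')). x' = (if a = 7 then id x else id x)"
    using * unfolding rule_match_def consistent_zip by (fastforce dest: set_zip_leftD)
  then have "ren id id (fst \<rho>) = fst \<rho>' \<and> ren id id (snd \<rho>) = snd \<rho>'"
    using * unfolding ren_rule_iff rule_match_def by blast
  then show "\<rho> = \<rho>'" by (simp add: id prod_eq_iff)
qed (simp add: rule_match_def consistent_def)

text \<open>A partial injection \<open>G\<close> that respects classes uses up equally many elements
  of each class on both sides. If the classes have equal sizes, so do the remainders, and these can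
  be paired off class by class. Classes are the arities for function symbols, and a single class for
  variables.\<close>

lemma extend_bij:
  fixes c :: "'a \<Rightarrow> 'k" and c' :: "'b \<Rightarrow> 'k"
  assumes fin: "finite F" "finite F'" and G: "G \<subseteq> F \<times> F'"
    and inj: "\<And>x x' y y'. (x, x') \<in> G \<Longrightarrow> (y, y') \<in> G \<Longrightarrow> x = y \<longleftrightarrow> x' = y'"
    and cls: "\<And>x x'. (x, x') \<in> G \<Longrightarrow> c x = c' x'"
    and cards: "\<And>k. card {x\<in>F. c x = k} = card {x\<in>F'. c' x = k}"
  shows "\<exists>h. bij_betw h F F' \<and> (\<forall>x\<in>F. c' (h x) = c x) \<and> (\<forall>(x, x')\<in>G. h x = x')"
proof -
  define A where "A = fst ` G"
  define A' where "A' = snd ` G"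
  have "\<forall>x\<in>A. \<exists>x'. (x, x') \<in> G" unfolding A_def by auto
  then obtain g where g: "\<And>x. x \<in> A \<Longrightarrow> (x, g x) \<in> G" by metis
  have gG: "(x, x') \<in> G \<Longrightarrow> g x = x' \<and> x \<in> A" for x x'
  proof -
    assume "(x, x') \<in> G"
    then have "x \<in> A" by (force simp: A_def)
    then show "g x = x' \<and> x \<in> A" using inj[OF g \<open>(x, x') \<in> G\<close>, of x] by simp
  qed
  have AF: "A \<subseteq> F" "A' \<subseteq> F'" using G by (auto simp: A_def A'_def)
  have cg: "c' (g x) = c x" if "x \<in> A" for x by (rule cls[OF g[OF that], symmetric])
  have gA': "g ` A = A'"
  proof (intro equalityI subsetI)
    fix y assume "y \<in> g ` A"
    then obtain x where "y = g x" "(x, g x) \<in> G" using g by blast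
    then show "y \<in> A'" unfolding A'_def by force
  next
    fix y assume "y \<in> A'"
    then obtain x where "(x, y) \<in> G" unfolding A'_def by auto
    then show "y \<in> g ` A" using gG by blast
  qed
  have ginj: "inj_on g A"
  proof (rule inj_onI)
    fix x y assume "x \<in> A" "y \<in> A" "g x = g y"
    then show "x = y" using inj[OF g[of x] g[of y]] by simp
  qed
  \<comment> \<open>The remainders of class \<open>k\<close> are differences of sets whose
    cardinalities agree pairwise.\<close>
  have "\<exists>h. bij_betw h {x\<in>F - A. c x = k} {x\<in>F' - A'. c' x = k}" for k
  proof -
    have im: "g ` {x\<in>A. c x = k} = {x\<in>A'. c' x = k}"
      unfolding gA'[symmetric] using cg by auto
    have "card {x\<in>A. c x = k} = card {x\<in>A'. c' x = k}"
      unfolding im[symmetric] by (rule card_image[symmetric], rule inj_on_subset[OF ginj]) auto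
    moreover have "{x\<in>F - A. c x = k} = {x\<in>F. c x = k} - {x\<in>A. c x = k}"
      "{x\<in>F' - A'. c' x = k} = {x\<in>F'. c' x = k} - {x\<in>A'. c' x = k}" by auto
    moreover have "card ({x\<in>F. c x = k} - {x\<in>A. c x = k}) = card {x\<in>F. c x = k} - card {x\<in>A. c x = k}"
      using AF fin by (intro card_Diff_subset) (auto intro: finite_subset)
    moreover have "card ({x\<in>F'. c' x = k} - {x\<in>A'. c' x = k}) = card {x\<in>F'. c' x = k} - card {x\<in>A'. c' x = k}"
      using AF fin by (intro card_Diff_subset) (auto intro: finite_subset)
    ultimately have "card {x\<in>F - A. c x = k} = card {x\<in>F' - A'. c' x = k}" using cards by simp
    then show ?thesis using fin by (intro finite_same_card_bij) auto
  qed
  then obtain H where H: "\<And>k. bij_betw (H k) {x\<in>F - A. c x = k} {x\<in>F' - A'. c' x = k}" by metis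
  define h where "h x = (if x \<in> A then g x else H (c x) x)" for x
  have HF: "H (c x) x \<in> F' - A' \<and> c' (H (c x) x) = c x" if "x \<in> F - A" for x
    using bij_betwE[OF H[of "c x"]] that by auto
  have cl: "\<forall>x\<in>F. c' (h x) = c x"
    using HF cg by (simp add: h_def)
  have "inj_on h F"
  proof (rule inj_onI)
    fix x y assume xy: "x \<in> F" "y \<in> F" "h x = h y"
    then have "c x = c y" using cl by metis
    consider "x \<in> A" "y \<in> A" | "x \<notin> A" "y \<notin> A" | "x \<in> A \<longleftrightarrow> y \<notin> A" by blast
    then show "x = y"
    proof cases
      case 1 then show ?thesis using xy ginj by (auto simp: h_def inj_on_def)
    next
      case 2 then show ?thesis using xy \<open>c x = c y\<close> bij_betw_imp_inj_on[OF H[of "c y"]] by (auto simp: h_def inj_on_def)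
    next
      case 3
      have "h z \<in> A' \<longleftrightarrow> z \<in> A" if "z \<in> F" for z using HF[of z] gA' that by (auto simp: h_def)
      with 3 xy show ?thesis by metis
    qed
  qed
  moreover have "h ` F = F'"
  proof
    show "h ` F \<subseteq> F'" using HF gA' AF by (auto simp: h_def)
    show "F' \<subseteq> h ` F"
    proof
      fix y assume y: "y \<in> F'"
      show "y \<in> h ` F"
      proof (cases "y \<in> A'")
        case True
        then show ?thesis using gA' AF by (auto simp: h_def)
      next
        case False
        then have "y \<in> H (c' y) ` {x\<in>F - A. c x = c' y}"
          using bij_betw_imp_surj_on[OF H[of "c' y"]] y by simp
        then obtain x where "x \<in> F - A" "c x = c' y" "H (c' y) x = y" by auto
        then show ?thesis by (intro image_eqI[of _ _ x]) (auto simp: h_def)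
      qed
    qed
  qed
  moreover have "\<forall>(x, x')\<in>G. h x = x'" using gG by (auto simp: h_def)
  ultimately show ?thesis using cl unfolding bij_betw_def by blast
qed

text \<open>For finite symbol sets this is exactly the condition that some term isomorphism of the
  given mode exists. Mode \<open>LVE\<close> fixes the function symbols, mode \<open>LFE\<close> the
  variables.\<close>

definition compatible :: "mode \<Rightarrow> trs \<Rightarrow> trs \<Rightarrow> bool" where
  "compatible m T T' = (case T of (F, ar, V, _) \<Rightarrow> case T' of (F', ar', V', _) \<Rightarrow>
     (if m = LVE then F = F' \<and> (\<forall>f\<in>F. ar' f = ar f)
      else \<forall>k. card {f\<in>F. ar f = k} = card {f\<in>F'. ar' f = k}) \<and>
     (if m = LFE then V = V' else card V = card V'))"

text \<open>An isomorphism restricts to a partial injection on the symbols occurring in the rule.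
  Conversely, the correspondence read off two matching rules preserves arities by well-formedness
  and extends by \<open>extend_bij\<close>; on a fixed sort it is part of the identity.\<close>

lemma iso_match_iff:
  assumes T: "is_trs T" "is_trs T'" and \<rho>: "\<rho> \<in> rules T" "\<rho>' \<in> rules T'"
  shows "(\<exists>pf pv. iso_m m T T' pf pv \<and> ren pf pv (fst \<rho>) = fst \<rho>' \<and> ren pf pv (snd \<rho>) = snd \<rho>')
    \<longleftrightarrow> compatible m T T' \<and> rule_match (m = LVE) (m = LFE) \<rho> \<rho>'"
proof -
  obtain F ar V R where T1: "T = (F, ar, V, R)" by (cases T)
  obtain F' ar' V' R' where T2: "T' = (F', ar', V', R')" by (cases T')
  let ?Z = "set (zip (occ_rule \<rho>) (occ_rule \<rho>'))"
  have wf: "a = 7 \<and> a' = 7 \<and> x \<in> F \<and> x' \<in> F' \<and> ar x = ar' x' \<or> a = 6 \<and> a' = 6 \<and> x \<in> V \<and> x' \<in> V'"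
    if "((a, x), (a', x')) \<in> ?Z" "shape (fst \<rho>) = shape (fst \<rho>')" "shape (snd \<rho>) = shape (snd \<rho>')" for a x a' x'
  proof -
    have "wf_trm F ar V (fst \<rho>)" "wf_trm F ar V (snd \<rho>)" "wf_trm F' ar' V' (fst \<rho>')" "wf_trm F' ar' V' (snd \<rho>')"
      using T \<rho> by (auto simp: T1 T2 is_trs_def rules_def)
    then show ?thesis using that wf_occ[of F ar V "fst \<rho>" F' ar' V' "fst \<rho>'" a x a' x']
        wf_occ[of F ar V "snd \<rho>" F' ar' V' "snd \<rho>'" a x a' x'] by (auto simp: zip_occ_rule)
  qed
  have fin: "finite F" "finite V" "finite F'" "finite V'" using T by (auto simp: T1 T2 is_trs_def)
  show ?thesis
  proof
    assume "\<exists>pf pv. iso_m m T T' pf pv \<and> ren pf pv (fst \<rho>) = fst \<rho>' \<and> ren pf pv (snd \<rho>) = snd \<rho>'"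
    then obtain pf pv where iso: "iso_m m T T' pf pv"
      and r: "ren pf pv (fst \<rho>) = fst \<rho>' \<and> ren pf pv (snd \<rho>) = snd \<rho>'" by blast
    have pf: "bij_betw pf F F'" "\<And>f. f \<in> F \<Longrightarrow> ar' (pf f) = ar f" and pv: "bij_betw pv V V'"
      and mo: "m = LVE \<Longrightarrow> F = F' \<and> (\<forall>f\<in>F. ar' f = ar f) \<and> (\<forall>f\<in>F. pf f = f)"
        "m = LFE \<Longrightarrow> V = V' \<and> (\<forall>x\<in>V. pv x = x)"
      using iso by (auto simp: iso_m_def term_iso_def mode_ok_def T1 T2)
    have "card {f\<in>F. ar f = k} = card {f\<in>F'. ar' f = k}" for k
    proof -
      have "pf ` {f\<in>F. ar f = k} = {f\<in>F'. ar' f = k}"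
        using pf bij_betw_imp_surj_on[OF pf(1)] by (auto simp: image_iff)
      moreover have "inj_on pf {f\<in>F. ar f = k}"
        by (rule inj_on_subset[OF bij_betw_imp_inj_on[OF pf(1)]]) auto
      ultimately show ?thesis using card_image by metis
    qed
    then have comp: "compatible m T T'"
      using mo bij_betw_same_card[OF pv] by (auto simp: compatible_def T1 T2)
    have sh: "shape (fst \<rho>) = shape (fst \<rho>')" "shape (snd \<rho>) = shape (snd \<rho>')"
      and z: "\<And>a x a' x'. ((a, x), (a', x')) \<in> ?Z \<Longrightarrow> x' = (if a = 7 then pf x else pv x)"
      using r unfolding ren_rule_iff by auto
    have "map fst (occ_rule \<rho>) = map fst (occ_rule \<rho>')"
      using shape_occ[OF sh(1)] shape_occ[OF sh(2)] by (simp add: occ_rule_def)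
    moreover have "x = x'" if "((a, x), (a', x')) \<in> ?Z" "a = 6 \<and> m = LFE \<or> a = 7 \<and> m = LVE" for a x a' x'
      using wf[OF that(1) sh] z[OF that(1)] that(2) mo(1,2) by (elim disjE conjE) simp_all
    moreover have "x = y \<longleftrightarrow> x' = y'" if "((a, x), (a', x')) \<in> ?Z" "((a, y), (b', y')) \<in> ?Z" for a x a' x' y b' y'
      using wf[OF that(1) sh] wf[OF that(2) sh] z[OF that(1)] z[OF that(2)]
        inj_on_eq_iff[OF bij_betw_imp_inj_on[OF pf(1)], of x y] inj_on_eq_iff[OF bij_betw_imp_inj_on[OF pv], of x y]
      by (elim disjE conjE) simp_all
    ultimately have "consistent (m = LVE) (m = LFE) (occ_rule \<rho>) (occ_rule \<rho>')"
      unfolding consistent_pairs by blast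
    then show "compatible m T T' \<and> rule_match (m = LVE) (m = LFE) \<rho> \<rho>'"
      using comp sh by (simp add: rule_match_def)
  next
    assume asm: "compatible m T T' \<and> rule_match (m = LVE) (m = LFE) \<rho> \<rho>'"
    then have sh: "shape (fst \<rho>) = shape (fst \<rho>')" "shape (snd \<rho>) = shape (snd \<rho>')"
      and con: "consistent (m = LVE) (m = LFE) (occ_rule \<rho>) (occ_rule \<rho>')"
      unfolding rule_match_def by blast+
    have id: "x = x'" if "((a, x), (a', x')) \<in> ?Z" "a = 6 \<and> m = LFE \<or> a = 7 \<and> m = LVE" for a x a' x'
      using con that unfolding consistent_pairs by blast
    have inj: "x = y \<longleftrightarrow> x' = y'" if "((a, x), (a', x')) \<in> ?Z" "((a, y), (b', y')) \<in> ?Z" for a x a' x' y b' y'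
      using con that unfolding consistent_pairs by blast
    \<comment> \<open>The correspondence of the symbols with tag \<open>b\<close>: 7 for function
      symbols, 6 for variables.\<close>
    define G where "G b = {(x, x'). \<exists>b'. ((b, x), (b', x')) \<in> ?Z}" for b :: nat
    have G7: "x \<in> F \<and> x' \<in> F' \<and> ar x = ar' x'" if "(x, x') \<in> G 7" for x x'
    proof -
      from that obtain b' where "((7, x), (b', x')) \<in> ?Z" by (auto simp: G_def)
      from wf[OF this sh] show ?thesis by simp
    qed
    have G6: "x \<in> V \<and> x' \<in> V'" if "(x, x') \<in> G 6" for x x'
    proof -
      from that obtain b' where "((6, x), (b', x')) \<in> ?Z" by (auto simp: G_def)
      from wf[OF this sh] show ?thesis by simp
    qed
    have Ginj: "x = y \<longleftrightarrow> x' = y'" if "(x, x') \<in> G b" "(y, y') \<in> G b" for b x x' y y'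
      using that inj unfolding G_def by blast
    have Gid: "x = x'" if "(x, x') \<in> G b" "b = 6 \<and> m = LFE \<or> b = 7 \<and> m = LVE" for b x x'
      using that id unfolding G_def by blast
    have "\<exists>pf. bij_betw pf F F' \<and> (\<forall>f\<in>F. ar' (pf f) = ar f) \<and> (\<forall>(x, x')\<in>G 7. pf x = x') \<and>
      (m = LVE \<longrightarrow> F = F' \<and> (\<forall>f\<in>F. ar' f = ar f) \<and> (\<forall>f\<in>F. pf f = f))"
    proof (cases "m = LVE")
      case True
      then show ?thesis using asm Gid[of _ _ 7]
        by (intro exI[of _ "\<lambda>f. f"]) (auto simp: compatible_def T1 T2 bij_betw_def)
    next
      case False
      have "\<exists>h. bij_betw h F F' \<and> (\<forall>x\<in>F. ar' (h x) = ar x) \<and> (\<forall>(x, x')\<in>G 7. h x = x')"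
      proof (rule extend_bij[OF fin(1,3)])
        show "G 7 \<subseteq> F \<times> F'" using G7 by auto
        show "ar x = ar' x'" if "(x, x') \<in> G 7" for x x' using G7[OF that] by simp
        show "x = y \<longleftrightarrow> x' = y'" if "(x, x') \<in> G 7" "(y, y') \<in> G 7" for x x' y y'
          by (rule Ginj[OF that])
        show "card {x\<in>F. ar x = k} = card {x\<in>F'. ar' x = k}" for k
          using asm False by (simp add: compatible_def T1 T2)
      qed
      then show ?thesis using False by simp
    qed
    then obtain pf where pf: "bij_betw pf F F'" "\<forall>f\<in>F. ar' (pf f) = ar f" "\<forall>(x, x')\<in>G 7. pf x = x'"
      "m = LVE \<longrightarrow> F = F' \<and> (\<forall>f\<in>F. ar' f = ar f) \<and> (\<forall>f\<in>F. pf f = f)" by blast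
    have "\<exists>pv. bij_betw pv V V' \<and> (\<forall>(x, x')\<in>G 6. pv x = x') \<and> (m = LFE \<longrightarrow> V = V' \<and> (\<forall>x\<in>V. pv x = x))"
    proof (cases "m = LFE")
      case True
      then show ?thesis using asm Gid[of _ _ 6]
        by (intro exI[of _ "\<lambda>f. f"]) (auto simp: compatible_def T1 T2 bij_betw_def)
    next
      case False
      \<comment> \<open>The class function is constantly \<open>()\<close>, so the class condition
        becomes equality of the two cardinalities.\<close>
      have "\<exists>h. bij_betw h V V' \<and> (\<forall>x\<in>V. () = ()) \<and> (\<forall>(x, x')\<in>G 6. h x = x')"
      proof (rule extend_bij[OF fin(2,4)])
        show "G 6 \<subseteq> V \<times> V'" using G6 by auto
        show "x = y \<longleftrightarrow> x' = y'" if "(x, x') \<in> G 6" "(y, y') \<in> G 6" for x x' y y'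
          by (rule Ginj[OF that])
        show "card {x\<in>V. () = k} = card {x\<in>V'. () = k}" for k
          using asm False by (simp add: compatible_def T1 T2)
      qed simp
      then show ?thesis using False by simp
    qed
    then obtain pv where pv: "bij_betw pv V V'" "\<forall>(x, x')\<in>G 6. pv x = x'"
      "m = LFE \<longrightarrow> V = V' \<and> (\<forall>x\<in>V. pv x = x)" by blast
    have "iso_m m T T' pf pv"
      using pf pv by (cases m) (auto simp: iso_m_def term_iso_def mode_ok_def T1 T2)
    moreover have "\<forall>((a, x), (a', x'))\<in>?Z. x' = (if a = 7 then pf x else pv x)"
    proof (clarify)
      fix a x a' x' assume z: "((a, x), (a', x')) \<in> ?Z"
      then have "(x, x') \<in> G a" by (auto simp: G_def)
      then show "x' = (if a = 7 then pf x else pv x)" using wf[OF z sh] pf(3) pv(2) by auto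
    qed
    ultimately show "\<exists>pf pv. iso_m m T T' pf pv \<and> ren pf pv (fst \<rho>) = fst \<rho>' \<and> ren pf pv (snd \<rho>) = snd \<rho>'"
      using sh ren_rule_iff by blast
  qed
qed

lemma normal_form_iff:
  assumes "is_trs T"
  shows "normal_form m T \<longleftrightarrow> (\<forall>\<rho>\<in>rules T. \<forall>\<rho>'\<in>rules T. rule_match (m = LVE) (m = LFE) \<rho> \<rho>' \<longrightarrow> \<rho> = \<rho>')"
proof -
  \<comment> \<open>Within one system compatibility is automatic and drops out of the
    criterion.\<close>
  have comp: "compatible m T T" by (simp add: compatible_def split: prod.split)
  have "normal_form m T \<longleftrightarrow> (\<forall>\<rho>\<in>rules T. \<forall>\<rho>'\<in>rules T. (\<exists>pf pv. iso_m m T T pf pv \<and>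
    ren pf pv (fst \<rho>) = fst \<rho>' \<and> ren pf pv (snd \<rho>) = snd \<rho>') \<longrightarrow> \<rho> = \<rho>')"
    unfolding normal_form_def Ball_def split_paired_All fst_conv snd_conv by blast
  then show ?thesis using iso_match_iff[OF assms assms, of _ _ m] comp by simp
qed

text \<open>Without rules in \<open>T\<close> the family of isomorphisms is empty, hence the guard
  before compatibility. With rules, any one isomorphism of the family forces it.\<close>

lemma trs_iso_iff:
  assumes T: "is_trs T" "is_trs T'"
  shows "trs_iso m T T' \<longleftrightarrow>
    (\<forall>\<rho>\<in>rules T. \<forall>\<rho>'\<in>rules T. rule_match (m = LVE) (m = LFE) \<rho> \<rho>' \<longrightarrow> \<rho> = \<rho>') \<and>
    (\<forall>\<rho>\<in>rules T'. \<forall>\<rho>'\<in>rules T'. rule_match (m = LVE) (m = LFE) \<rho> \<rho>' \<longrightarrow> \<rho> = \<rho>') \<and>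
    (\<forall>\<rho>\<in>rules T. \<exists>\<rho>'\<in>rules T'. rule_match (m = LVE) (m = LFE) \<rho> \<rho>') \<and>
    (\<forall>\<rho>'\<in>rules T'. \<exists>\<rho>\<in>rules T. rule_match (m = LVE) (m = LFE) \<rho> \<rho>') \<and>
    (rules T \<noteq> {} \<longrightarrow> compatible m T T')"
    (is "_ \<longleftrightarrow> ?N \<and> ?N' \<and> ?A \<and> ?B \<and> ?C")
proof -
  let ?match = "rule_match (m = LVE) (m = LFE)"
  have "local_iso m T T' \<longleftrightarrow> ?A \<and> ?B \<and> ?C" if N': ?N'
  proof
    assume "local_iso m T T'"
    then obtain PF PV where iso: "\<And>\<rho>. \<rho> \<in> rules T \<Longrightarrow> iso_m m T T' (PF \<rho>) (PV \<rho>)"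
      and im: "(\<lambda>\<rho>. (ren (PF \<rho>) (PV \<rho>) (fst \<rho>), ren (PF \<rho>) (PV \<rho>) (snd \<rho>))) ` rules T = rules T'"
      unfolding local_iso_def by blast
    have h: "(ren (PF \<rho>) (PV \<rho>) (fst \<rho>), ren (PF \<rho>) (PV \<rho>) (snd \<rho>)) \<in> rules T' \<and>
      compatible m T T' \<and> ?match \<rho> (ren (PF \<rho>) (PV \<rho>) (fst \<rho>), ren (PF \<rho>) (PV \<rho>) (snd \<rho>))"
      if "\<rho> \<in> rules T" for \<rho>
    proof
      show *: "(ren (PF \<rho>) (PV \<rho>) (fst \<rho>), ren (PF \<rho>) (PV \<rho>) (snd \<rho>)) \<in> rules T'" using im that by blast
      show "compatible m T T' \<and> ?match \<rho> (ren (PF \<rho>) (PV \<rho>) (fst \<rho>), ren (PF \<rho>) (PV \<rho>) (snd \<rho>))"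
        using iso_match_iff[OF T that *, of m] iso[OF that] by auto
    qed
    have ?A using h by blast
    moreover have ?C using h by blast
    moreover have ?B
    proof
      fix \<rho>' assume "\<rho>' \<in> rules T'"
      then obtain \<rho> where "\<rho> \<in> rules T" "\<rho>' = (ren (PF \<rho>) (PV \<rho>) (fst \<rho>), ren (PF \<rho>) (PV \<rho>) (snd \<rho>))"
        unfolding im[symmetric] by (rule imageE)
      then show "\<exists>\<rho>\<in>rules T. ?match \<rho> \<rho>'" using h[of \<rho>] by blast
    qed
    ultimately show "?A \<and> ?B \<and> ?C" by blast
  next
    assume ABC: "?A \<and> ?B \<and> ?C"
    then obtain f where f: "\<And>\<rho>. \<rho> \<in> rules T \<Longrightarrow> f \<rho> \<in> rules T' \<and> ?match \<rho> (f \<rho>)" by metis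
    have "\<exists>pf pv. iso_m m T T' pf pv \<and> ren pf pv (fst \<rho>) = fst (f \<rho>) \<and> ren pf pv (snd \<rho>) = snd (f \<rho>)"
      if "\<rho> \<in> rules T" for \<rho>
      using iso_match_iff[OF T that, of "f \<rho>" m] f[OF that] ABC that by blast
    then obtain PF PV where P: "\<And>\<rho>. \<rho> \<in> rules T \<Longrightarrow> iso_m m T T' (PF \<rho>) (PV \<rho>) \<and>
      ren (PF \<rho>) (PV \<rho>) (fst \<rho>) = fst (f \<rho>) \<and> ren (PF \<rho>) (PV \<rho>) (snd \<rho>) = snd (f \<rho>)" by metis
    have "f ` rules T = rules T'"
    proof
      show "f ` rules T \<subseteq> rules T'" using f by blast
      show "rules T' \<subseteq> f ` rules T"
      proof
        fix \<rho>' assume \<rho>': "\<rho>' \<in> rules T'"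
        then obtain \<rho> where \<rho>: "\<rho> \<in> rules T" "?match \<rho> \<rho>'" using ABC by blast
        \<comment> \<open>Both are partners of the same rule, hence match each other, and the normal
          form of \<open>T'\<close> identifies them. So an arbitrary choice \<open>f\<close> is
          onto.\<close>
        then have "f \<rho> = \<rho>'" using f[OF \<rho>(1)] rule_match_cancel N' \<rho>' by blast
        then show "\<rho>' \<in> f ` rules T" using \<rho>(1) by blast
      qed
    qed
    moreover have "(\<lambda>\<rho>. (ren (PF \<rho>) (PV \<rho>) (fst \<rho>), ren (PF \<rho>) (PV \<rho>) (snd \<rho>))) ` rules T = f ` rules T"
      by (rule image_cong[OF refl]) (use P in auto)
    ultimately show "local_iso m T T'" unfolding local_iso_def using P by blast
  qed
  then show ?thesis unfolding trs_iso_def normal_form_iff[OF T(1)] normal_form_iff[OF T(2)] by blast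
qed

section \<open>Isomorphism in terms of positions in the input\<close>

text \<open>Blocks 0, 1, 2 of the input list the function symbols, variables and rules of the first TRS,
  blocks 3, 4, 5 those of the second one.  Items of a block are represented by the position just before
  them, numerals by the position before their opening bracket.\<close>

primrec below :: "nat \<Rightarrow> nat list \<Rightarrow> nat \<Rightarrow> bool" where
  "below 0 w y = False"
| "below (Suc j) w y = (\<forall>x<length w. x < y \<longrightarrow> below j w x)"

definition depth0 :: "nat list \<Rightarrow> nat \<Rightarrow> bool" where
  "depth0 w y \<longleftrightarrow> card {x. x < length w \<and> (x < y \<and> sym_at w x = 3)} =
    card {x. x < length w \<and> (x < y \<and> sym_at w x = 4)}"

text \<open>The position \<open>y\<close> itself is counted on the right as the missing closing
  bracket, which turns a difference of one into an equality of counts.\<close>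

definition depth1 :: "nat list \<Rightarrow> nat \<Rightarrow> bool" where
  "depth1 w y \<longleftrightarrow> card {x. x < length w \<and> (x < y \<and> sym_at w x = 3)} =
    card {x. x < length w \<and> (x = y \<or> x < y \<and> sym_at w x = 4)}"

definition sep :: "nat list \<Rightarrow> nat \<Rightarrow> bool" where
  "sep w y \<longleftrightarrow> sym_at w y = 5 \<and> depth1 w y"

definition closer :: "nat list \<Rightarrow> nat \<Rightarrow> bool" where
  "closer w y \<longleftrightarrow> sym_at w y = 4 \<and> depth1 w y"

text \<open>The number of block ends before \<open>y\<close> is compared with the constant
  \<open>j\<close>, which is itself written as a count: \<open>below j\<close> holds of the first
  \<open>j\<close> positions.\<close>

definition in_block :: "nat \<Rightarrow> nat list \<Rightarrow> nat \<Rightarrow> bool" where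
  "in_block j w y \<longleftrightarrow> card {x. x < length w \<and> (x < y \<and> closer w x)} = card {x. x < length w \<and> below j w x}"

text \<open>A later separator in the same block is demanded because no item starts after the last
  separator, nor after the bracket of an empty block.\<close>

definition mark :: "nat \<Rightarrow> nat list \<Rightarrow> nat \<Rightarrow> bool" where
  "mark j w p \<longleftrightarrow> in_block j w p \<and> (sep w p \<or> sym_at w p = 3 \<and> depth0 w p) \<and>
    (\<exists>e<length w. p < e \<and> sep w e \<and> in_block j w e)"

text \<open>The range of \<open>y\<close> includes \<open>x\<close>, so the separator that ends the
  item does not belong to it.\<close>

definition in_item :: "nat list \<Rightarrow> nat \<Rightarrow> nat \<Rightarrow> bool" where
  "in_item w p x \<longleftrightarrow> p < x \<and> (\<forall>y<length w. p < y \<longrightarrow> \<not> x < y \<longrightarrow> \<not> sep w y)"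

text \<open>Corresponding positions are those of equal rank among the positions of their items that
  satisfy \<open>P\<close>.\<close>

definition corr :: "(nat \<Rightarrow> bool) \<Rightarrow> nat list \<Rightarrow> nat \<Rightarrow> nat \<Rightarrow> nat \<Rightarrow> nat \<Rightarrow> bool" where
  "corr P w p x q y \<longleftrightarrow> in_item w p x \<and> P (sym_at w x) \<and> in_item w q y \<and> P (sym_at w y) \<and>
    card {z. z < length w \<and> (in_item w p z \<and> P (sym_at w z) \<and> z < x)} =
    card {z. z < length w \<and> (in_item w q z \<and> P (sym_at w z) \<and> z < y)}"

text \<open>Compares the maximal runs of symbols below 4, that is, opening bracket and digits,
  behind \<open>x\<close> and \<open>y\<close>. Equal offsets are expressed by equally many
  positions in between. If one run ended earlier, the offset just behind it would carry a symbol
  below 4 on one side only, violating the condition.\<close>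

definition same_num :: "nat list \<Rightarrow> nat \<Rightarrow> nat \<Rightarrow> bool" where
  "same_num w x y \<longleftrightarrow> (\<forall>z<length w. \<forall>u<length w. x < z \<longrightarrow> y < u \<longrightarrow>
     card {t. t < length w \<and> (x < t \<and> t < z)} = card {t. t < length w \<and> (y < t \<and> t < u)} \<longrightarrow>
     (\<forall>t<length w. x < t \<longrightarrow> t < z \<longrightarrow> sym_at w t < 4) \<longrightarrow>
     (\<forall>t<length w. y < t \<longrightarrow> t < u \<longrightarrow> sym_at w t < 4) \<longrightarrow>
     sym_at w z < 4 \<or> sym_at w u < 4 \<longrightarrow> sym_at w z = sym_at w u)"

abbreviation structural :: "nat \<Rightarrow> bool" where "structural a \<equiv> 3 \<le> a"

abbreviation tag :: "nat \<Rightarrow> bool" where "tag a \<equiv> a = 6 \<or> a = 7"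

text \<open>The first two clauses compare the items with all digits deleted, which amounts to
  comparing shapes. The last one is \<open>consistent\<close>, with occurrences replaced by
  positions of tags.\<close>

definition item_match :: "bool \<Rightarrow> bool \<Rightarrow> nat list \<Rightarrow> nat \<Rightarrow> nat \<Rightarrow> bool" where
  "item_match idF idV w p q \<longleftrightarrow>
     card {x. x < length w \<and> (in_item w p x \<and> structural (sym_at w x))} =
     card {x. x < length w \<and> (in_item w q x \<and> structural (sym_at w x))} \<and>
     (\<forall>x<length w. \<forall>y<length w. corr structural w p x q y \<longrightarrow> sym_at w x = sym_at w y) \<and>
     (\<forall>x<length w. \<forall>y<length w. corr tag w p x q y \<longrightarrow>
        (sym_at w x = 6 \<and> idV \<or> sym_at w x = 7 \<and> idF \<longrightarrow> same_num w x y) \<and>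
        (\<forall>x'<length w. \<forall>y'<length w. corr tag w p x' q y' \<longrightarrow> sym_at w x = sym_at w x' \<longrightarrow>
           same_num w x x' = same_num w y y'))"

definition end_num :: "nat list \<Rightarrow> nat \<Rightarrow> nat \<Rightarrow> bool" where
  "end_num w p y \<longleftrightarrow> p < y \<and> sym_at w y = 4 \<and> (\<forall>t<length w. p < t \<longrightarrow> t < y \<longrightarrow> \<not> sym_at w t = 4)"

text \<open>An arity is written directly behind the numeral of its symbol, so the closing bracket of
  that numeral is the position that represents the arity.\<close>

definition same_arity :: "nat list \<Rightarrow> nat \<Rightarrow> nat \<Rightarrow> bool" where
  "same_arity w p q \<longleftrightarrow> (\<forall>y<length w. \<forall>u<length w. end_num w p y \<longrightarrow> end_num w q u \<longrightarrow> same_num w y u)"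

text \<open>A variable may be listed several times; counting only first occurrences gives the
  cardinality of the set.\<close>

definition vars_compatible :: "bool \<Rightarrow> nat list \<Rightarrow> bool" where
  "vars_compatible idV w \<longleftrightarrow> (if idV then
      (\<forall>p<length w. mark 1 w p \<longrightarrow> (\<exists>q<length w. mark 4 w q \<and> same_num w p q)) \<and>
      (\<forall>q<length w. mark 4 w q \<longrightarrow> (\<exists>p<length w. mark 1 w p \<and> same_num w p q))
    else
      card {p. p < length w \<and> (mark 1 w p \<and> (\<forall>q<length w. mark 1 w q \<longrightarrow> q < p \<longrightarrow> \<not> same_num w q p))} =
      card {p. p < length w \<and> (mark 4 w p \<and> (\<forall>q<length w. mark 4 w q \<longrightarrow> q < p \<longrightarrow> \<not> same_num w q p))})"

text \<open>Only arities of listed symbols are tested, since any other arity has count zero on both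
  sides.\<close>

definition funs_compatible :: "bool \<Rightarrow> nat list \<Rightarrow> bool" where
  "funs_compatible idF w \<longleftrightarrow> (if idF then
      (\<forall>p<length w. mark 0 w p \<longrightarrow> (\<exists>q<length w. mark 3 w q \<and> same_num w p q \<and> same_arity w p q)) \<and>
      (\<forall>q<length w. mark 3 w q \<longrightarrow> (\<exists>p<length w. mark 0 w p \<and> same_num w p q \<and> same_arity w p q))
    else
      (\<forall>r<length w. mark 0 w r \<or> mark 3 w r \<longrightarrow>
        card {p. p < length w \<and> (mark 0 w p \<and> same_arity w p r)} =
        card {p. p < length w \<and> (mark 3 w p \<and> same_arity w p r)}))"

text \<open>Distinct positions may hold the same rule, so the conclusion of the normal form clauses
  is a match with all symbols fixed rather than equality of positions.\<close>

definition word_iso :: "bool \<Rightarrow> bool \<Rightarrow> nat list \<Rightarrow> bool" where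
  "word_iso idF idV w \<longleftrightarrow>
     (\<forall>p<length w. \<forall>q<length w. mark 2 w p \<longrightarrow> mark 2 w q \<longrightarrow> item_match idF idV w p q \<longrightarrow> item_match True True w p q) \<and>
     (\<forall>p<length w. \<forall>q<length w. mark 5 w p \<longrightarrow> mark 5 w q \<longrightarrow> item_match idF idV w p q \<longrightarrow> item_match True True w p q) \<and>
     (\<forall>p<length w. mark 2 w p \<longrightarrow> (\<exists>q<length w. mark 5 w q \<and> item_match idF idV w p q)) \<and>
     (\<forall>q<length w. mark 5 w q \<longrightarrow> (\<exists>p<length w. mark 2 w p \<and> item_match idF idV w p q)) \<and>
     ((\<exists>p<length w. mark 2 w p) \<longrightarrow> funs_compatible idF w \<and> vars_compatible idV w)"

section \<open>Pointer programs for the positional predicates\<close>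

lemma dec_small: "i < d \<Longrightarrow> dec d (\<lambda>w e. sym_at w (e i) < 4)"
  by (rule dec_sym_pred)

lemma dec_structural: "i < d \<Longrightarrow> dec d (\<lambda>w e. structural (sym_at w (e i)))"
  by (rule dec_sym_pred)

lemma dec_tag: "i < d \<Longrightarrow> dec d (\<lambda>w e. tag (sym_at w (e i)))"
  by (rule dec_sym_pred)

text \<open>Applied backwards, these rules turn a bound position into register \<open>d + 2\<close>
  at depth \<open>d + 3\<close>; what remains are register bounds and insensitivity to registers out
  of scope.\<close>

lemmas dec_connectives = dec_less dec_same dec_sym dec_sym_eq dec_small
  dec_not dec_conj dec_disj dec_imp dec_iff dec_card_eq dec_all dec_ex

lemma dec_below: "i < d \<Longrightarrow> dec d (\<lambda>w e. below j w (e i))"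
proof (induction j arbitrary: d i)
  case 0
  then show ?case by (simp add: dec_const)
next
  case (Suc j)
  show ?case unfolding below.simps
    by (intro dec_connectives Suc.IH) (use Suc.prems in simp_all)
qed

lemma dec_depth0: "i < d \<Longrightarrow> dec d (\<lambda>w e. depth0 w (e i))"
  unfolding depth0_def by (intro dec_connectives) simp_all

lemma dec_depth1: "i < d \<Longrightarrow> dec d (\<lambda>w e. depth1 w (e i))"
  unfolding depth1_def by (intro dec_connectives) simp_all

lemma dec_sep: "i < d \<Longrightarrow> dec d (\<lambda>w e. sep w (e i))"
  unfolding sep_def by (intro dec_connectives dec_depth1) simp_all

lemma dec_closer: "i < d \<Longrightarrow> dec d (\<lambda>w e. closer w (e i))"
  unfolding closer_def by (intro dec_connectives dec_depth1) simp_all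

lemma dec_in_block: "i < d \<Longrightarrow> dec d (\<lambda>w e. in_block j w (e i))"
  unfolding in_block_def by (intro dec_connectives dec_closer dec_below) simp_all

lemma dec_mark: "i < d \<Longrightarrow> dec d (\<lambda>w e. mark j w (e i))"
  unfolding mark_def by (intro dec_connectives dec_in_block dec_sep dec_depth0) simp_all

lemma dec_in_item: "i < d \<Longrightarrow> j < d \<Longrightarrow> dec d (\<lambda>w e. in_item w (e i) (e j))"
  unfolding in_item_def by (intro dec_connectives dec_sep) simp_all

lemma dec_corr:
  assumes "\<And>d i. i < d \<Longrightarrow> dec d (\<lambda>w e. P (sym_at w (e i)))"
  shows "i < d \<Longrightarrow> j < d \<Longrightarrow> k < d \<Longrightarrow> l < d \<Longrightarrow> dec d (\<lambda>w e. corr P w (e i) (e j) (e k) (e l))"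
  unfolding corr_def by (intro dec_connectives dec_in_item assms) simp_all

lemma dec_same_num: "i < d \<Longrightarrow> j < d \<Longrightarrow> dec d (\<lambda>w e. same_num w (e i) (e j))"
  unfolding same_num_def by (intro dec_connectives) simp_all

lemma dec_item_match: "i < d \<Longrightarrow> j < d \<Longrightarrow> dec d (\<lambda>w e. item_match idF idV w (e i) (e j))"
  unfolding item_match_def
  by (intro dec_connectives dec_const dec_in_item dec_structural dec_same_num
      dec_corr[where P = structural, OF dec_structural] dec_corr[where P = tag, OF dec_tag]) simp_all

lemma dec_end_num: "i < d \<Longrightarrow> j < d \<Longrightarrow> dec d (\<lambda>w e. end_num w (e i) (e j))"
  unfolding end_num_def by (intro dec_connectives) simp_all

lemma dec_same_arity: "i < d \<Longrightarrow> j < d \<Longrightarrow> dec d (\<lambda>w e. same_arity w (e i) (e j))"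
  unfolding same_arity_def by (intro dec_connectives dec_end_num dec_same_num) simp_all

lemma dec_vars_compatible: "dec d (\<lambda>w e. vars_compatible idV w)"
  unfolding vars_compatible_def
  by (cases idV; simp only: if_True if_False; intro dec_connectives dec_mark dec_same_num; simp)

lemma dec_funs_compatible: "dec d (\<lambda>w e. funs_compatible idF w)"
  unfolding funs_compatible_def
  by (cases idF; simp only: if_True if_False; intro dec_connectives dec_mark dec_same_num dec_same_arity; simp)

lemma dec_word_iso: "dec d (\<lambda>w e. word_iso idF idV w)"
  unfolding word_iso_def
  by (intro dec_connectives dec_mark dec_item_match dec_vars_compatible dec_funs_compatible) simp_all

section \<open>Structure of the input word\<close>

definition num_before :: "nat \<Rightarrow> nat list \<Rightarrow> nat \<Rightarrow> nat" where
  "num_before a w y = card {x. x < y \<and> sym_at w x = a}"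

lemma num_before_0 [simp]: "num_before a w 0 = 0"
  by (simp add: num_before_def)

lemma num_before_Suc:
  "num_before a w (Suc y) = (if sym_at w y = a then Suc (num_before a w y) else num_before a w y)"
  unfolding num_before_def card_less_Suc ..

lemma prefix_restrict: "y \<le> n \<Longrightarrow> {x. x < n \<and> (x < y \<and> Q x)} = {x. x < y \<and> Q (x::nat)}"
  by auto

lemma depth0_iff: "y < length w \<Longrightarrow> depth0 w y \<longleftrightarrow> num_before 3 w y = num_before 4 w y"
  by (simp add: depth0_def prefix_restrict num_before_def)

lemma depth1_iff: "y < length w \<Longrightarrow> depth1 w y \<longleftrightarrow> num_before 3 w y = Suc (num_before 4 w y)"
proof -
  assume y: "y < length w"
  then have "{x. x < length w \<and> (x = y \<or> x < y \<and> sym_at w x = 4)} = insert y {x. x < y \<and> sym_at w x = 4}"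
    by auto
  then show ?thesis using y by (simp add: depth1_def prefix_restrict num_before_def)
qed

lemma below_iff: "y < length w \<Longrightarrow> below j w y \<longleftrightarrow> y < j"
proof (induction j arbitrary: y)
  case (Suc j)
  have "below (Suc j) w y \<longleftrightarrow> (\<forall>x<length w. x < y \<longrightarrow> x < j)" using Suc.IH by simp
  also have "\<dots> \<longleftrightarrow> y < Suc j" using Suc.prems
    by (metis less_Suc_eq_le less_trans not_less not_less_iff_gr_or_eq order_less_le_trans)
  finally show ?case .
qed simp

lemma card_below:
  assumes "j \<le> length w" shows "card {x. x < length w \<and> below j w x} = j"
proof -
  have "{x. x < length w \<and> below j w x} = {..<j}" using assms by (auto simp: below_iff)
  then show ?thesis by simp
qed

text \<open>A left-to-right reading that tracks the depth and the number of closed blocks. With an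
  integer depth no subtraction is truncated, so on every word the depth is the plain difference of
  bracket counts.\<close>

fun scan :: "int \<Rightarrow> nat \<Rightarrow> nat list \<Rightarrow> int \<times> nat" where
  "scan d c [] = (d, c)"
| "scan d c (a # v) = scan (if a = 3 then d + 1 else if a = 4 then d - 1 else d)
     (if a = 4 \<and> d = 1 then Suc c else c) v"

lemma scan_append: "scan d c (u @ v) = (case scan d c u of (d', c') \<Rightarrow> scan d' c' v)"
  by (induction u arbitrary: d c) auto

text \<open>Links the counting predicates, which see the whole word, to a function that splits over
  concatenation.\<close>

lemma scan_take:
  "y \<le> length w \<Longrightarrow> scan 0 0 (take y w) =
    (int (num_before 3 w y) - int (num_before 4 w y), card {x. x < y \<and> closer w x})"
proof (induction y)
  case (Suc y)
  then have y: "y < length w" and IH: "scan 0 0 (take y w) =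
    (int (num_before 3 w y) - int (num_before 4 w y), card {x. x < y \<and> closer w x})" by auto
  have s: "sym_at w y = w ! y" using y by (simp add: sym_at_def)
  have c: "closer w y \<longleftrightarrow> w ! y = 4 \<and> int (num_before 3 w y) - int (num_before 4 w y) = 1"
    using y by (auto simp: closer_def depth1_iff s)
  show ?case
    unfolding take_Suc_conv_app_nth[OF y] scan_append IH num_before_Suc card_less_Suc c s by simp
qed simp

lemma sep_iff: "y < length w \<Longrightarrow> sep w y \<longleftrightarrow> w ! y = 5 \<and> fst (scan 0 0 (take y w)) = 1"
  by (auto simp: sep_def depth1_iff scan_take sym_at_def)

lemma opener_iff:
  "y < length w \<Longrightarrow> sym_at w y = 3 \<and> depth0 w y \<longleftrightarrow> w ! y = 3 \<and> fst (scan 0 0 (take y w)) = 0"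
  by (auto simp: depth0_iff scan_take sym_at_def)

lemma in_block_iff:
  "y < length w \<Longrightarrow> j \<le> length w \<Longrightarrow> in_block j w y \<longleftrightarrow> snd (scan 0 0 (take y w)) = j"
  by (simp add: in_block_def card_below prefix_restrict scan_take)

text \<open>Besides closing every bracket, the word may contain separators only inside its own
  brackets. This keeps the separators of argument lists apart from those between items.\<close>

fun balanced :: "nat \<Rightarrow> nat list \<Rightarrow> bool" where
  "balanced d [] = (d = 0)"
| "balanced d (a # v) = (if a = 3 then balanced (Suc d) v else if a = 4 then d > 0 \<and> balanced (d - 1) v
     else if a = 5 then d > 0 \<and> balanced d v else balanced d v)"

text \<open>Inside an item the depth never drops below that of the block body, so no symbol of the
  item can be taken for a separator of items or for the end of the block.\<close>

lemma scan_balanced: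
  "balanced d s \<Longrightarrow> y \<le> length s \<Longrightarrow> \<exists>d'\<ge>1. scan (1 + int d) c (take y s) = (d', c) \<and>
     (y < length s \<longrightarrow> s ! y = 5 \<longrightarrow> d' > 1) \<and> (y = length s \<longrightarrow> d' = 1)"
proof (induction s arbitrary: d y)
  case (Cons a s)
  show ?case
  proof (cases y)
    case 0
    then show ?thesis using Cons.prems(1) by (intro exI[of _ "1 + int d"]) (auto split: if_splits)
  next
    case (Suc z)
    then have z: "z \<le> length s" using Cons.prems(2) by simp
    consider "a = 3" "balanced (Suc d) s" | "a = 4" "d > 0" "balanced (d - 1) s" | "a \<noteq> 3" "a \<noteq> 4" "balanced d s"
      using Cons.prems(1) by (auto split: if_splits)
    then show ?thesis
    proof cases
      case 1
      then show ?thesis using Cons.IH[OF 1(2) z] Suc by (simp add: add.commute)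
    next
      case 2
      moreover have "1 + int (d - 1) = int d" using 2 by simp
      ultimately show ?thesis using Cons.IH[OF 2(3) z] Suc by simp
    next
      case 3
      then show ?thesis using Cons.IH[OF 3(3) z] Suc by simp
    qed
  qed
qed simp

section \<open>Words composed of blocks of balanced items\<close>

definition body :: "nat list list \<Rightarrow> nat list" where
  "body S = concat (map (\<lambda>s. s @ [5]) S)"

definition blk :: "nat list list \<Rightarrow> nat list" where
  "blk S = 3 # body S @ [4]"

lemma body_simps [simp]: "body [] = []" "body (s # S) = s @ 5 # body S"
  by (simp_all add: body_def)

text \<open>Induction over the items: a position lies in the first item, on its separator, or in the
  remainder, which is reached with depth and counter restored. A separator is the last symbol of the
  text of its item, hence \<open>Suc y\<close> on the left of the length equation.\<close>

lemma scan_body: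
  assumes "\<forall>s\<in>set S. balanced 0 s" "y \<le> length (body S)"
  shows "(\<exists>d'\<ge>1. scan 1 c (take y (body S)) = (d', c)) \<and>
     (y = length (body S) \<longrightarrow> scan 1 c (take y (body S)) = (1, c)) \<and>
     (y < length (body S) \<longrightarrow> (body S ! y = 5 \<and> fst (scan 1 c (take y (body S))) = 1 \<longleftrightarrow>
        (\<exists>i<length S. Suc y = length (body (take (Suc i) S)))))"
  using assms
proof (induction S arbitrary: y)
  case (Cons s S)
  have bal: "balanced 0 s" using Cons.prems(1) by simp
  consider "y < length s" | "y = length s" | y' where "y = length s + 1 + y'" "y' \<le> length (body S)"
  proof -
    assume a: "y < length s \<Longrightarrow> thesis" "y = length s \<Longrightarrow> thesis"
      "\<And>y'. y = length s + 1 + y' \<Longrightarrow> y' \<le> length (body S) \<Longrightarrow> thesis"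
    show thesis
    proof (cases "y \<le> length s")
      case False
      then show thesis using Cons.prems(2) by (intro a(3)[of "y - length s - 1"]) auto
    qed (use a in linarith)
  qed
  then show ?case
  proof cases
    case 1
    then show ?thesis using scan_balanced[OF bal, of y c] by (auto simp: nth_append)
  next
    case 2
    then show ?thesis using scan_balanced[OF bal, of y c] by (auto intro!: exI[of _ 0])
  next
    case 3
    have sc: "scan 1 c s = (1, c)" using scan_balanced[OF bal, of "length s" c] by auto
    have t: "take y (body (s # S)) = s @ 5 # take y' (body S)" using 3(1) by simp
    have S: "scan 1 c (take y (body (s # S))) = scan 1 c (take y' (body S))"
      unfolding t scan_append sc by simp
    have n: "body (s # S) ! y = body S ! y'" using 3(1) by (simp add: nth_append)
    have ex: "(\<exists>i<length (s # S). Suc y = length (body (take (Suc i) (s # S)))) \<longleftrightarrow>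
      (\<exists>i<length S. Suc y' = length (body (take (Suc i) S)))"
    proof
      assume "\<exists>i<length (s # S). Suc y = length (body (take (Suc i) (s # S)))"
      then obtain i where i: "i < length (s # S)" "Suc y = length (body (take (Suc i) (s # S)))" by blast
      then obtain k where "i = Suc k" using 3(1) by (cases i) auto
      then show "\<exists>i<length S. Suc y' = length (body (take (Suc i) S))" using i 3(1) by (intro exI[of _ k]) simp
    next
      assume "\<exists>i<length S. Suc y' = length (body (take (Suc i) S))"
      then obtain k where k: "k < length S" "Suc y' = length (body (take (Suc k) S))" by blast
      then show "\<exists>i<length (s # S). Suc y = length (body (take (Suc i) (s # S)))"
        using 3(1) by (intro exI[of _ "Suc k"]) (simp del: take_Suc)
    qed
    have l: "y = length (body (s # S)) \<longleftrightarrow> y' = length (body S)" "y < length (body (s # S)) \<longleftrightarrow> y' < length (body S)"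
      using 3(1) by simp_all
    show ?thesis unfolding S n ex l using Cons.IH[OF _ 3(2)] Cons.prems(1) by simp
  qed
qed simp

lemma scan_blk:
  assumes "\<forall>s\<in>set S. balanced 0 s" "y \<le> length (body S)"
  shows "scan 0 c (take (Suc y) (blk S)) = scan 1 c (take y (body S))"
  using assms(2) by (simp add: blk_def)

lemma scan_blk_all: "\<forall>s\<in>set S. balanced 0 s \<Longrightarrow> scan 0 c (blk S) = (0, Suc c)"
  using scan_body[of S "length (body S)" c] by (simp add: blk_def scan_append)

lemma scan_blocks:
  "\<forall>S\<in>set SS. \<forall>s\<in>set S. balanced 0 s \<Longrightarrow> scan 0 c (concat (map blk SS)) = (0, c + length SS)"
  by (induction SS arbitrary: c) (auto simp: scan_append scan_blk_all)

locale blocks =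
  fixes SS :: "nat list list list"
  assumes bal: "\<And>S s. S \<in> set SS \<Longrightarrow> s \<in> set S \<Longrightarrow> balanced 0 s"
begin

definition W :: "nat list" where "W = concat (map blk SS)"

definition off :: "nat \<Rightarrow> nat" where "off j = length (concat (map blk (take j SS)))"

lemma W_split:
  assumes "j < length SS"
  shows "W = concat (map blk (take j SS)) @ blk (SS ! j) @ concat (map blk (drop (Suc j) SS))"
  unfolding W_def by (subst id_take_nth_drop[OF assms]) simp

lemma W_block:
  assumes j: "j < length SS" and y: "y < length (blk (SS ! j))"
  shows "W ! (off j + y) = blk (SS ! j) ! y" "scan 0 0 (take (off j + y) W) = scan 0 j (take y (blk (SS ! j)))"
    "off j + y < length W"
proof -
  have "scan 0 0 (concat (map blk (take j SS))) = (0, j)"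
    using scan_blocks[of "take j SS" 0] bal j by (auto dest: in_set_takeD)
  then show "scan 0 0 (take (off j + y) W) = scan 0 j (take y (blk (SS ! j)))"
    using y by (simp add: W_split[OF j] off_def scan_append)
qed (use y in \<open>simp_all add: W_split[OF j] off_def nth_append\<close>)

text \<open>The counter concerns only symbols strictly before the position, so even the closing
  bracket of a block belongs to it.\<close>

lemma scan_in_block:
  assumes j: "j < length SS" and y: "y < length (blk (SS ! j))"
  shows "snd (scan 0 0 (take (off j + y) W)) = j"
proof (cases y)
  case 0
  then show ?thesis using W_block(2)[OF j y] by simp
next
  case (Suc z)
  have b: "\<forall>s\<in>set (SS ! j). balanced 0 s" using bal nth_mem[OF j] by blast
  have z: "z \<le> length (body (SS ! j))" using y Suc by (simp add: blk_def)
  show ?thesis using W_block(2)[OF j y] scan_blk[OF b z] scan_body[OF b z, of j] Suc by auto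
qed

lemma find_block:
  assumes "y < length W"
  obtains j z where "j < length SS" "z < length (blk (SS ! j))" "y = off j + z"
proof -
  have "\<exists>j z. j < length TT \<and> z < length (blk (TT ! j)) \<and> y = length (concat (map blk (take j TT))) + z"
    if "y < length (concat (map blk TT))" for y and TT :: "nat list list list"
    using that
  proof (induction TT arbitrary: y)
    case (Cons T TT)
    show ?case
    proof (cases "y < length (blk T)")
      case True
      then show ?thesis by (intro exI[of _ 0] exI[of _ y]) simp
    next
      case False
      then have "y - length (blk T) < length (concat (map blk TT))" using Cons.prems by simp
      from Cons.IH[OF this] obtain j z where "j < length TT" "z < length (blk (TT ! j))"
        "y - length (blk T) = length (concat (map blk (take j TT))) + z" by blast
      then show ?thesis using False by (intro exI[of _ "Suc j"] exI[of _ z]) simp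
    qed
  qed simp
  from this[OF assms[unfolded W_def]] show thesis using that unfolding off_def by blast
qed

lemma in_block_W:
  assumes j: "j < length SS" and y: "y < length W"
  shows "in_block j W y \<longleftrightarrow> off j \<le> y \<and> y < off j + length (blk (SS ! j))"
proof -
  \<comment> \<open>Needed for \<open>below j\<close> to hold at exactly \<open>j\<close> positions
    of the word; every block contributes at least its brackets.\<close>
  have jW: "j \<le> length W"
  proof -
    have "length TT \<le> length (concat (map blk TT))" for TT
      by (induction TT) (auto simp: blk_def)
    from this[of SS] show ?thesis using j by (simp add: W_def)
  qed
  obtain i z where i: "i < length SS" "z < length (blk (SS ! i))" "y = off i + z" using find_block[OF y] .
  have "in_block j W y \<longleftrightarrow> i = j" using in_block_iff[OF y jW] scan_in_block[OF i(1,2)] i(3) by simp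
  moreover have "i = j" if "off j \<le> y" "y < off j + length (blk (SS ! j))"
    using scan_in_block[OF j, of "y - off j"] scan_in_block[OF i(1,2)] i(3) that by simp
  ultimately show ?thesis using i by auto
qed

text \<open>The opening bracket shifts the body by one, so this is the cell just before item
  \<open>i\<close>: the bracket for \<open>i = 0\<close>, otherwise the separator of the preceding
  item. With \<open>i\<close> the number of items it is the last separator, or the bracket of an
  empty block.\<close>

definition pos :: "nat \<Rightarrow> nat \<Rightarrow> nat" where
  "pos j i = off j + length (body (take i (SS ! j)))"

lemma pos_Suc:
  assumes "i < length (SS ! j)" shows "pos j (Suc i) = pos j i + length (SS ! j ! i) + 1"
proof -
  have "body (S @ T) = body S @ body T" for S T by (simp add: body_def)
  then show ?thesis using assms by (simp add: pos_def take_Suc_conv_app_nth)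
qed

lemma pos_less: "i < k \<Longrightarrow> k \<le> length (SS ! j) \<Longrightarrow> pos j i < pos j k"
proof (induction k)
  case (Suc k)
  then show ?case using pos_Suc[of k j] by (cases "i = k") auto
qed simp

lemma pos_less_iff: "i \<le> length (SS ! j) \<Longrightarrow> k \<le> length (SS ! j) \<Longrightarrow> pos j i < pos j k \<longleftrightarrow> i < k"
  using pos_less by (metis less_imp_not_less linorder_neqE_nat)

lemma pos_in_blk:
  assumes "i \<le> length (SS ! j)" shows "off j \<le> pos j i" "pos j i < off j + length (blk (SS ! j)) - 1"
proof -
  have "pos j i \<le> pos j (length (SS ! j))" using pos_less[of i "length (SS ! j)" j] assms by (cases "i = length (SS ! j)") auto
  then show "off j \<le> pos j i" "pos j i < off j + length (blk (SS ! j)) - 1" by (simp_all add: pos_def blk_def)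
qed

lemma pos_less_W: "j < length SS \<Longrightarrow> i \<le> length (SS ! j) \<Longrightarrow> pos j i < length W"
  using W_block(3)[of j "pos j i - off j"] pos_in_blk[of i j] by simp

text \<open>The body is settled by \<open>scan_body\<close>; the two remaining cells of the block
  are its brackets, which are no separators.\<close>

lemma sep_W:
  assumes j: "j < length SS" and e: "e < length W"
  shows "sep W e \<and> in_block j W e \<longleftrightarrow> (\<exists>i<length (SS ! j). e = pos j (Suc i))"
proof (cases "off j \<le> e \<and> e < off j + length (blk (SS ! j))")
  case True
  define z where "z = e - off j"
  have z: "z < length (blk (SS ! j))" "e = off j + z" using True by (auto simp: z_def)
  have b: "\<forall>s\<in>set (SS ! j). balanced 0 s" using bal nth_mem[OF j] by blast
  have "sep W e \<longleftrightarrow> (\<exists>i<length (SS ! j). e = pos j (Suc i))"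
  proof (cases z)
    case 0
    then have "\<not> sep W e" using sep_iff[OF e] W_block(2)[OF j z(1)] z(2) by simp
    moreover have "e \<noteq> pos j (Suc i)" if "i < length (SS ! j)" for i
      using pos_less[of 0 "Suc i" j] that z(2) 0 by (simp add: pos_def)
    ultimately show ?thesis by blast
  next
    case (Suc x)
    then have x: "x \<le> length (body (SS ! j))" using z by (simp add: blk_def)
    have sc: "scan 0 0 (take e W) = scan 1 j (take x (body (SS ! j)))"
      using W_block(2)[OF j z(1)] scan_blk[OF b x] Suc z(2) by simp
    show ?thesis
    proof (cases "x < length (body (SS ! j))")
      case True
      have "W ! e = body (SS ! j) ! x" using W_block(1)[OF j z(1)] z(2) Suc True by (simp add: blk_def nth_append)
      then have "sep W e \<longleftrightarrow> (\<exists>i<length (SS ! j). Suc x = length (body (take (Suc i) (SS ! j))))"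
        using sep_iff[OF e] scan_body[OF b x, of j] True sc by simp
      then show ?thesis using z(2) Suc by (simp add: pos_def)
    next
      case False
      then have "W ! e = 4" using W_block(1)[OF j z(1)] z(2) Suc x by (simp add: blk_def nth_append)
      then have "\<not> sep W e" using sep_iff[OF e] by simp
      moreover have "e \<noteq> pos j (Suc i)" if "i < length (SS ! j)" for i
        using pos_in_blk(2)[of "Suc i" j] that z(2) Suc False by (simp add: blk_def)
      ultimately show ?thesis by blast
    qed
  qed
  then show ?thesis using in_block_W[OF j e] True by simp
next
  case False
  then have "e \<noteq> pos j (Suc i)" if "i < length (SS ! j)" for i
    using pos_in_blk[of "Suc i" j] that by auto
  then show ?thesis using in_block_W[OF j e] False by blast
qed

lemma opener_W:
  assumes j: "j < length SS" and e: "e < length W"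
  shows "(sym_at W e = 3 \<and> depth0 W e) \<and> in_block j W e \<longleftrightarrow> e = pos j 0"
proof (cases "off j \<le> e \<and> e < off j + length (blk (SS ! j))")
  case True
  define z where "z = e - off j"
  have z: "z < length (blk (SS ! j))" "e = off j + z" using True by (auto simp: z_def)
  have b: "\<forall>s\<in>set (SS ! j). balanced 0 s" using bal nth_mem[OF j] by blast
  have "(sym_at W e = 3 \<and> depth0 W e) \<longleftrightarrow> z = 0"
  proof (cases z)
    case 0
    then show ?thesis using opener_iff[OF e] W_block(1,2)[OF j z(1)] z(2) by (simp add: blk_def)
  next
    case (Suc x)
    then have x: "x \<le> length (body (SS ! j))" using z by (simp add: blk_def)
    have sc: "scan 0 0 (take e W) = scan 1 j (take x (body (SS ! j)))"
      using W_block(2)[OF j z(1)] scan_blk[OF b x] Suc z(2) by simp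
    then show ?thesis using opener_iff[OF e] scan_body[OF b x, of j] Suc by auto
  qed
  then show ?thesis using in_block_W[OF j e] True z(2) by (auto simp: pos_def)
next
  case False
  then show ?thesis using in_block_W[OF j e] pos_in_blk[of 0 j] by auto
qed

lemma mark_W:
  assumes j: "j < length SS" and p: "p < length W"
  shows "mark j W p \<longleftrightarrow> (\<exists>i<length (SS ! j). p = pos j i)"
proof -
  let ?N = "length (SS ! j)"
  have "mark j W p \<longleftrightarrow> (sep W p \<and> in_block j W p \<or> (sym_at W p = 3 \<and> depth0 W p) \<and> in_block j W p) \<and>
    (\<exists>e<length W. p < e \<and> (sep W e \<and> in_block j W e))"
    unfolding mark_def by blast
  also have "\<dots> \<longleftrightarrow> ((\<exists>i<?N. p = pos j (Suc i)) \<or> p = pos j 0) \<and> (\<exists>i<?N. p < pos j (Suc i))"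
    unfolding sep_W[OF j p] opener_W[OF j p] using sep_W[OF j] pos_less_W[OF j]
    by (metis Suc_leI)
  also have "\<dots> \<longleftrightarrow> (\<exists>i<?N. p = pos j i)"
  proof
    assume "((\<exists>i<?N. p = pos j (Suc i)) \<or> p = pos j 0) \<and> (\<exists>i<?N. p < pos j (Suc i))"
    then obtain i k where "i \<le> ?N" "p = pos j i" "k < ?N" "p < pos j (Suc k)" by (metis Suc_leI le0)
    then show "\<exists>i<?N. p = pos j i" using pos_less_iff[of i j "Suc k"] by (intro exI[of _ i]) simp
  next
    assume "\<exists>i<?N. p = pos j i"
    then obtain i where i: "i < ?N" "p = pos j i" by blast
    have "p < pos j (Suc i)" using pos_less[of i "Suc i" j] i by simp
    moreover have "(\<exists>i<?N. p = pos j (Suc i)) \<or> p = pos j 0" using i by (cases i) (auto intro: Suc_lessD)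
    ultimately show "((\<exists>i<?N. p = pos j (Suc i)) \<or> p = pos j 0) \<and> (\<exists>i<?N. p < pos j (Suc i))"
      using i(1) by blast
  qed
  finally show ?thesis .
qed

lemma in_item_W:
  assumes j: "j < length SS" and i: "i < length (SS ! j)" and x: "x < length W"
  shows "in_item W (pos j i) x \<longleftrightarrow> pos j i < x \<and> x \<le> pos j i + length (SS ! j ! i)"
proof
  assume *: "in_item W (pos j i) x"
  have "pos j (Suc i) < length W" using pos_less_W[OF j, of "Suc i"] i by simp
  moreover have "sep W (pos j (Suc i))" using sep_W[OF j calculation] i by blast
  ultimately have "x < pos j (Suc i)" using * pos_less[of i "Suc i" j] i by (auto simp: in_item_def)
  then show "pos j i < x \<and> x \<le> pos j i + length (SS ! j ! i)"
    using * pos_Suc[OF i] by (auto simp: in_item_def)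
next
  assume *: "pos j i < x \<and> x \<le> pos j i + length (SS ! j ! i)"
  have "\<not> sep W y" if y: "y < length W" "pos j i < y" "\<not> x < y" for y
  proof
    assume "sep W y"
    have ylt: "y < pos j (Suc i)" using y * pos_Suc[OF i] by simp
    then have "in_block j W y"
      using in_block_W[OF j y(1)] y(2) pos_in_blk[of i j] pos_in_blk[of "Suc i" j] i by simp
    \<comment> \<open>A separator inside the item would be some \<open>pos j (Suc k)\<close>
      strictly between the consecutive values \<open>pos j i\<close> and
      \<open>pos j (Suc i)\<close>.\<close>
    then obtain k where "k < length (SS ! j)" "y = pos j (Suc k)" using sep_W[OF j y(1)] \<open>sep W y\<close> by blast
    then show False using pos_less_iff[of i j "Suc k"] pos_less_iff[of "Suc k" j "Suc i"] y(2) ylt i by simp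
  qed
  then show "in_item W (pos j i) x" using * by (auto simp: in_item_def)
qed

lemma item_split:
  assumes j: "j < length SS" and i: "i < length (SS ! j)"
  shows "\<exists>A B. W = A @ SS ! j ! i @ 5 # B \<and> length A = Suc (pos j i)"
proof -
  have "body (S @ T) = body S @ body T" for S T by (simp add: body_def)
  then have "body (SS ! j) = body (take i (SS ! j)) @ SS ! j ! i @ 5 # body (drop (Suc i) (SS ! j))"
    by (subst id_take_nth_drop[OF i]) simp
  then show ?thesis unfolding W_split[OF j]
    by (intro exI[of _ "concat (map blk (take j SS)) @ 3 # body (take i (SS ! j))"]
        exI[of _ "body (drop (Suc i) (SS ! j)) @ 4 # concat (map blk (drop (Suc j) SS))"])
      (simp add: blk_def pos_def off_def)
qed

end

section \<open>Unique readability of numerals and terms\<close>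

declare bin.simps [simp del]

lemma bin_0 [simp]: "bin 0 = []"
  by (simp add: bin.simps)

lemma set_bin: "set (bin n) \<subseteq> {1, 2}"
proof (induction n rule: less_induct)
  case (less n)
  then show ?case by (cases "n = 0") (auto simp: bin.simps[of n])
qed

lemma bin_inj: "bin m = bin n \<Longrightarrow> m = n"
proof (induction m arbitrary: n rule: less_induct)
  case (less m)
  show ?case
  proof (cases "m = 0")
    case True
    then show ?thesis using less.prems by (simp add: bin.simps[of n] split: if_splits)
  next
    case False
    then have n: "n \<noteq> 0" using less.prems by (cases "n = 0") (simp_all add: bin.simps[of m])
    have "m mod 2 = n mod 2" "bin (m div 2) = bin (n div 2)"
      using less.prems False n by (simp_all add: bin.simps[of m] bin.simps[of n])
    moreover have "m div 2 = n div 2" using less.IH[OF _ calculation(2)] False by simp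
    ultimately show ?thesis by (metis div_mult_mod_eq)
  qed
qed

lemma bin_eq_iff: "bin m = bin n \<longleftrightarrow> m = n"
  using bin_inj by blast

lemma takeWhile_bin: "takeWhile (\<lambda>a. a < 4) (3 # bin n @ 4 # v) = 3 # bin n"
proof -
  have "\<forall>a\<in>set (bin n). a < 4" using set_bin[of n] by fastforce
  then show ?thesis by (simp add: takeWhile_append2)
qed

lemma filter_structural_bin [simp]: "filter structural (bin n) = []"
  using set_bin[of n] by (force simp: filter_empty_conv)

text \<open>The numeral of 0 has no digits, so deleting all digits has the same effect as renaming
  every symbol to 0.\<close>

lemma filter_enc_trm: "filter structural (enc_trm t) = enc_trm (shape t)"
proof (induction t)
  case (Fun f ts)
  have "filter structural (concat (map (\<lambda>t. enc_trm t @ [5]) ts)) =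
    concat (map (\<lambda>t. enc_trm t @ [5]) (map shape ts))"
    using Fun.IH by (induction ts) auto
  then show ?case by (simp add: enc_nat_def)
qed (simp add: enc_nat_def)

lemma bin_prefix: "bin m @ 4 # u = bin n @ 4 # v \<Longrightarrow> m = n \<and> u = v"
proof -
  assume *: "bin m @ 4 # u = bin n @ 4 # v"
  then have "takeWhile (\<lambda>a. a < 4) (3 # bin m @ 4 # u) = takeWhile (\<lambda>a. a < 4) (3 # bin n @ 4 # v)" by simp
  then have "m = n" unfolding takeWhile_bin using bin_inj by simp
  with * show ?thesis by simp
qed

lemma enc_trm_Cons: "\<exists>a s. enc_trm t = a # s \<and> tag a"
  by (cases t) auto

text \<open>The term code is prefix-free; hence the two sides of a rule can be recovered although
  they are written without a separator between them.\<close>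

lemma enc_trm_prefix: "enc_trm t @ u = enc_trm t' @ u' \<Longrightarrow> t = t' \<and> u = u'"
proof (induction t arbitrary: t' u u')
  case (Var x)
  then show ?case by (cases t') (auto simp: enc_nat_def dest: bin_prefix)
next
  case (Fun f ts)
  then obtain g us where t': "t' = Fun g us" by (cases t') auto
  let ?A = "\<lambda>ts. concat (map (\<lambda>t. enc_trm t @ [5]) ts)"
  have "bin f @ 4 # 3 # ?A ts @ 4 # u = bin g @ 4 # 3 # ?A us @ 4 # u'"
    using Fun.prems by (simp add: t' enc_nat_def)
  from bin_prefix[OF this] have fg: "f = g" and "?A ts @ 4 # u = ?A us @ 4 # u'" by auto
  from this(2) have "ts = us \<and> u = u'" using Fun.IH
  proof (induction ts arbitrary: us)
    case Nil
    \<comment> \<open>The list of arguments ends with a closing bracket, whereas an argument starts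
      with a tag.\<close>
    then show ?case using enc_trm_Cons[of "hd us"] by (cases us) auto
  next
    case (Cons t ts)
    obtain v us' where us: "us = v # us'"
      using Cons.prems(1) enc_trm_Cons[of t] by (cases us) auto
    have "enc_trm t @ (5 # ?A ts @ 4 # u) = enc_trm v @ (5 # ?A us' @ 4 # u')"
      using Cons.prems(1) us by simp
    then have "t = v \<and> 5 # ?A ts @ 4 # u = 5 # ?A us' @ 4 # u'" by (rule Cons.prems(2)[rotated]) simp
    moreover have "ts = us' \<and> u = u'"
      by (rule Cons.IH) (use calculation in simp, rule Cons.prems(2), auto)
    ultimately show ?case using us by simp
  qed
  then show ?case using fg t' by simp
qed

lemma enc_rule_shape:
  "filter structural (enc_trm l @ enc_trm r) = filter structural (enc_trm l' @ enc_trm r') \<longleftrightarrow>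
    shape l = shape l' \<and> shape r = shape r'"
proof
  assume "filter structural (enc_trm l @ enc_trm r) = filter structural (enc_trm l' @ enc_trm r')"
  then have *: "enc_trm (shape l) @ enc_trm (shape r) = enc_trm (shape l') @ enc_trm (shape r')"
    by (simp add: filter_enc_trm)
  then have "shape l = shape l'" "enc_trm (shape r) @ [] = enc_trm (shape r') @ []"
    using enc_trm_prefix by (blast, fastforce dest: enc_trm_prefix)
  then show "shape l = shape l' \<and> shape r = shape r'" using enc_trm_prefix by blast
qed (simp add: filter_enc_trm)

text \<open>The second argument is the text that follows: numerals are read off all the remaining
  text, exactly as from positions in the word, and the function then splits over
  concatenation.\<close>

fun occs :: "nat list \<Rightarrow> nat list \<Rightarrow> (nat \<times> nat list) list" where
  "occs [] v = []"
| "occs (a # s) v = (if tag a then [(a, takeWhile (\<lambda>a. a < 4) (s @ v))] else []) @ occs s v"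

lemma occs_append: "occs (s @ t) v = occs s (t @ v) @ occs t v"
  by (induction s) auto

lemma occs_untagged: "\<forall>a\<in>set s. \<not> tag a \<Longrightarrow> occs s v = []"
  by (induction s) auto

lemma occs_bin [simp]: "occs (bin n) v = []"
  using set_bin[of n] by (intro occs_untagged) fastforce

lemma occs_enc_trm: "occs (enc_trm t) v = map (\<lambda>(a, x). (a, 3 # bin x)) (occ t)"
proof (induction t arbitrary: v)
  case (Var x)
  then show ?case using takeWhile_bin[of x v] by (simp add: enc_nat_def occs_append)
next
  case (Fun f ts)
  let ?A = "\<lambda>ts. concat (map (\<lambda>t. enc_trm t @ [5]) ts)"
  have "occs (?A ts) v = map (\<lambda>(a, x). (a, 3 # bin x)) (concat (map occ ts))" for v
    using Fun.IH by (induction ts) (simp_all add: occs_append)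
  then show ?case using takeWhile_bin[of f "3 # ?A ts @ 4 # v"] by (simp add: enc_nat_def occs_append)
qed

section \<open>Comparing numerals and items by positions\<close>

definition numstr :: "nat list \<Rightarrow> nat \<Rightarrow> nat list" where
  "numstr w x = takeWhile (\<lambda>a. a < 4) (drop (Suc x) w)"

text \<open>Equality of two initial runs stated offset by offset, in the form of
  \<open>same_num\<close>. Each run has to be stopped by an element of its own list; otherwise the
  end of a list could hide a difference in length.\<close>

lemma takeWhile_eq_iff:
  assumes "\<exists>a\<in>set xs. \<not> P a" "\<exists>a\<in>set ys. \<not> P a"
  shows "takeWhile P xs = takeWhile P ys \<longleftrightarrow> (\<forall>i. i < length xs \<longrightarrow> i < length ys \<longrightarrow>
    (\<forall>k<i. P (xs ! k)) \<longrightarrow> (\<forall>k<i. P (ys ! k)) \<longrightarrow> P (xs ! i) \<or> P (ys ! i) \<longrightarrow> xs ! i = ys ! i)"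
  using assms
proof (induction xs arbitrary: ys)
  case (Cons a xs)
  then obtain b ys' where ys: "ys = b # ys'" by (cases ys) auto
  have all_Suc: "(\<forall>i. Q i) \<longleftrightarrow> Q 0 \<and> (\<forall>i. Q (Suc i))" for Q :: "nat \<Rightarrow> bool"
    by (metis not0_implies_Suc)
  have less_Suc: "(\<forall>k<Suc i. Q k) \<longleftrightarrow> Q 0 \<and> (\<forall>k<i. Q (Suc k))" for Q :: "nat \<Rightarrow> bool" and i
    by (metis less_Suc_eq_0_disj)
  show ?case
  proof (cases "P a \<and> P b")
    case True
    then have IH: "takeWhile P xs = takeWhile P ys' \<longleftrightarrow> (\<forall>i. i < length xs \<longrightarrow> i < length ys' \<longrightarrow>
      (\<forall>k<i. P (xs ! k)) \<longrightarrow> (\<forall>k<i. P (ys' ! k)) \<longrightarrow> P (xs ! i) \<or> P (ys' ! i) \<longrightarrow> xs ! i = ys' ! i)"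
      using Cons.IH[of ys'] Cons.prems ys by simp
    show ?thesis unfolding ys by (subst all_Suc) (use True IH in \<open>simp add: less_Suc\<close>)
  next
    case False
    then show ?thesis unfolding ys by (subst all_Suc) (auto simp: less_Suc)
  qed
qed simp

text \<open>The positions \<open>a\<close> and \<open>b\<close> witness that both runs end inside
  the word, as \<open>takeWhile_eq_iff\<close> requires.\<close>

lemma same_num_iff:
  assumes x: "x < a" "a < length w" "\<not> w ! a < 4" and y: "y < b" "b < length w" "\<not> w ! b < 4"
  shows "same_num w x y \<longleftrightarrow> numstr w x = numstr w y"
proof -
  let ?n = "length w"
  let ?xs = "drop (Suc x) w" and ?ys = "drop (Suc y) w"
  have "?xs ! (a - Suc x) = w ! a" "?ys ! (b - Suc y) = w ! b" using x y by simp_all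
  then have ex: "\<exists>c\<in>set ?xs. \<not> c < 4" "\<exists>c\<in>set ?ys. \<not> c < 4"
    using x y by (metis diff_less_mono length_drop nth_mem Suc_leI)+
  have sx: "sym_at w (Suc x + i) = ?xs ! i" "Suc x + i < ?n" if "i < length ?xs" for i
    using that by (auto simp: sym_at_def)
  have sy: "sym_at w (Suc y + i) = ?ys ! i" "Suc y + i < ?n" if "i < length ?ys" for i
    using that by (auto simp: sym_at_def)
  \<comment> \<open>The number of positions strictly in between is the offset, so equal counts mean
    equal offsets.\<close>
  have c: "card {t. t < ?n \<and> (v < t \<and> t < z)} = z - Suc v" if "z < ?n" for v z
  proof -
    have "{t. t < ?n \<and> (v < t \<and> t < z)} = {v<..<z}" using that by auto
    then show ?thesis by simp
  qed
  show ?thesis unfolding numstr_def takeWhile_eq_iff[OF ex]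
  proof (intro iffI allI impI)
    fix i assume s: "same_num w x y" and i: "i < length ?xs" "i < length ?ys"
      and k: "\<forall>k<i. ?xs ! k < 4" "\<forall>k<i. ?ys ! k < 4" and l: "?xs ! i < 4 \<or> ?ys ! i < 4"
    have "sym_at w (Suc x + i) = sym_at w (Suc y + i)"
    proof (rule s[unfolded same_num_def, rule_format])
      show "Suc x + i < ?n" "Suc y + i < ?n" using sx(2)[OF i(1)] sy(2)[OF i(2)] .
      then show "card {t. t < ?n \<and> (x < t \<and> t < Suc x + i)} = card {t. t < ?n \<and> (y < t \<and> t < Suc y + i)}"
        by (simp only: c)
      show "sym_at w t < 4" if t: "x < t" "t < Suc x + i" for t
      proof -
        have e: "t = Suc x + (t - Suc x)" "t - Suc x < i" using t by auto
        then have "sym_at w t = ?xs ! (t - Suc x)" using sx(1)[of "t - Suc x"] i(1) by simp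
        then show ?thesis using k(1) e(2) by metis
      qed
      show "sym_at w t < 4" if t: "y < t" "t < Suc y + i" for t
      proof -
        have e: "t = Suc y + (t - Suc y)" "t - Suc y < i" using t by auto
        then have "sym_at w t = ?ys ! (t - Suc y)" using sy(1)[of "t - Suc y"] i(2) by simp
        then show ?thesis using k(2) e(2) by metis
      qed
      show "sym_at w (Suc x + i) < 4 \<or> sym_at w (Suc y + i) < 4"
        using l unfolding sx(1)[OF i(1)] sy(1)[OF i(2)] .
    qed simp_all
    then show "?xs ! i = ?ys ! i" using sx(1)[OF i(1)] sy(1)[OF i(2)] by simp
  next
    assume R: "\<forall>i. i < length ?xs \<longrightarrow> i < length ?ys \<longrightarrow> (\<forall>k<i. ?xs ! k < 4) \<longrightarrow> (\<forall>k<i. ?ys ! k < 4) \<longrightarrow>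
      ?xs ! i < 4 \<or> ?ys ! i < 4 \<longrightarrow> ?xs ! i = ?ys ! i"
    show "same_num w x y" unfolding same_num_def
    proof (intro allI impI)
      fix z u assume z: "z < ?n" "u < ?n" "x < z" "y < u"
        and e: "card {t. t < ?n \<and> (x < t \<and> t < z)} = card {t. t < ?n \<and> (y < t \<and> t < u)}"
        and k: "\<forall>t<?n. x < t \<longrightarrow> t < z \<longrightarrow> sym_at w t < 4" "\<forall>t<?n. y < t \<longrightarrow> t < u \<longrightarrow> sym_at w t < 4"
        and l: "sym_at w z < 4 \<or> sym_at w u < 4"
      define i where "i = z - Suc x"
      have i: "z = Suc x + i" "u = Suc y + i" using e z c by (auto simp: i_def)
      have il: "i < length ?xs" "i < length ?ys" using i z by auto
      have a: "?xs ! m < 4" if "m < i" for m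
      proof -
        have m: "m < length ?xs" using il that by simp
        have "sym_at w (Suc x + m) < 4" using k(1)[rule_format, OF sx(2)[OF m]] that i(1) by simp
        then show ?thesis unfolding sx(1)[OF m] .
      qed
      have b: "?ys ! m < 4" if "m < i" for m
      proof -
        have m: "m < length ?ys" using il that by simp
        have "sym_at w (Suc y + m) < 4" using k(2)[rule_format, OF sy(2)[OF m]] that i(2) by simp
        then show ?thesis unfolding sy(1)[OF m] .
      qed
      have "?xs ! i < 4 \<or> ?ys ! i < 4" using l unfolding i sx(1)[OF il(1)] sy(1)[OF il(2)] .
      then have "?xs ! i = ?ys ! i" using R[rule_format, OF il a b] by blast
      then show "sym_at w z = sym_at w u" unfolding i sx(1)[OF il(1)] sy(1)[OF il(2)] .
    qed
  qed
qed

text \<open>All that is needed of an item, independent of the blocks around it. The separator behind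
  it also stops every run of digits that starts in the item.\<close>

definition located :: "nat list \<Rightarrow> nat \<Rightarrow> nat list \<Rightarrow> bool" where
  "located w p s \<longleftrightarrow> (\<exists>A B. w = A @ s @ 5 # B \<and> length A = Suc p) \<and>
     (\<forall>x<length w. in_item w p x \<longleftrightarrow> p < x \<and> x \<le> p + length s)"

definition sel :: "(nat \<Rightarrow> bool) \<Rightarrow> nat list \<Rightarrow> nat \<Rightarrow> nat list \<Rightarrow> nat list" where
  "sel P w p s = filter (\<lambda>x. P (sym_at w x)) [Suc p..<Suc p + length s]"

lemma located_end:
  assumes "located w p s"
  shows "Suc p + length s < length w" "w ! (Suc p + length s) = 5"
proof -
  obtain A B where "w = A @ s @ 5 # B" "length A = Suc p" using assms unfolding located_def by blast
  then show "Suc p + length s < length w" "w ! (Suc p + length s) = 5" by (simp_all add: nth_append)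
qed

lemma set_sel: "located w p s \<Longrightarrow> set (sel P w p s) = {x. x < length w \<and> in_item w p x \<and> P (sym_at w x)}"
proof -
  assume l: "located w p s"
  have "in_item w p x \<longleftrightarrow> p < x \<and> x \<le> p + length s" if "x < length w" for x
    using l that unfolding located_def by blast
  then show ?thesis using located_end(1)[OF l] by (auto simp: sel_def)
qed

lemma sorted_sel: "sorted_wrt (<) (sel P w p s)"
  unfolding sel_def by (intro sorted_wrt_filter sorted_wrt_upt)

lemma card_below_nth:
  fixes X :: "nat list"
  assumes "sorted_wrt (<) X" "k < length X"
  shows "card {z \<in> set X. z < X ! k} = k"
proof -
  have lt: "X ! i < X ! j" if "i < j" "j < length X" for i j
    using sorted_wrt_nth_less[OF assms(1) that] .
  have "{z \<in> set X. z < X ! k} = (!) X ` {..<k}"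
  proof (intro equalityI subsetI)
    fix z assume "z \<in> {z \<in> set X. z < X ! k}"
    then obtain i where i: "i < length X" "z = X ! i" "X ! i < X ! k" by (auto simp: in_set_conv_nth)
    then have "i < k" using lt[of k i] by (metis less_asym linorder_neqE_nat)
    then show "z \<in> (!) X ` {..<k}" using i by auto
  qed (use lt assms(2) in auto)
  moreover have "inj_on ((!) X) {..<k}"
  proof (rule inj_onI)
    fix i j assume "i \<in> {..<k}" "j \<in> {..<k}" "X ! i = X ! j"
    then show "i = j" using lt[of i j] lt[of j i] assms(2) by (cases i j rule: linorder_cases) auto
  qed
  ultimately show ?thesis by (simp add: card_image)
qed

text \<open>In a strictly increasing enumeration the rank of an element is its index, so
  corresponding positions are the entries with equal index.\<close>

lemma corr_iff:
  assumes p: "located w p s" and q: "located w q t" and xy: "x < length w" "y < length w"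
  shows "corr P w p x q y \<longleftrightarrow>
    (\<exists>k. k < length (sel P w p s) \<and> k < length (sel P w q t) \<and> x = sel P w p s ! k \<and> y = sel P w q t ! k)"
proof -
  let ?X = "sel P w p s" and ?Y = "sel P w q t"
  have "corr P w p x q y \<longleftrightarrow> x \<in> set ?X \<and> y \<in> set ?Y \<and> card {z \<in> set ?X. z < x} = card {z \<in> set ?Y. z < y}"
    using xy unfolding corr_def set_sel[OF p] set_sel[OF q] by (simp add: conj_ac)
  also have "\<dots> \<longleftrightarrow> (\<exists>k. k < length ?X \<and> k < length ?Y \<and> x = ?X ! k \<and> y = ?Y ! k)"
  proof
    assume *: "x \<in> set ?X \<and> y \<in> set ?Y \<and> card {z \<in> set ?X. z < x} = card {z \<in> set ?Y. z < y}"
    then obtain k l where k: "k < length ?X" "x = ?X ! k" and l: "l < length ?Y" "y = ?Y ! l"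
      by (auto simp: in_set_conv_nth)
    then have "k = l" using * card_below_nth[OF sorted_sel k(1)] card_below_nth[OF sorted_sel l(1)] by simp
    then show "\<exists>k. k < length ?X \<and> k < length ?Y \<and> x = ?X ! k \<and> y = ?Y ! k" using k l by blast
  next
    assume "\<exists>k. k < length ?X \<and> k < length ?Y \<and> x = ?X ! k \<and> y = ?Y ! k"
    then obtain k where k: "k < length ?X" "k < length ?Y" "x = ?X ! k" "y = ?Y ! k" by blast
    then show "x \<in> set ?X \<and> y \<in> set ?Y \<and> card {z \<in> set ?X. z < x} = card {z \<in> set ?Y. z < y}"
      using card_below_nth[OF sorted_sel k(1)] card_below_nth[OF sorted_sel k(2)] by simp
  qed
  finally show ?thesis .
qed

lemma all_corr_iff:
  assumes p: "located w p s" and q: "located w q t"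
  shows "(\<forall>x<length w. \<forall>y<length w. corr P w p x q y \<longrightarrow> Q x y) \<longleftrightarrow>
    (\<forall>k. k < length (sel P w p s) \<longrightarrow> k < length (sel P w q t) \<longrightarrow> Q (sel P w p s ! k) (sel P w q t ! k))"
proof (intro iffI allI impI)
  fix k assume *: "\<forall>x<length w. \<forall>y<length w. corr P w p x q y \<longrightarrow> Q x y"
    and k: "k < length (sel P w p s)" "k < length (sel P w q t)"
  have n: "sel P w p s ! k < length w" "sel P w q t ! k < length w"
    using nth_mem[OF k(1)] nth_mem[OF k(2)] unfolding set_sel[OF p] set_sel[OF q] by blast+
  have "corr P w p (sel P w p s ! k) q (sel P w q t ! k)" unfolding corr_iff[OF p q n] using k by blast
  then show "Q (sel P w p s ! k) (sel P w q t ! k)" using * n by blast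
next
  fix x y assume *: "\<forall>k. k < length (sel P w p s) \<longrightarrow> k < length (sel P w q t) \<longrightarrow>
      Q (sel P w p s ! k) (sel P w q t ! k)"
    and n: "x < length w" "y < length w" and "corr P w p x q y"
  then obtain k where "k < length (sel P w p s)" "k < length (sel P w q t)" "x = sel P w p s ! k" "y = sel P w q t ! k"
    unfolding corr_iff[OF p q n] by blast
  then show "Q x y" using * by blast
qed

lemma map_sel:
  assumes "w = A @ s @ v" "length A = Suc p"
  shows "map (sym_at w) (sel P w p s) = filter P s"
    and "map (\<lambda>x. (sym_at w x, numstr w x)) (sel tag w p s) = occs s v"
proof -
  have sy: "map (sym_at (A @ s @ v)) (filter (\<lambda>x. P (sym_at (A @ s @ v) x)) [length A..<length A + length s]) = filter P s"
    for A :: "nat list"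
  proof (induction s arbitrary: A)
    case (Cons a s)
    have "sym_at (A @ (a # s) @ v) (length A) = a" by (simp add: sym_at_def)
    then show ?case using Cons.IH[of "A @ [a]"] by (simp add: upt_conv_Cons del: upt_Suc)
  qed simp
  show "map (sym_at w) (sel P w p s) = filter P s"
    unfolding sel_def assms(1) assms(2)[symmetric] by (rule sy)
  have oc: "map (\<lambda>x. (sym_at (A @ s @ v) x, numstr (A @ s @ v) x))
      (filter (\<lambda>x. tag (sym_at (A @ s @ v) x)) [length A..<length A + length s]) = occs s v" for A :: "nat list"
  proof (induction s arbitrary: A)
    case (Cons a s)
    have "sym_at (A @ (a # s) @ v) (length A) = a" by (simp add: sym_at_def)
    moreover have "numstr (A @ (a # s) @ v) (length A) = takeWhile (\<lambda>a. a < 4) (s @ v)" by (simp add: numstr_def)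
    ultimately show ?case using Cons.IH[of "A @ [a]"] by (simp add: upt_conv_Cons del: upt_Suc)
  qed simp
  show "map (\<lambda>x. (sym_at w x, numstr w x)) (sel tag w p s) = occs s v"
    unfolding sel_def assms(1) assms(2)[symmetric] by (rule oc)
qed

definition enc_rule :: "trm \<times> trm \<Rightarrow> nat list" where
  "enc_rule = (\<lambda>(l, r). enc_trm l @ enc_trm r)"

text \<open>The structural symbols spell the encodings of the shapes, which are uniquely readable;
  the tags with the numerals behind them spell the occurrence lists. If the shapes differ, both
  sides fail; if they agree, both lists have the same length and are compared index by
  index.\<close>

lemma item_match_iff:
  assumes p: "located w p (enc_rule \<rho>)" and q: "located w q (enc_rule \<rho>')"
  shows "item_match idF idV w p q \<longleftrightarrow> rule_match idF idV \<rho> \<rho>'"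
proof -
  let ?n = "length w"
  let ?s = "enc_rule \<rho>" and ?t = "enc_rule \<rho>'"
  define N where "N = sel structural w p ?s"
  define N' where "N' = sel structural w q ?t"
  define X where "X = sel tag w p ?s"
  define X' where "X' = sel tag w q ?t"
  obtain A B where A: "w = A @ ?s @ 5 # B" "length A = Suc p" using p unfolding located_def by blast
  obtain A' B' where A': "w = A' @ ?t @ 5 # B'" "length A' = Suc q" using q unfolding located_def by blast
  have mN: "map (sym_at w) N = filter structural ?s" "map (sym_at w) N' = filter structural ?t"
    unfolding N_def N'_def by (rule map_sel(1)[OF A] map_sel(1)[OF A'])+
  have "occs (enc_rule \<sigma>) v = map (\<lambda>(a, x). (a, 3 # bin x)) (occ_rule \<sigma>)" for \<sigma> v
    by (simp add: enc_rule_def occ_rule_def occs_append occs_enc_trm split: prod.split)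
  then have mX: "map (\<lambda>x. (sym_at w x, numstr w x)) X = map (\<lambda>(a, x). (a, 3 # bin x)) (occ_rule \<rho>)"
    "map (\<lambda>x. (sym_at w x, numstr w x)) X' = map (\<lambda>(a, x). (a, 3 # bin x)) (occ_rule \<rho>')"
    unfolding X_def X'_def using map_sel(2)[OF A] map_sel(2)[OF A'] by simp_all
  have lenX: "length X = length (occ_rule \<rho>)" "length X' = length (occ_rule \<rho>')"
    using mX[THEN map_eq_imp_length_eq] by simp_all
  have X: "sym_at w (X ! k) = fst (occ_rule \<rho> ! k)" "numstr w (X ! k) = 3 # bin (snd (occ_rule \<rho> ! k))"
    if "k < length X" for k
    using arg_cong[OF mX(1), of "\<lambda>l. l ! k"] that lenX by (simp_all add: case_prod_beta)
  have X': "sym_at w (X' ! k) = fst (occ_rule \<rho>' ! k)" "numstr w (X' ! k) = 3 # bin (snd (occ_rule \<rho>' ! k))"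
    if "k < length X'" for k
    using arg_cong[OF mX(2), of "\<lambda>l. l ! k"] that lenX by (simp_all add: case_prod_beta)
  have bX: "x < Suc p + length ?s" if "x \<in> set N \<union> set X" for x
    using that by (auto simp: N_def X_def sel_def)
  have bX': "x < Suc q + length ?t" if "x \<in> set N' \<union> set X'" for x
    using that by (auto simp: N'_def X'_def sel_def)
  have num: "same_num w x y \<longleftrightarrow> numstr w x = numstr w y" if "x \<in> set X \<union> set X'" "y \<in> set X \<union> set X'" for x y
  proof -
    \<comment> \<open>The separator behind the item serves as the symbol that ends every
      run.\<close>
    have "\<exists>a. z < a \<and> a < ?n \<and> \<not> w ! a < 4" if "z \<in> set X \<union> set X'" for z
    proof (cases "z \<in> set X")
      case True
      then show ?thesis using bX[of z] located_end[OF p] by (intro exI[of _ "Suc p + length ?s"]) simp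
    next
      case False
      then show ?thesis using bX'[of z] located_end[OF q] that by (intro exI[of _ "Suc q + length ?t"]) simp
    qed
    from this[OF that(1)] this[OF that(2)] show ?thesis by (elim exE conjE) (rule same_num_iff)
  qed
  have corrN: "(\<forall>x<?n. \<forall>y<?n. corr structural w p x q y \<longrightarrow> Q x y) \<longleftrightarrow>
    (\<forall>k. k < length N \<longrightarrow> k < length N' \<longrightarrow> Q (N ! k) (N' ! k))" for Q
    unfolding N_def N'_def by (rule all_corr_iff[OF p q])
  have corrX: "(\<forall>x<?n. \<forall>y<?n. corr tag w p x q y \<longrightarrow> Q x y) \<longleftrightarrow>
    (\<forall>k. k < length X \<longrightarrow> k < length X' \<longrightarrow> Q (X ! k) (X' ! k))" for Q
    unfolding X_def X'_def by (rule all_corr_iff[OF p q])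
  have cardN: "card {x. x < ?n \<and> (in_item w p x \<and> structural (sym_at w x))} = length N"
    "card {x. x < ?n \<and> (in_item w q x \<and> structural (sym_at w x))} = length N'"
    using set_sel[OF p, of structural] set_sel[OF q, of structural]
      distinct_card[of N] distinct_card[of N'] unfolding N_def N'_def by (simp_all add: sel_def)
  let ?shapes = "shape (fst \<rho>) = shape (fst \<rho>') \<and> shape (snd \<rho>) = shape (snd \<rho>')"
  have "length N = length N' \<and> (\<forall>k. k < length N \<longrightarrow> k < length N' \<longrightarrow> sym_at w (N ! k) = sym_at w (N' ! k)) \<longleftrightarrow>
    map (sym_at w) N = map (sym_at w) N'"
    by (auto simp: list_eq_iff_nth_eq)
  also have "\<dots> \<longleftrightarrow> ?shapes"
    unfolding mN enc_rule_def case_prod_beta by (rule enc_rule_shape)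
  finally have sh: "length N = length N' \<and>
    (\<forall>k. k < length N \<longrightarrow> k < length N' \<longrightarrow> sym_at w (N ! k) = sym_at w (N' ! k)) \<longleftrightarrow> ?shapes" .
  show ?thesis
  proof (cases ?shapes)
    case True
    then have mf: "map fst (occ_rule \<rho>) = map fst (occ_rule \<rho>')"
      using shape_occ[of "fst \<rho>" "fst \<rho>'"] shape_occ[of "snd \<rho>" "snd \<rho>'"] by (simp add: occ_rule_def)
    then have len: "length X = length (occ_rule \<rho>)" "length X' = length (occ_rule \<rho>)"
      using lenX map_eq_imp_length_eq[OF mf] by simp_all
    have e: "same_num w (X ! i) (X ! j) \<longleftrightarrow> snd (occ_rule \<rho> ! i) = snd (occ_rule \<rho> ! j)"
      "same_num w (X' ! i) (X' ! j) \<longleftrightarrow> snd (occ_rule \<rho>' ! i) = snd (occ_rule \<rho>' ! j)"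
      "same_num w (X ! i) (X' ! j) \<longleftrightarrow> snd (occ_rule \<rho> ! i) = snd (occ_rule \<rho>' ! j)"
      if "i < length (occ_rule \<rho>)" "j < length (occ_rule \<rho>)" for i j
    proof -
      have i: "i < length X" "i < length X'" "j < length X" "j < length X'" using that len by simp_all
      show "same_num w (X ! i) (X ! j) \<longleftrightarrow> snd (occ_rule \<rho> ! i) = snd (occ_rule \<rho> ! j)"
        "same_num w (X' ! i) (X' ! j) \<longleftrightarrow> snd (occ_rule \<rho>' ! i) = snd (occ_rule \<rho>' ! j)"
        "same_num w (X ! i) (X' ! j) \<longleftrightarrow> snd (occ_rule \<rho> ! i) = snd (occ_rule \<rho>' ! j)"
        using num[of "X ! i" "X ! j"] num[of "X' ! i" "X' ! j"] num[of "X ! i" "X' ! j"]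
        by (simp_all add: i X X' bin_eq_iff)
    qed
    have "item_match idF idV w p q \<longleftrightarrow> consistent idF idV (occ_rule \<rho>) (occ_rule \<rho>')"
      unfolding item_match_def corrN corrX cardN consistent_def
      using sh True mf e X(1) len by simp
    then show ?thesis using True by (simp add: rule_match_def)
  next
    case False
    then show ?thesis using sh unfolding item_match_def corrN cardN rule_match_def by blast
  qed
qed

lemma numstr_located:
  assumes "located w p (enc_nat v @ s)"
  shows "numstr w p = 3 # bin v"
proof -
  obtain A B where "w = A @ (enc_nat v @ s) @ 5 # B" "length A = Suc p" using assms unfolding located_def by blast
  then have "drop (Suc p) w = 3 # bin v @ 4 # s @ 5 # B" by (simp add: enc_nat_def)
  then show ?thesis unfolding numstr_def by (simp only: takeWhile_bin)
qed

lemma same_num_located: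
  assumes "located w p (enc_nat v @ s)" "located w q (enc_nat u @ t)"
  shows "same_num w p q \<longleftrightarrow> v = u"
proof -
  have "same_num w p q \<longleftrightarrow> numstr w p = numstr w q"
    using located_end[OF assms(1)] located_end[OF assms(2)]
    by (intro same_num_iff[of _ "Suc p + length (enc_nat v @ s)" _ _ "Suc q + length (enc_nat u @ t)"]) simp_all
  then show ?thesis using numstr_located[OF assms(1)] numstr_located[OF assms(2)] bin_eq_iff by simp
qed

text \<open>The opening bracket of the first numeral is at \<open>Suc p\<close>, followed by the
  digits of \<open>f\<close>; the next cell is its closing bracket, and the arity starts right
  behind that.\<close>

lemma end_num_located:
  assumes l: "located w p (enc_nat f @ enc_nat a)" and y: "y < length w"
  shows "end_num w p y \<longleftrightarrow> y = Suc (Suc p) + length (bin f)"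
    and "numstr w (Suc (Suc p) + length (bin f)) = 3 # bin a"
proof -
  let ?y = "Suc (Suc p) + length (bin f)"
  obtain A B where w: "w = A @ (enc_nat f @ enc_nat a) @ 5 # B" and A: "length A = Suc p"
    using l unfolding located_def by blast
  have w': "w = (A @ 3 # bin f) @ 4 # 3 # bin a @ 4 # 5 # B" using w by (simp add: enc_nat_def)
  have lA: "length (A @ 3 # bin f) = ?y" using A by simp
  have y4: "sym_at w ?y = 4" unfolding w' sym_at_def lA[symmetric] nth_append_length by simp
  have yn: "?y < length w" unfolding w' using lA by simp
  have n4: "sym_at w t \<noteq> 4" if "p < t" "t < ?y" for t
  proof -
    have t: "t = Suc p + (t - Suc p)" "t - Suc p < length (3 # bin f)" using that by auto
    have "w ! t = (3 # bin f) ! (t - Suc p)"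
    proof -
      have "w ! t = ((3 # bin f) @ 4 # 3 # bin a @ 4 # 5 # B) ! (t - Suc p)"
        unfolding w' append_assoc using that A by (simp add: nth_append)
      then show ?thesis using t(2) by (simp only: nth_append if_True)
    qed
    moreover have "(3 # bin f) ! (t - Suc p) \<in> set (3 # bin f)" using t(2) by (rule nth_mem)
    ultimately show ?thesis using set_bin[of f] by (auto simp: sym_at_def)
  qed
  show "end_num w p y \<longleftrightarrow> y = ?y"
  proof
    assume e: "end_num w p y"
    then have "\<not> ?y < y" using y4 yn unfolding end_num_def by auto
    moreover have "\<not> y < ?y" using e n4[of y] unfolding end_num_def by auto
    ultimately show "y = ?y" by simp
  next
    assume "y = ?y"
    then show "end_num w p y" using y4 n4 unfolding end_num_def by auto
  qed
  have "drop (Suc ?y) w = 3 # bin a @ 4 # 5 # B" unfolding w' using lA by simp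
  then show "numstr w ?y = 3 # bin a" unfolding numstr_def by (simp only: takeWhile_bin)
qed

lemma same_arity_located:
  assumes p: "located w p (enc_nat f @ enc_nat a)" and q: "located w q (enc_nat g @ enc_nat b)"
  shows "same_arity w p q \<longleftrightarrow> a = b"
proof -
  let ?y = "Suc (Suc p) + length (bin f)" and ?u = "Suc (Suc q) + length (bin g)"
  have y: "?y < Suc p + length (enc_nat f @ enc_nat a)" "?u < Suc q + length (enc_nat g @ enc_nat b)"
    by (simp_all add: enc_nat_def)
  then have yn: "?y < length w" "?u < length w"
    using located_end(1)[OF p] located_end(1)[OF q] by linarith+
  have "same_arity w p q \<longleftrightarrow> same_num w ?y ?u"
  proof
    assume "same_arity w p q"
    then show "same_num w ?y ?u" unfolding same_arity_def
      using yn end_num_located(1)[OF p yn(1)] end_num_located(1)[OF q yn(2)] by blast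
  next
    assume *: "same_num w ?y ?u"
    show "same_arity w p q" unfolding same_arity_def
    proof (intro allI impI)
      fix y u assume "y < length w" "u < length w" "end_num w p y" "end_num w q u"
      then show "same_num w y u" using * end_num_located(1)[OF p, of y] end_num_located(1)[OF q, of u] by simp
    qed
  qed
  also have "\<dots> \<longleftrightarrow> numstr w ?y = numstr w ?u"
    using y located_end[OF p] located_end[OF q]
    by (intro same_num_iff[of _ "Suc p + length (enc_nat f @ enc_nat a)" _ _ "Suc q + length (enc_nat g @ enc_nat b)"]) simp_all
  also have "\<dots> \<longleftrightarrow> a = b"
    using end_num_located(2)[OF p yn(1)] end_num_located(2)[OF q yn(2)] bin_eq_iff by simp
  finally show ?thesis .
qed

section \<open>Quantifying and counting over the items of a block\<close>

context blocks begin

lemma located_W: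
  assumes "j < length SS" "i < length (SS ! j)"
  shows "located W (pos j i) (SS ! j ! i)"
  unfolding located_def using item_split[OF assms] in_item_W[OF assms] by blast

lemma set_marks:
  assumes "j < length SS"
  shows "{p. p < length W \<and> mark j W p} = pos j ` {..<length (SS ! j)}"
proof (intro equalityI subsetI)
  fix p assume "p \<in> {p. p < length W \<and> mark j W p}"
  then show "p \<in> pos j ` {..<length (SS ! j)}" using mark_W[OF assms, of p] by auto
next
  fix p assume "p \<in> pos j ` {..<length (SS ! j)}"
  then obtain i where i: "i < length (SS ! j)" "p = pos j i" by blast
  then have "p < length W" using pos_less_W[OF assms, of i] by simp
  then show "p \<in> {p. p < length W \<and> mark j W p}" using mark_W[OF assms, of p] i by blast
qed

lemma all_marks:
  assumes "j < length SS"
  shows "(\<forall>p<length W. mark j W p \<longrightarrow> Q p) \<longleftrightarrow> (\<forall>i<length (SS ! j). Q (pos j i))"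
proof -
  have "(\<forall>p<length W. mark j W p \<longrightarrow> Q p) \<longleftrightarrow> (\<forall>p\<in>{p. p < length W \<and> mark j W p}. Q p)" by blast
  then show ?thesis unfolding set_marks[OF assms] by auto
qed

lemma ex_marks:
  assumes "j < length SS"
  shows "(\<exists>p<length W. mark j W p \<and> Q p) \<longleftrightarrow> (\<exists>i<length (SS ! j). Q (pos j i))"
  using all_marks[OF assms, of "\<lambda>p. \<not> Q p"] by blast

lemma card_marks:
  assumes "j < length SS"
  shows "card {p. p < length W \<and> (mark j W p \<and> Q p)} = card {i. i < length (SS ! j) \<and> Q (pos j i)}"
proof -
  have "{p. p < length W \<and> (mark j W p \<and> Q p)} = {p \<in> {p. p < length W \<and> mark j W p}. Q p}" by blast
  also have "\<dots> = pos j ` {i. i < length (SS ! j) \<and> Q (pos j i)}"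
    unfolding set_marks[OF assms] by blast
  finally have "{p. p < length W \<and> (mark j W p \<and> Q p)} = pos j ` {i. i < length (SS ! j) \<and> Q (pos j i)}" .
  moreover have "inj_on (pos j) {i. i < length (SS ! j) \<and> Q (pos j i)}"
  proof (rule inj_onI)
    fix i k assume "i \<in> {i. i < length (SS ! j) \<and> Q (pos j i)}" "k \<in> {i. i < length (SS ! j) \<and> Q (pos j i)}"
      "pos j i = pos j k"
    then show "i = k" using pos_less[of i k j] pos_less[of k i j] by (cases i k rule: linorder_cases) auto
  qed
  ultimately show ?thesis by (simp add: card_image)
qed

end

section \<open>The encoded pair of systems as six blocks\<close>

definition enc_sig :: "nat \<times> nat \<Rightarrow> nat list" where
  "enc_sig = (\<lambda>(f, a). enc_nat f @ enc_nat a)"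

definition rep_blocks :: "trs_rep \<Rightarrow> nat list list list" where
  "rep_blocks x = (case x of (Fs, Vs, Rs) \<Rightarrow> [map enc_sig Fs, map enc_nat Vs, map enc_rule Rs])"

lemma enc_list_blk: "enc_list e xs = blk (map e xs)"
  by (simp add: enc_list_def blk_def body_def o_def)

lemma enc_pair_blocks: "enc_pair (x, y) = concat (map blk (rep_blocks x @ rep_blocks y))"
  by (simp add: enc_list_blk enc_pair_def enc_rep_def rep_blocks_def enc_sig_def enc_rule_def split: prod.split)

lemma rep_blocks_item:
  assumes "S \<in> set (rep_blocks x)" "s \<in> set S"
  obtains f a where "s = enc_nat f @ enc_nat a" | v where "s = enc_nat v" | l r where "s = enc_trm l @ enc_trm r"
proof -
  obtain Fs Vs Rs where x: "x = (Fs, Vs, Rs)" by (cases x)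
  from assms consider "s \<in> enc_sig ` set Fs" | "s \<in> enc_nat ` set Vs" | "s \<in> enc_rule ` set Rs"
    by (auto simp: x rep_blocks_def)
  then show thesis
    using that unfolding enc_sig_def enc_rule_def case_prod_beta by cases blast+
qed

lemma balanced_bin: "balanced d (bin n @ v) = balanced d v"
proof -
  have "set s \<subseteq> {1, 2} \<Longrightarrow> balanced d (s @ v) = balanced d v" for s by (induction s) auto
  then show ?thesis using set_bin by blast
qed

lemma balanced_enc_nat: "balanced d (enc_nat n @ v) = balanced d v"
  by (simp add: enc_nat_def balanced_bin)

lemma balanced_enc_trm: "balanced d (enc_trm t @ v) = balanced d v"
proof (induction t arbitrary: d v)
  case (Var x)
  then show ?case by (simp add: balanced_enc_nat)
next
  case (Fun f ts)
  have "balanced (Suc d) (concat (map (\<lambda>t. enc_trm t @ [5]) ts) @ v) = balanced (Suc d) v" for v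
    using Fun.IH by (induction ts) simp_all
  then show ?case by (simp add: balanced_enc_nat)
qed

lemma balanced_rep_blocks:
  assumes "S \<in> set (rep_blocks x)" "s \<in> set S"
  shows "balanced 0 s"
  using assms
proof (cases rule: rep_blocks_item)
  case (2 v)
  then show ?thesis using balanced_enc_nat[of 0 v "[]"] by simp
next
  case (1 f a)
  then show ?thesis using balanced_enc_nat[of 0 a "[]"] by (simp add: balanced_enc_nat)
next
  case (3 l r)
  then show ?thesis using balanced_enc_trm[of 0 r "[]"] by (simp add: balanced_enc_trm)
qed

lemma set_enc_nat: "set (enc_nat n) \<subseteq> {1..7}"
  using set_bin[of n] by (force simp: enc_nat_def)

lemma set_enc_trm: "set (enc_trm t) \<subseteq> {1..7}"
proof (induction t)
  case (Var x)
  then show ?case using set_enc_nat[of x] by simp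
next
  case (Fun f ts)
  then have "set (concat (map (\<lambda>t. enc_trm t @ [5]) ts)) \<subseteq> {1..7}" by (induction ts) simp_all
  then show ?case using set_enc_nat[of f] by simp
qed

lemma set_enc_pair: "set (enc_pair p) \<subseteq> {1..7}"
proof -
  have item: "set s \<subseteq> {1..7}" if "S \<in> set (rep_blocks x)" "s \<in> set S" for s S x
    using that
  proof (cases rule: rep_blocks_item)
    case (1 f a)
    then show ?thesis using set_enc_nat[of f] set_enc_nat[of a] by simp
  next
    case (2 v)
    then show ?thesis using set_enc_nat[of v] by simp
  next
    case (3 l r)
    then show ?thesis using set_enc_trm[of l] set_enc_trm[of r] by simp
  qed
  have body: "set (blk S) \<subseteq> {1..7}" if "\<forall>s\<in>set S. set s \<subseteq> {1..7}" for S
  proof -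
    have "set (body S) \<subseteq> {1..7}" using that by (induction S) simp_all
    then show ?thesis by (simp add: blk_def)
  qed
  have "set (concat (map blk SS)) \<subseteq> {1..7}" if "\<forall>S\<in>set SS. \<forall>s\<in>set S. set s \<subseteq> {1..7}" for SS
    using that body by (induction SS) simp_all
  from this[of "rep_blocks (fst p) @ rep_blocks (snd p)"] show ?thesis
    using item enc_pair_blocks[of "fst p" "snd p"] by (metis Un_iff prod.collapse set_append)
qed

lemma nth_subsets:
  "(\<forall>i<length xs. \<exists>k<length ys. xs ! i = ys ! k) \<and> (\<forall>k<length ys. \<exists>i<length xs. xs ! i = ys ! k)
    \<longleftrightarrow> set xs = set ys"
proof -
  have mem: "x \<in> set zs \<longleftrightarrow> (\<exists>k<length zs. x = zs ! k)" for x :: 'a and zs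
    by (auto simp: in_set_conv_nth)
  have "(\<forall>i<length xs. \<exists>k<length ys. xs ! i = ys ! k) \<longleftrightarrow> set xs \<subseteq> set ys"
    unfolding mem[symmetric] by (auto simp: subset_code(1) all_set_conv_all_nth)
  moreover have "(\<forall>k<length ys. \<exists>i<length xs. xs ! i = ys ! k) \<longleftrightarrow> set ys \<subseteq> set xs"
    unfolding eq_commute[of "xs ! _"] mem[symmetric] by (auto simp: subset_code(1) all_set_conv_all_nth)
  ultimately show ?thesis by auto
qed

text \<open>Each element of the list is represented by its least index.\<close>

lemma card_first_occurrences:
  "card {i. i < length xs \<and> (\<forall>k<length xs. k < i \<longrightarrow> xs ! k \<noteq> xs ! i)} = card (set xs)"
proof -
  let ?S = "{i. i < length xs \<and> (\<forall>k<length xs. k < i \<longrightarrow> xs ! k \<noteq> xs ! i)}"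
  have "inj_on ((!) xs) ?S"
  proof (rule inj_onI)
    fix i k assume ik: "i \<in> ?S" "k \<in> ?S" "xs ! i = xs ! k"
    have "\<not> k < i"
    proof
      assume "k < i"
      then have "xs ! k \<noteq> xs ! i" using ik(1) by simp
      then show False using ik(3) by simp
    qed
    moreover have "\<not> i < k"
    proof
      assume "i < k"
      then have "xs ! i \<noteq> xs ! k" using ik(2) by simp
      then show False using ik(3) by simp
    qed
    ultimately have "\<not> k < i \<and> \<not> i < k" by simp
    then show "i = k" by simp
  qed
  moreover have "(!) xs ` ?S = set xs"
  proof (intro equalityI subsetI)
    fix x assume "x \<in> set xs"
    then have ex: "\<exists>i. i < length xs \<and> xs ! i = x" by (auto simp: in_set_conv_nth)
    define i where "i = (LEAST i. i < length xs \<and> xs ! i = x)"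
    have i: "i < length xs \<and> xs ! i = x" unfolding i_def by (rule LeastI_ex[OF ex])
    have "xs ! k \<noteq> xs ! i" if "k < length xs" "k < i" for k
    proof
      assume "xs ! k = xs ! i"
      then have "k < length xs \<and> xs ! k = x" using i that by simp
      then have "i \<le> k" unfolding i_def by (rule Least_le)
      then show False using that by simp
    qed
    then have "i \<in> ?S" using i by simp
    moreover have "x = xs ! i" using i by simp
    ultimately show "x \<in> (!) xs ` ?S" by (rule rev_image_eqI)
  next
    fix x assume "x \<in> (!) xs ` ?S"
    then obtain i where "i \<in> ?S" "x = xs ! i" by (rule imageE)
    then show "x \<in> set xs" by simp
  qed
  ultimately show ?thesis using card_image[of "(!) xs" ?S] by simp
qed

text \<open>Stated for arbitrary lists, so function symbols are still counted as list entries; for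
  valid representations \<open>card_arity\<close> turns this into counting symbols.\<close>

lemma word_iso_enc_pair:
  "word_iso idF idV (enc_pair ((F1, V1, R1), (F2, V2, R2))) \<longleftrightarrow>
    (\<forall>\<rho>\<in>set R1. \<forall>\<rho>'\<in>set R1. rule_match idF idV \<rho> \<rho>' \<longrightarrow> \<rho> = \<rho>') \<and>
    (\<forall>\<rho>\<in>set R2. \<forall>\<rho>'\<in>set R2. rule_match idF idV \<rho> \<rho>' \<longrightarrow> \<rho> = \<rho>') \<and>
    (\<forall>\<rho>\<in>set R1. \<exists>\<rho>'\<in>set R2. rule_match idF idV \<rho> \<rho>') \<and>
    (\<forall>\<rho>'\<in>set R2. \<exists>\<rho>\<in>set R1. rule_match idF idV \<rho> \<rho>') \<and>
    (set R1 \<noteq> {} \<longrightarrow>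
      (if idF then set F1 = set F2
       else \<forall>a. card {i. i < length F1 \<and> snd (F1 ! i) = a} = card {i. i < length F2 \<and> snd (F2 ! i) = a}) \<and>
      (if idV then set V1 = set V2 else card (set V1) = card (set V2)))"
proof -
  define SS where "SS = rep_blocks (F1, V1, R1) @ rep_blocks (F2, V2, R2)"
  interpret blocks SS
    by unfold_locales (auto simp: SS_def intro: balanced_rep_blocks)
  have W: "enc_pair ((F1, V1, R1), (F2, V2, R2)) = W"
    by (simp only: W_def) (simp only: SS_def enc_pair_blocks)
  have SS: "SS ! 0 = map enc_sig F1" "SS ! 1 = map enc_nat V1" "SS ! 2 = map enc_rule R1"
    "SS ! 3 = map enc_sig F2" "SS ! 4 = map enc_nat V2" "SS ! 5 = map enc_rule R2" "length SS = 6"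
    by (simp_all add: SS_def rep_blocks_def)
  have all_in: "(\<forall>i<length xs. Q (xs ! i)) \<longleftrightarrow> (\<forall>x\<in>set xs. Q x)" for xs :: "'b list" and Q
    by (simp add: all_set_conv_all_nth)
  have ex_in: "(\<exists>i<length xs. Q (xs ! i)) \<longleftrightarrow> (\<exists>x\<in>set xs. Q x)" for xs :: "'b list" and Q
    unfolding Bex_def in_set_conv_nth by blast
  have lR: "located W (pos 2 i) (enc_rule (R1 ! i))" if "i < length R1" for i
    using located_W[of 2 i] SS that by simp
  have lR': "located W (pos 5 i) (enc_rule (R2 ! i))" if "i < length R2" for i
    using located_W[of 5 i] SS that by simp
  \<comment> \<open>The empty suffix brings the item into the form of
    \<open>same_num_located\<close>.\<close>
  have lV: "located W (pos 1 i) (enc_nat (V1 ! i) @ [])" if "i < length V1" for i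
    using located_W[of 1 i] SS that by simp
  have lV': "located W (pos 4 i) (enc_nat (V2 ! i) @ [])" if "i < length V2" for i
    using located_W[of 4 i] SS that by simp
  have lF: "located W (pos 0 i) (enc_nat (fst (F1 ! i)) @ enc_nat (snd (F1 ! i)))" if "i < length F1" for i
    using located_W[of 0 i] SS that by (simp add: enc_sig_def case_prod_beta)
  have lF': "located W (pos 3 i) (enc_nat (fst (F2 ! i)) @ enc_nat (snd (F2 ! i)))" if "i < length F2" for i
    using located_W[of 3 i] SS that by (simp add: enc_sig_def case_prod_beta)
  have marks: "(\<forall>p<length W. mark 0 W p \<longrightarrow> Q p) \<longleftrightarrow> (\<forall>i<length F1. Q (pos 0 i))"
    "(\<forall>p<length W. mark 1 W p \<longrightarrow> Q p) \<longleftrightarrow> (\<forall>i<length V1. Q (pos 1 i))"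
    "(\<forall>p<length W. mark 2 W p \<longrightarrow> Q p) \<longleftrightarrow> (\<forall>i<length R1. Q (pos 2 i))"
    "(\<forall>p<length W. mark 3 W p \<longrightarrow> Q p) \<longleftrightarrow> (\<forall>i<length F2. Q (pos 3 i))"
    "(\<forall>p<length W. mark 4 W p \<longrightarrow> Q p) \<longleftrightarrow> (\<forall>i<length V2. Q (pos 4 i))"
    "(\<forall>p<length W. mark 5 W p \<longrightarrow> Q p) \<longleftrightarrow> (\<forall>i<length R2. Q (pos 5 i))"
    "(\<exists>p<length W. mark 0 W p \<and> Q p) \<longleftrightarrow> (\<exists>i<length F1. Q (pos 0 i))"
    "(\<exists>p<length W. mark 1 W p \<and> Q p) \<longleftrightarrow> (\<exists>i<length V1. Q (pos 1 i))"
    "(\<exists>p<length W. mark 2 W p \<and> Q p) \<longleftrightarrow> (\<exists>i<length R1. Q (pos 2 i))"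
    "(\<exists>p<length W. mark 3 W p \<and> Q p) \<longleftrightarrow> (\<exists>i<length F2. Q (pos 3 i))"
    "(\<exists>p<length W. mark 4 W p \<and> Q p) \<longleftrightarrow> (\<exists>i<length V2. Q (pos 4 i))"
    "(\<exists>p<length W. mark 5 W p \<and> Q p) \<longleftrightarrow> (\<exists>i<length R2. Q (pos 5 i))" for Q
    using all_marks[of 0 Q] all_marks[of 1 Q] all_marks[of 2 Q] all_marks[of 3 Q] all_marks[of 4 Q] all_marks[of 5 Q]
      ex_marks[of 0 Q] ex_marks[of 1 Q] ex_marks[of 2 Q] ex_marks[of 3 Q] ex_marks[of 4 Q] ex_marks[of 5 Q] SS
    by simp_all
  have cards: "card {p. p < length W \<and> (mark 0 W p \<and> Q p)} = card {i. i < length F1 \<and> Q (pos 0 i)}"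
    "card {p. p < length W \<and> (mark 1 W p \<and> Q p)} = card {i. i < length V1 \<and> Q (pos 1 i)}"
    "card {p. p < length W \<and> (mark 3 W p \<and> Q p)} = card {i. i < length F2 \<and> Q (pos 3 i)}"
    "card {p. p < length W \<and> (mark 4 W p \<and> Q p)} = card {i. i < length V2 \<and> Q (pos 4 i)}" for Q
    using card_marks[of 0 Q] card_marks[of 1 Q] card_marks[of 3 Q] card_marks[of 4 Q] SS by simp_all
  have nf: "(\<forall>p<length W. \<forall>q<length W. mark 2 W p \<longrightarrow> mark 2 W q \<longrightarrow> item_match idF idV W p q \<longrightarrow> item_match True True W p q)
    \<longleftrightarrow> (\<forall>\<rho>\<in>set R1. \<forall>\<rho>'\<in>set R1. rule_match idF idV \<rho> \<rho>' \<longrightarrow> \<rho> = \<rho>')"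
  proof -
    \<comment> \<open>Each guard is moved next to its quantifier, where \<open>marks\<close>
      applies.\<close>
    have "(\<forall>p<length W. \<forall>q<length W. mark 2 W p \<longrightarrow> mark 2 W q \<longrightarrow> item_match idF idV W p q \<longrightarrow> item_match True True W p q)
      \<longleftrightarrow> (\<forall>p<length W. mark 2 W p \<longrightarrow> (\<forall>q<length W. mark 2 W q \<longrightarrow> item_match idF idV W p q \<longrightarrow> item_match True True W p q))"
      by blast
    also have "\<dots> \<longleftrightarrow> (\<forall>i<length R1. \<forall>k<length R1. item_match idF idV W (pos 2 i) (pos 2 k) \<longrightarrow> item_match True True W (pos 2 i) (pos 2 k))"
      unfolding marks ..
    also have "\<dots> \<longleftrightarrow> (\<forall>i<length R1. \<forall>k<length R1. rule_match idF idV (R1 ! i) (R1 ! k) \<longrightarrow> R1 ! i = R1 ! k)"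
      by (simp add: item_match_iff[OF lR lR] rule_match_True)
    finally show ?thesis unfolding all_set_conv_all_nth .
  qed
  have nf': "(\<forall>p<length W. \<forall>q<length W. mark 5 W p \<longrightarrow> mark 5 W q \<longrightarrow> item_match idF idV W p q \<longrightarrow> item_match True True W p q)
    \<longleftrightarrow> (\<forall>\<rho>\<in>set R2. \<forall>\<rho>'\<in>set R2. rule_match idF idV \<rho> \<rho>' \<longrightarrow> \<rho> = \<rho>')"
  proof -
    have "(\<forall>p<length W. \<forall>q<length W. mark 5 W p \<longrightarrow> mark 5 W q \<longrightarrow> item_match idF idV W p q \<longrightarrow> item_match True True W p q)
      \<longleftrightarrow> (\<forall>p<length W. mark 5 W p \<longrightarrow> (\<forall>q<length W. mark 5 W q \<longrightarrow> item_match idF idV W p q \<longrightarrow> item_match True True W p q))"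
      by blast
    also have "\<dots> \<longleftrightarrow> (\<forall>i<length R2. \<forall>k<length R2. item_match idF idV W (pos 5 i) (pos 5 k) \<longrightarrow> item_match True True W (pos 5 i) (pos 5 k))"
      unfolding marks ..
    also have "\<dots> \<longleftrightarrow> (\<forall>i<length R2. \<forall>k<length R2. rule_match idF idV (R2 ! i) (R2 ! k) \<longrightarrow> R2 ! i = R2 ! k)"
      by (simp add: item_match_iff[OF lR' lR'] rule_match_True)
    finally show ?thesis unfolding all_set_conv_all_nth .
  qed
  have fwd: "(\<forall>p<length W. mark 2 W p \<longrightarrow> (\<exists>q<length W. mark 5 W q \<and> item_match idF idV W p q))
    \<longleftrightarrow> (\<forall>\<rho>\<in>set R1. \<exists>\<rho>'\<in>set R2. rule_match idF idV \<rho> \<rho>')"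
    unfolding marks all_in[symmetric] ex_in[symmetric]
    by (simp add: item_match_iff[OF lR lR'] cong: conj_cong)
  have bwd: "(\<forall>q<length W. mark 5 W q \<longrightarrow> (\<exists>p<length W. mark 2 W p \<and> item_match idF idV W p q))
    \<longleftrightarrow> (\<forall>\<rho>'\<in>set R2. \<exists>\<rho>\<in>set R1. rule_match idF idV \<rho> \<rho>')"
    unfolding marks all_in[symmetric] ex_in[symmetric]
    by (simp add: item_match_iff[OF lR lR'] cong: conj_cong)
  have ne: "(\<exists>p<length W. mark 2 W p) \<longleftrightarrow> set R1 \<noteq> {}"
    using marks(9)[of "\<lambda>_. True"] by auto
  have vars: "vars_compatible idV W \<longleftrightarrow> (if idV then set V1 = set V2 else card (set V1) = card (set V2))"
  proof (cases idV)
    case True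
    have "vars_compatible idV W \<longleftrightarrow> (\<forall>i<length V1. \<exists>k<length V2. V1 ! i = V2 ! k) \<and> (\<forall>k<length V2. \<exists>i<length V1. V1 ! i = V2 ! k)"
      unfolding vars_compatible_def marks using True same_num_located[OF lV lV'] by (simp cong: conj_cong)
    also have "\<dots> \<longleftrightarrow> set V1 = set V2" by (rule nth_subsets)
    finally show ?thesis using True by simp
  next
    case False
    have "pos 1 k < pos 1 i \<longleftrightarrow> k < i" if "k < length V1" "i < length V1" for i k
      using pos_less_iff[of k 1 i] that SS by simp
    then have 1: "{i. i < length V1 \<and> (\<forall>k<length V1. pos 1 k < pos 1 i \<longrightarrow> \<not> same_num W (pos 1 k) (pos 1 i))} =
      {i. i < length V1 \<and> (\<forall>k<length V1. k < i \<longrightarrow> V1 ! k \<noteq> V1 ! i)}"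
      using same_num_located[OF lV lV] by auto
    have "pos 4 k < pos 4 i \<longleftrightarrow> k < i" if "k < length V2" "i < length V2" for i k
      using pos_less_iff[of k 4 i] that SS by simp
    then have 2: "{i. i < length V2 \<and> (\<forall>k<length V2. pos 4 k < pos 4 i \<longrightarrow> \<not> same_num W (pos 4 k) (pos 4 i))} =
      {i. i < length V2 \<and> (\<forall>k<length V2. k < i \<longrightarrow> V2 ! k \<noteq> V2 ! i)}"
      by (auto simp: same_num_located[OF lV' lV'])
    show ?thesis unfolding vars_compatible_def marks cards 1 2 card_first_occurrences using False by simp
  qed
  have funs: "funs_compatible idF W \<longleftrightarrow> (if idF then set F1 = set F2
       else \<forall>a. card {i. i < length F1 \<and> snd (F1 ! i) = a} = card {i. i < length F2 \<and> snd (F2 ! i) = a})"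
  proof (cases idF)
    case True
    have e: "same_num W (pos 0 i) (pos 3 k) \<and> same_arity W (pos 0 i) (pos 3 k) \<longleftrightarrow> F1 ! i = F2 ! k"
      if "i < length F1" "k < length F2" for i k
      using same_num_located[OF lF lF'] same_arity_located[OF lF lF'] that by (simp add: prod_eq_iff)
    have "funs_compatible idF W \<longleftrightarrow> (\<forall>i<length F1. \<exists>k<length F2. F1 ! i = F2 ! k) \<and> (\<forall>k<length F2. \<exists>i<length F1. F1 ! i = F2 ! k)"
      unfolding funs_compatible_def marks using True e by (simp cong: conj_cong)
    also have "\<dots> \<longleftrightarrow> set F1 = set F2" by (rule nth_subsets)
    finally show ?thesis using True by simp
  next
    case False
    let ?c1 = "\<lambda>a. card {i. i < length F1 \<and> snd (F1 ! i) = a}" and ?c2 = "\<lambda>a. card {i. i < length F2 \<and> snd (F2 ! i) = a}"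
    have c: "{i. i < length F1 \<and> same_arity W (pos 0 i) (pos 0 r)} = {i. i < length F1 \<and> snd (F1 ! i) = snd (F1 ! r)}"
      "{i. i < length F2 \<and> same_arity W (pos 3 i) (pos 0 r)} = {i. i < length F2 \<and> snd (F2 ! i) = snd (F1 ! r)}"
      if "r < length F1" for r
      using that by (auto simp: same_arity_located[OF lF lF] same_arity_located[OF lF' lF])
    have c': "{i. i < length F1 \<and> same_arity W (pos 0 i) (pos 3 r)} = {i. i < length F1 \<and> snd (F1 ! i) = snd (F2 ! r)}"
      "{i. i < length F2 \<and> same_arity W (pos 3 i) (pos 3 r)} = {i. i < length F2 \<and> snd (F2 ! i) = snd (F2 ! r)}"
      if "r < length F2" for r
      using that by (auto simp: same_arity_located[OF lF lF'] same_arity_located[OF lF' lF'])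
    have "funs_compatible idF W \<longleftrightarrow> (\<forall>r<length W. mark 0 W r \<longrightarrow>
        card {p. p < length W \<and> (mark 0 W p \<and> same_arity W p r)} = card {p. p < length W \<and> (mark 3 W p \<and> same_arity W p r)}) \<and>
      (\<forall>r<length W. mark 3 W r \<longrightarrow>
        card {p. p < length W \<and> (mark 0 W p \<and> same_arity W p r)} = card {p. p < length W \<and> (mark 3 W p \<and> same_arity W p r)})"
      unfolding funs_compatible_def using False by auto
    also have "\<dots> \<longleftrightarrow> (\<forall>r<length F1. ?c1 (snd (F1 ! r)) = ?c2 (snd (F1 ! r))) \<and> (\<forall>r<length F2. ?c1 (snd (F2 ! r)) = ?c2 (snd (F2 ! r)))"
      unfolding marks cards using c c' by simp
    also have "\<dots> \<longleftrightarrow> (\<forall>a. ?c1 a = ?c2 a)"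
    proof (intro iffI allI)
      fix a assume *: "(\<forall>r<length F1. ?c1 (snd (F1 ! r)) = ?c2 (snd (F1 ! r))) \<and> (\<forall>r<length F2. ?c1 (snd (F2 ! r)) = ?c2 (snd (F2 ! r)))"
      show "?c1 a = ?c2 a"
      proof (cases "\<exists>r. r < length F1 \<and> snd (F1 ! r) = a \<or> r < length F2 \<and> snd (F2 ! r) = a")
        case False
        \<comment> \<open>An arity that occurs in neither list has count zero on both sides.\<close>
        then have e: "{i. i < length F1 \<and> snd (F1 ! i) = a} = {}" "{i. i < length F2 \<and> snd (F2 ! i) = a} = {}" by blast+
        show ?thesis unfolding e card.empty ..
      qed (use * in blast)
    qed blast
    finally show ?thesis using False by simp
  qed
  show ?thesis unfolding W word_iso_def nf nf' fwd bwd ne vars funs ..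
qed

section \<open>From lists of declarations to rewrite systems\<close>

lemma signature_lookup:
  assumes "distinct (map fst Fs)"
  shows "(f, a) \<in> set Fs \<longleftrightarrow> f \<in> fst ` set Fs \<and> (case map_of Fs f of Some a \<Rightarrow> a | None \<Rightarrow> 0) = a"
proof (cases "map_of Fs f")
  case None
  then have "f \<notin> fst ` set Fs" by (simp add: map_of_eq_None_iff)
  then show ?thesis by force
next
  case (Some b)
  then have "f \<in> fst ` set Fs" using map_of_SomeD by force
  moreover have "(f, a) \<in> set Fs \<longleftrightarrow> map_of Fs f = Some a" using map_of_eq_Some_iff[OF assms] by simp
  ultimately show ?thesis using Some by simp
qed

text \<open>Distinct declarations make the map from indices to symbols injective.\<close>

lemma card_arity:
  assumes "distinct (map fst Fs)"
  shows "card {i. i < length Fs \<and> snd (Fs ! i) = a} =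
    card {f \<in> fst ` set Fs. (case map_of Fs f of Some a \<Rightarrow> a | None \<Rightarrow> 0) = a}"
proof -
  let ?S = "{i. i < length Fs \<and> snd (Fs ! i) = a}"
  have "inj_on (\<lambda>i. fst (Fs ! i)) ?S"
    using nth_eq_iff_index_eq[OF assms] by (auto simp: inj_on_def)
  moreover have "(\<lambda>i. fst (Fs ! i)) ` ?S = {f. (f, a) \<in> set Fs}"
  proof (intro equalityI subsetI)
    fix f assume "f \<in> {f. (f, a) \<in> set Fs}"
    then obtain i where "i < length Fs" "Fs ! i = (f, a)" by (auto simp: in_set_conv_nth)
    then show "f \<in> (\<lambda>i. fst (Fs ! i)) ` ?S" by (intro image_eqI[of _ _ i]) simp_all
  next
    fix f assume "f \<in> (\<lambda>i. fst (Fs ! i)) ` ?S"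
    then obtain i where i: "i < length Fs" "snd (Fs ! i) = a" "f = fst (Fs ! i)" by blast
    then have "(f, a) = Fs ! i" by (simp add: prod_eq_iff)
    then show "f \<in> {f. (f, a) \<in> set Fs}" using i(1) by simp
  qed
  ultimately show ?thesis using card_image[of "\<lambda>i. fst (Fs ! i)" ?S] signature_lookup[OF assms] by simp
qed

lemma word_iso_correct:
  assumes "valid_rep x1" "valid_rep x2"
  shows "word_iso (m = LVE) (m = LFE) (enc_pair (x1, x2)) \<longleftrightarrow> trs_iso m (abs_rep x1) (abs_rep x2)"
proof -
  obtain F1 V1 R1 where x1: "x1 = (F1, V1, R1)" by (cases x1)
  obtain F2 V2 R2 where x2: "x2 = (F2, V2, R2)" by (cases x2)
  let ?ar = "\<lambda>Fs f. case map_of Fs f of Some a \<Rightarrow> a | None \<Rightarrow> (0::nat)"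
  have d: "distinct (map fst F1)" "distinct (map fst F2)" and T: "is_trs (abs_rep x1)" "is_trs (abs_rep x2)"
    using assms by (auto simp: valid_rep_def x1 x2)
  have R: "rules (abs_rep x1) = set R1" "rules (abs_rep x2) = set R2"
    by (simp_all add: rules_def abs_rep_def x1 x2)
  \<comment> \<open>With distinct symbols a signature list is determined as a set by its symbols and
    their arities, so comparing declarations is comparing signatures.\<close>
  have "set F1 = set F2 \<longleftrightarrow> fst ` set F1 = fst ` set F2 \<and> (\<forall>f\<in>fst ` set F1. ?ar F2 f = ?ar F1 f)"
  proof
    assume *: "set F1 = set F2"
    have "?ar F2 f = ?ar F1 f" if "f \<in> fst ` set F1" for f
      using signature_lookup[OF d(1), of f "?ar F1 f"] signature_lookup[OF d(2), of f "?ar F1 f"] that * by simp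
    then show "fst ` set F1 = fst ` set F2 \<and> (\<forall>f\<in>fst ` set F1. ?ar F2 f = ?ar F1 f)" using * by simp
  next
    assume *: "fst ` set F1 = fst ` set F2 \<and> (\<forall>f\<in>fst ` set F1. ?ar F2 f = ?ar F1 f)"
    have "(f, a) \<in> set F1 \<longleftrightarrow> (f, a) \<in> set F2" for f a
      unfolding signature_lookup[OF d(1)] signature_lookup[OF d(2)] using * by metis
    then show "set F1 = set F2" by (simp add: set_eq_iff split_paired_All)
  qed
  then have "compatible m (abs_rep x1) (abs_rep x2) \<longleftrightarrow>
      (if m = LVE then set F1 = set F2
       else \<forall>a. card {i. i < length F1 \<and> snd (F1 ! i) = a} = card {i. i < length F2 \<and> snd (F2 ! i) = a}) \<and>
      (if m = LFE then set V1 = set V2 else card (set V1) = card (set V2))"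
    unfolding compatible_def abs_rep_def x1 x2 card_arity[OF d(1)] card_arity[OF d(2)] by simp
  then show ?thesis
    unfolding trs_iso_iff[OF T] R unfolding x1 x2 word_iso_enc_pair by simp
qed

lemma trs_iso_poly_time:
  "poly_time_decidable (\<lambda>(x1, x2). valid_rep x1 \<and> valid_rep x2) enc_pair
     (\<lambda>(x1, x2). trs_iso m (abs_rep x1) (abs_rep x2))"
proof (rule dec_poly_time_decidable[OF dec_word_iso[of 0 "m = LVE" "m = LFE"]])
  fix x :: "trs_rep \<times> trs_rep"
  assume *: "case x of (x1, x2) \<Rightarrow> valid_rep x1 \<and> valid_rep x2"
  obtain x1 x2 where x: "x = (x1, x2)" by (cases x)
  have "enc_pair x \<noteq> []"
    by (cases x1; cases x2) (simp add: x enc_pair_blocks rep_blocks_def blk_def)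
  moreover have "word_iso (m = LVE) (m = LFE) (enc_pair x) \<longleftrightarrow> (case x of (x1, x2) \<Rightarrow> trs_iso m (abs_rep x1) (abs_rep x2))"
    using word_iso_correct[of x1 x2 m] * by (simp add: x)
  ultimately show "set (enc_pair x) \<subseteq> {1..7} \<and> enc_pair x \<noteq> [] \<and>
      (word_iso (m = LVE) (m = LFE) (enc_pair x) \<longleftrightarrow> (case x of (x1, x2) \<Rightarrow> trs_iso m (abs_rep x1) (abs_rep x2)))"
    using set_enc_pair by blast
qed

theorem mainTheorem10:
  shows "poly_time_decidable (\<lambda>(x1, x2). valid_rep x1 \<and> valid_rep x2) enc_pair
           (\<lambda>(x1, x2). trs_iso LE (abs_rep x1) (abs_rep x2))
       \<and> poly_time_decidable (\<lambda>(x1, x2). valid_rep x1 \<and> valid_rep x2) enc_pair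
           (\<lambda>(x1, x2). trs_iso LVE (abs_rep x1) (abs_rep x2))
       \<and> poly_time_decidable (\<lambda>(x1, x2). valid_rep x1 \<and> valid_rep x2) enc_pair
           (\<lambda>(x1, x2). trs_iso LFE (abs_rep x1) (abs_rep x2))"
  by (intro conjI trs_iso_poly_time)

end
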